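(* There exists $\varepsilon_0>0$ such that for every $0<\varepsilon<\varepsilon_0$ the following holds. If $u\in H^2(S^3)$, $u>0$, is a minimizer of the functional $\varphi\mapsto\Vert\varphi^{-1}\Vert_{L^6(S^3)}^2E_\varepsilon(\varphi)$ over all $\varphi\in H^2(S^3)$ with $\varphi>0$, then $u$ is radial symmetric and decreasing with respect to some point of $S^3$; that is, there exist $e\in S^3$ and an increasing function $\phi$ on $[-1,1]$ such that $u(x)=\phi(x\cdot e)$ for all $x\in S^3$.
   Context: $S^{3}\subset\mathbb{R}^{4}$ is the unit sphere with its standard round metric, $\mu$ its volume measure, $\Delta$ the Laplace–Beltrami operator (nonpositive spectrum), and $x\cdot e$ the Euclidean dot product in $\mathbb{R}^4$. For $\varepsilon>0$ and $\varphi\in H^2(S^3)$ set $$E_\varepsilon(\varphi)=\int_{S^3}\left[(\Delta\varphi)^2-\tfrac12|\nabla\varphi|^2-\tfrac{15}{16}\varphi^2\right]d\mu+\varepsilon\int_{S^3}\varphi^2\,d\mu .$$ $H^2(S^3)$ is the real $L^2$-based Sobolev space of order 2; since $H^2(S^3)\subset C^{1/2}(S^3)$, elements are identified with their continuous representatives, and $\varphi>0$ is meant pointwise everywhere. "Increasing" means nondecreasing. *)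

theory Defs
  imports "HOL-Analysis.Analysis"
begin

text \<open>Functions on \<open>S\<^sup>3\<close> are represented by functions on \<open>\<real>\<^sup>4\<close>; their values off the unit sphere
  never matter.\<close>

abbreviation S3 :: "(real^4) set" where
  "S3 \<equiv> sphere 0 1"

text \<open>Volume measure of the round sphere. By polar coordinates, the volume of \<open>A \<subseteq> S\<^sup>3\<close> is 4 times
  the Lebesgue measure of the cone of all \<open>r x\<close> with \<open>0 < r < 1\<close> and \<open>x \<in> A\<close>.\<close>

definition mu :: "(real^4) measure" where
  "mu = scale_measure 4
     (distr (restrict_space lborel (ball 0 1 - {0})) (restrict_space borel S3) (\<lambda>x. x /\<^sub>R norm x))"

definition partial_deriv :: "4 \<Rightarrow> (real^4 \<Rightarrow> real) \<Rightarrow> real^4 \<Rightarrow> real" where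
  "partial_deriv i F x = frechet_derivative F (at x) (axis i 1)"

text \<open>Only meant for open sets \<open>U\<close>.\<close>

primrec C_k_on :: "nat \<Rightarrow> (real^4) set \<Rightarrow> (real^4 \<Rightarrow> real) \<Rightarrow> bool" where
  "C_k_on 0 U F \<longleftrightarrow> continuous_on U F"
| "C_k_on (Suc k) U F \<longleftrightarrow> F differentiable_on U \<and> (\<forall>i. C_k_on k U (partial_deriv i F))"

definition radial_ext :: "(real^4 \<Rightarrow> real) \<Rightarrow> real^4 \<Rightarrow> real" where
  "radial_ext f x = f (x /\<^sub>R norm x)"

definition smooth_S3 :: "(real^4 \<Rightarrow> real) \<Rightarrow> bool" where
  "smooth_S3 f \<longleftrightarrow> (\<forall>k. C_k_on k (- {0}) (radial_ext f))"

text \<open>At a point of the sphere, the Euclidean gradient of the radially constant extension is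
  tangential, hence equal to the Riemannian gradient.\<close>

definition grad_S3 :: "(real^4 \<Rightarrow> real) \<Rightarrow> real^4 \<Rightarrow> real^4" where
  "grad_S3 f x = (\<chi> i. partial_deriv i (radial_ext f) x)"

text \<open>The second fundamental form of the sphere is normal and the radial derivative of the extension
  vanishes, so the covariant Hessian is the Euclidean Hessian of the extension, restricted to the
  tangent space. It is represented by a 4 by 4 matrix vanishing on the normal direction, so that its
  Frobenius norm and its trace are the Riemannian ones.\<close>

definition tangent_proj :: "real^4 \<Rightarrow> real^4^4" where
  "tangent_proj x = mat 1 - (\<chi> i j. x $ i * x $ j)"

definition hess_S3 :: "(real^4 \<Rightarrow> real) \<Rightarrow> real^4 \<Rightarrow> real^4^4" where
  "hess_S3 f x = tangent_proj x
     ** (\<chi> i j. partial_deriv i (partial_deriv j (radial_ext f)) x) ** tangent_proj x"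

text \<open>Convergence in \<open>L\<^sup>2(S\<^sup>3)\<close>. The extended integral is used because the Bochner integral of a
  non-integrable function is 0.\<close>

definition L2_tendsto :: "(nat \<Rightarrow> real^4 \<Rightarrow> 'a::euclidean_space) \<Rightarrow> (real^4 \<Rightarrow> 'a) \<Rightarrow> bool" where
  "L2_tendsto f g \<longleftrightarrow> g \<in> borel_measurable mu \<and>
     (\<lambda>n. \<integral>\<^sup>+x. ennreal ((norm (f n x - g x))\<^sup>2) \<partial>mu) \<longlonglongrightarrow> 0"

text \<open>\<open>H\<^sup>2(S\<^sup>3)\<close> is the completion of the smooth functions under the norm given by the \<open>L\<^sup>2\<close> norms of
  the function, its gradient and its covariant Hessian; \<open>V\<close> and \<open>T\<close> are the weak gradient and weak
  Hessian of \<open>\<phi>\<close>, which are unique up to null sets.\<close>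

definition has_weak_derivs :: "(real^4 \<Rightarrow> real) \<Rightarrow> (real^4 \<Rightarrow> real^4) \<Rightarrow> (real^4 \<Rightarrow> real^4^4) \<Rightarrow> bool"
  where
  "has_weak_derivs \<phi> V T \<longleftrightarrow> (\<exists>f. (\<forall>n. smooth_S3 (f n)) \<and>
     L2_tendsto f \<phi> \<and> L2_tendsto (\<lambda>n. grad_S3 (f n)) V \<and> L2_tendsto (\<lambda>n. hess_S3 (f n)) T)"

text \<open>Elements of \<open>H\<^sup>2(S\<^sup>3)\<close> are identified with their continuous representatives.\<close>

definition H2 :: "(real^4 \<Rightarrow> real) set" where
  "H2 = {\<phi>. continuous_on S3 \<phi> \<and> (\<exists>V T. has_weak_derivs \<phi> V T)}"

definition weak_grad :: "(real^4 \<Rightarrow> real) \<Rightarrow> real^4 \<Rightarrow> real^4" where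
  "weak_grad \<phi> = (SOME V. \<exists>T. has_weak_derivs \<phi> V T)"

definition weak_hess :: "(real^4 \<Rightarrow> real) \<Rightarrow> real^4 \<Rightarrow> real^4^4" where
  "weak_hess \<phi> = (SOME T. \<exists>V. has_weak_derivs \<phi> V T)"

definition laplacian :: "(real^4 \<Rightarrow> real) \<Rightarrow> real^4 \<Rightarrow> real" where
  "laplacian \<phi> x = trace (weak_hess \<phi> x)"

definition Lp_norm :: "real \<Rightarrow> (real^4 \<Rightarrow> real) \<Rightarrow> real" where
  "Lp_norm p f = (\<integral>x. \<bar>f x\<bar> powr p \<partial>mu) powr (1 / p)"

definition E :: "real \<Rightarrow> (real^4 \<Rightarrow> real) \<Rightarrow> real" where
  "E \<epsilon> \<phi> = (\<integral>x. (laplacian \<phi> x)\<^sup>2 - 1/2 * (norm (weak_grad \<phi> x))\<^sup>2 - 15/16 * (\<phi> x)\<^sup>2 \<partial>mu)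
     + \<epsilon> * (\<integral>x. (\<phi> x)\<^sup>2 \<partial>mu)"

definition positive_H2 :: "(real^4 \<Rightarrow> real) set" where
  "positive_H2 = {\<phi> \<in> H2. \<forall>x\<in>S3. \<phi> x > 0}"

definition J :: "real \<Rightarrow> (real^4 \<Rightarrow> real) \<Rightarrow> real" where
  "J \<epsilon> \<phi> = (Lp_norm 6 (\<lambda>x. inverse (\<phi> x)))\<^sup>2 * E \<epsilon> \<phi>"

end

theory Submission
  imports Defs "HOL-Analysis.Analysis" "HOL-Real_Asymp.Real_Asymp"
begin

text \<open>
  Let \<open>P = \<Delta>\<^sup>2 + \<Delta>/2 - (15/16 - \<epsilon>)\<close>, so that \<open>E \<epsilon> \<phi>\<close> is the integral of \<open>\<phi> P\<phi>\<close>. On spherical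
  harmonics of degree \<open>k\<close> it acts, with \<open>n = k + 1\<close>, as \<open>n\<^sup>4 - 5/2 n\<^sup>2 + 9/16 + \<epsilon>\<close>, which for
  \<open>0 < \<epsilon> < 15/16\<close> is negative for \<open>k = 0\<close> and positive for all other \<open>k\<close>. In particular constants
  have negative energy, so a minimizer \<open>u\<close> has \<open>b = - E \<epsilon> u > 0\<close>. The threshold of the theorem is
  \<open>15/16\<close>.

  The operator \<open>-P\<close> has an inverse \<open>K\<close> with a zonal kernel \<open>kern \<epsilon> (x \<bullet> y)\<close>, up to normalization, and
  two properties of this kernel drive the proof: it is positive (lemma \<open>kern_pos\<close>) and it increases
  strictly with the distance of \<open>x\<close> and \<open>y\<close> (lemma \<open>kern_strict_antimono\<close>). The second one holds because
  \<open>1/(n\<^sup>4 - 5/2 n\<^sup>2 + 9/16 + \<epsilon>)\<close> is, for \<open>n \<ge> 2\<close>, the Laplace transform of a positive weight;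
  thus, up to a constant, \<open>- K\<close> is an average of Poisson operators, whose kernels decrease with the
  distance.

  Put \<open>f = u\<^sup>-\<^sup>7\<close> and \<open>N = \<integral> u\<^sup>-\<^sup>6\<close>. The Euler-Lagrange equation says that \<open>b u\<^sup>-\<^sup>7\<close> equals
  \<open>- N P u\<close> weakly; testing it with \<open>K f\<close> gives \<open>b \<integral> f K f = N\<^sup>2\<close> (lemma
  \<open>green_energy_minimizer\<close>). On the other hand, if \<open>v > 0\<close> is another function with
  \<open>\<integral> v\<^sup>-\<^sup>6 = N\<close> and \<open>g = v\<^sup>-\<^sup>7\<close>, then comparing \<open>u\<close> with the competitor \<open>K g\<close>, which is positive
  because the kernel is, and applying the reverse Hoelder inequality gives \<open>b \<integral> g K g \<ge> N\<^sup>2\<close> (lemma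
  \<open>green_energy_lower_bound\<close>). So \<open>f\<close> minimizes \<open>\<integral> f K f\<close> among its rearrangements. Polarization
  with respect to a hyperplane strictly lowers this quantity unless \<open>f\<close> and its reflection are ordered
  on a half space (lemma \<open>polarization_strict\<close>), because the kernel increases with the distance. Hence
  they are ordered for every hyperplane, and the center of mass \<open>\<integral> f(x) x\<close> tells in which way; this is
  radial monotonicity (lemma \<open>polarized_monotone\<close>).

  Apart from \<open>u\<close> itself, only smooth functions are used as elements of \<open>H2\<close>: the potentials \<open>K f\<close> and \<open>K g\<close> are replaced by
  polynomial zonal operators converging to them (lemma \<open>green_approximation\<close>). Calculus on the sphere is
  done with the three rotation fields given by quaternion multiplication; integration by parts for
  them is the rotation invariance of the measure.
\<close>

section \<open>The measure on the sphere\<close>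

lemma space_mu [simp]: "space mu = S3"
  by (simp add: mu_def space_restrict_space space_scale_measure)

lemma sets_mu: "sets mu = sets (restrict_space borel S3)"
  by (simp add: mu_def)

lemma measurable_mu_continuous:
  fixes f :: "real^4 \<Rightarrow> 'a::topological_space"
  assumes "continuous_on S3 f"
  shows "f \<in> borel_measurable mu"
  using borel_measurable_continuous_on_restrict[OF assms]
  by (simp cong: measurable_cong_sets add: sets_mu)

lemma measurable_normalise:
  "(\<lambda>x::real^4. x /\<^sub>R norm x) \<in> measurable (restrict_space lborel (ball 0 1 - {0})) (restrict_space borel S3)"
proof (rule measurable_restrict_space2)
  show "(\<lambda>x::real^4. x /\<^sub>R norm x) \<in> space (restrict_space lborel (ball 0 1 - {0})) \<rightarrow> S3"
    by (auto simp: space_restrict_space)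
  show "(\<lambda>x::real^4. x /\<^sub>R norm x) \<in> borel_measurable (restrict_space lborel (ball 0 1 - {0}))"
    by (rule measurable_restrict_space1) measurable
qed

lemma emeasure_mu:
  assumes "A \<in> sets mu"
  shows "emeasure mu A = 4 * emeasure lborel {x \<in> ball 0 1 - {0}. x /\<^sub>R norm x \<in> A}"
proof -
  have A: "A \<in> sets (restrict_space borel S3)"
    using assms by (simp add: sets_mu)
  have "(\<lambda>x. x /\<^sub>R norm x) -` A \<inter> space (restrict_space lborel (ball 0 1 - {0}))
      = {x \<in> ball 0 1 - {0}. x /\<^sub>R norm x \<in> A}"
    by (auto simp: space_restrict_space)
  then show ?thesis
    unfolding mu_def using A measurable_normalise
    by (simp add: emeasure_distr) (subst emeasure_restrict_space, auto)
qed

lemma finite_measure_mu: "finite_measure mu"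
proof
  have "emeasure lborel {x \<in> ball 0 1 - {0::real^4}. x /\<^sub>R norm x \<in> S3} \<le> emeasure lborel (ball (0::real^4) 1)"
    by (rule emeasure_mono) auto
  also have "\<dots> < \<infinity>"
    using emeasure_bounded_finite[of "ball (0::real^4) 1"] by auto
  finally show "emeasure mu (space mu) \<noteq> \<infinity>"
    using sets.top[of mu] by (simp add: emeasure_mu ennreal_mult_eq_top_iff)
qed

interpretation mu: finite_measure mu
  by (rule finite_measure_mu)

lemma continuous_compact_bound:
  fixes f :: "'a::topological_space \<Rightarrow> real"
  assumes "compact S" "continuous_on S f"
  obtains B where "B > 0" "\<And>x. x \<in> S \<Longrightarrow> \<bar>f x\<bar> \<le> B"
proof -
  have "bounded (f ` S)" by (intro compact_imp_bounded compact_continuous_image assms)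
  then obtain B where B: "\<forall>z\<in>f ` S. norm z \<le> B" unfolding bounded_iff by blast
  have "\<bar>f x\<bar> \<le> max B 1" if "x \<in> S" for x using B that by fastforce
  then show ?thesis by (intro that[of "max B 1"]) auto
qed

lemma emeasure_lborel_open_pos:
  fixes U :: "'a::euclidean_space set"
  assumes "open U" "U \<noteq> {}"
  shows "emeasure lborel U > 0"
proof (rule ccontr)
  assume "\<not> emeasure lborel U > 0"
  then have "U \<in> null_sets lborel"
    using assms by (auto simp: null_sets_def)
  then have "negligible U"
    by (simp add: negligible_iff_null_sets null_sets_completionI)
  then show False
    using assms open_not_negligible by blast
qed

lemma integrable_mu_continuous:
  fixes f :: "real^4 \<Rightarrow> 'a::euclidean_space"
  assumes "continuous_on S3 f"
  shows "integrable mu f"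
proof -
  have "compact (f ` S3)"
    by (intro compact_continuous_image assms compact_sphere)
  then obtain B where "\<And>x. x \<in> S3 \<Longrightarrow> norm (f x) \<le> B"
    using compact_imp_bounded[of "f ` S3"] unfolding bounded_iff by blast
  then show ?thesis
    by (intro mu.integrable_const_bound[of _ B] measurable_mu_continuous assms) auto
qed

text \<open>Open cones have positive Lebesgue measure, so continuous functions do not see null sets.\<close>

lemma AE_mu_continuous_eq:
  fixes f :: "real^4 \<Rightarrow> real"
  assumes cont: "continuous_on S3 f" and AE: "AE x in mu. f x = 0" and x: "x \<in> S3"
  shows "f x = 0"
proof (rule ccontr)
  assume nz: "f x \<noteq> 0"
  define N where "N = {y \<in> space mu. f y \<noteq> 0}"
  have mN: "N \<in> sets mu"
    unfolding N_def using measurable_mu_continuous[OF cont] by measurable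
  have "emeasure mu N = 0"
    using AE mN unfolding N_def by (auto simp: AE_iff_measurable[OF mN[unfolded N_def] refl])
  then have 0: "emeasure lborel {y \<in> ball 0 1 - {0}. y /\<^sub>R norm y \<in> N} = 0"
    using emeasure_mu[OF mN] by auto
  have "{y \<in> ball 0 1 - {0}. y /\<^sub>R norm y \<in> N} = (ball 0 1 - {0}) \<inter> (\<lambda>y. f (y /\<^sub>R norm y)) -` (- {0})"
    by (auto simp: N_def)
  moreover have "open \<dots>"
  proof (rule continuous_open_preimage)
    show "continuous_on (ball 0 1 - {0}) (\<lambda>y. f (y /\<^sub>R norm y))"
    proof (rule continuous_on_compose2[OF cont])
      show "continuous_on (ball 0 1 - {0}) (\<lambda>y::real^4. y /\<^sub>R norm y)"
        by (intro continuous_intros) auto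
      have "y /\<^sub>R norm y \<in> S3" if "y \<noteq> 0" for y :: "real^4" using that by simp
      then show "(\<lambda>y. y /\<^sub>R norm y) ` (ball 0 1 - {0::real^4}) \<subseteq> S3" by blast
    qed
  qed auto
  ultimately have "open {y \<in> ball 0 1 - {0}. y /\<^sub>R norm y \<in> N}" by simp
  moreover have "(1/2) *\<^sub>R x \<in> {y \<in> ball 0 1 - {0}. y /\<^sub>R norm y \<in> N}"
    using x nz by (auto simp: N_def)
  ultimately show False
    using emeasure_lborel_open_pos 0 by fastforce
qed

lemma integral_mu_nonneg_eq_0:
  fixes f :: "real^4 \<Rightarrow> real"
  assumes cont: "continuous_on S3 f" and nn: "\<And>x. x \<in> S3 \<Longrightarrow> f x \<ge> 0"
    and 0: "(\<integral>x. f x \<partial>mu) = 0" and x: "x \<in> S3"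
  shows "f x = 0"
proof (rule AE_mu_continuous_eq[OF cont _ x])
  show "AE x in mu. f x = 0"
    using integral_nonneg_eq_0_iff_AE[OF integrable_mu_continuous[OF cont] AE_I2] nn 0 by auto
qed

lemma integral_mu_pos:
  fixes f :: "real^4 \<Rightarrow> real"
  assumes cont: "continuous_on S3 f" and nn: "\<And>x. x \<in> S3 \<Longrightarrow> f x \<ge> 0"
    and x: "x \<in> S3" "f x > 0"
  shows "(\<integral>x. f x \<partial>mu) > 0"
  using integral_mu_nonneg_eq_0[OF cont nn _ x(1)] x(2)
    integral_nonneg_AE[of f mu, OF AE_I2] nn by (fastforce simp: less_le)

definition mass :: real where "mass = measure mu S3"

lemma mass_pos: "mass > 0"
  using integral_mu_pos[of "\<lambda>_. 1" "axis 1 1"] by (auto simp: mass_def)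

subsection \<open>Orthogonal invariance\<close>

lemma emeasure_lborel_orthogonal:
  fixes R :: "real^4 \<Rightarrow> real^4"
  assumes R: "orthogonal_transformation R" and A: "A \<in> sets borel" and bd: "bounded A"
  shows "emeasure lborel (R -` A) = emeasure lborel A"
proof -
  have bij: "bij R" using R by (rule orthogonal_transformation_bij)
  define R' where "R' = inv R"
  have R': "orthogonal_transformation R'"
    unfolding R'_def by (rule orthogonal_transformation_inv[OF R])
  have eq: "R -` A = R' ` A"
    unfolding R'_def by (rule bij_vimage_eq_inv_image[OF bij])
  have Am: "A \<in> lmeasurable"
    using A bd by (intro bounded_set_imp_lmeasurable) auto
  have "continuous_on UNIV R"
    using R by (intro linear_continuous_on) (simp add: linear_linear orthogonal_transformation_linear)
  then have meas: "R -` A \<in> sets borel"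
    using A by (metis borel_measurable_continuous_onI measurable_sets_borel)
  have fin: "emeasure lborel X < \<infinity>" if "X \<in> lmeasurable" "X \<in> sets borel" for X :: "(real^4) set"
    using that by (auto simp: fmeasurable_def)
  have Bm: "R -` A \<in> lmeasurable" 
    using measurable_orthogonal_image[OF R' Am] eq by simp
  have "measure lborel (R -` A) = measure lborel A"
    using measure_orthogonal_image[OF R' Am] eq A meas by simp
  then show ?thesis
    using fin[OF Am A] fin[OF Bm meas] by (simp add: emeasure_eq_ennreal_measure)
qed

lemma orthogonal_norm: "orthogonal_transformation R \<Longrightarrow> norm (R x) = norm x"
  by (simp add: orthogonal_transformation)

lemma measurable_mu_orthogonal:
  assumes R: "orthogonal_transformation R"
  shows "R \<in> measurable mu mu"
proof -
  have "continuous_on S3 R"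
    using R by (intro linear_continuous_on) (simp add: linear_linear orthogonal_transformation_linear)
  then have "R \<in> measurable mu (restrict_space borel S3)"
    by (intro measurable_restrict_space2 measurable_mu_continuous) (use orthogonal_norm[OF R] in auto)
  then show ?thesis by (simp cong: measurable_cong_sets add: sets_mu)
qed

text \<open>The cone over a rotated set is the rotated cone.\<close>

lemma distr_mu_orthogonal:
  assumes R: "orthogonal_transformation R"
  shows "distr mu mu R = mu"
proof (rule measure_eqI)
  have lin: "linear R" using R by (rule orthogonal_transformation_linear)
  have Rm: "R \<in> measurable mu mu" by (rule measurable_mu_orthogonal[OF R])
  show "sets (distr mu mu R) = sets mu" by simp
  fix A assume "A \<in> sets (distr mu mu R)"
  then have A: "A \<in> sets mu" by simp
  let ?C = "\<lambda>A. {x \<in> ball 0 1 - {0}. x /\<^sub>R norm x \<in> A}"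
  have CA: "?C A \<in> sets borel" if "A \<in> sets mu" for A
  proof -
    have "(\<lambda>x. x /\<^sub>R norm x) -` A \<inter> space (restrict_space lborel (ball 0 1 - {0}))
       \<in> sets (restrict_space lborel (ball 0 1 - {0}))"
      by (rule measurable_sets[OF measurable_normalise]) (use that in \<open>simp only: sets_mu\<close>)
    then have "(\<lambda>x. x /\<^sub>R norm x) -` A \<inter> (ball 0 1 - {0}) \<in> sets borel"
      by (subst (asm) sets_restrict_space_iff) (auto simp: space_restrict_space)
    moreover have "(\<lambda>x. x /\<^sub>R norm x) -` A \<inter> (ball 0 1 - {0}) = ?C A" by auto
    ultimately show ?thesis by simp
  qed
  have pre: "R -` A \<inter> S3 \<in> sets mu"
    using measurable_sets[OF Rm A] by simp
  have "?C (R -` A \<inter> S3) = R -` ?C A"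
  proof (rule set_eqI)
    fix x :: "real^4"
    have "R x = 0 \<longleftrightarrow> x = 0" using orthogonal_norm[OF R, of x] by (metis norm_eq_zero)
    moreover have "x /\<^sub>R norm x \<in> S3" if "x \<noteq> 0" using that by simp
    moreover have "R (x /\<^sub>R norm x) = R x /\<^sub>R norm (R x)"
      by (simp add: linear_scale[OF lin] orthogonal_norm[OF R])
    ultimately show "x \<in> ?C (R -` A \<inter> S3) \<longleftrightarrow> x \<in> R -` ?C A"
      using orthogonal_norm[OF R, of x] by auto
  qed
  moreover have "emeasure lborel (R -` ?C A) = emeasure lborel (?C A)"
    by (rule emeasure_lborel_orthogonal[OF R CA[OF A]]) (rule bounded_subset[OF bounded_ball[of 0 1]], auto)
  ultimately show "emeasure (distr mu mu R) A = emeasure mu A"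
    using Rm A pre by (simp add: emeasure_distr emeasure_mu)
qed

lemma integral_mu_orthogonal:
  fixes f :: "real^4 \<Rightarrow> 'a::euclidean_space"
  assumes R: "orthogonal_transformation R" and f: "continuous_on S3 f"
  shows "(\<integral>x. f (R x) \<partial>mu) = (\<integral>x. f x \<partial>mu)"
proof -
  have Rm: "R \<in> measurable mu mu" by (rule measurable_mu_orthogonal[OF R])
  have "(\<integral>x. f x \<partial>mu) = (\<integral>x. f x \<partial>(distr mu mu R))"
    by (simp add: distr_mu_orthogonal[OF R])
  also have "\<dots> = (\<integral>x. f (R x) \<partial>mu)"
    by (rule integral_distr[OF Rm measurable_mu_continuous[OF f]])
  finally show ?thesis by simp
qed

lemma continuous_on_integral_mu:
  fixes F :: "'a::metric_space \<Rightarrow> real^4 \<Rightarrow> real"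
  assumes cont: "continuous_on (X \<times> S3) (\<lambda>(x, y). F x y)"
    and bd: "\<And>x y. x \<in> X \<Longrightarrow> y \<in> S3 \<Longrightarrow> \<bar>F x y\<bar> \<le> B"
  shows "continuous_on X (\<lambda>x. \<integral>y. F x y \<partial>mu)"
  unfolding continuous_on_sequentially
proof (intro allI ballI impI)
  fix s a assume a: "a \<in> X" and s: "(\<forall>n. s n \<in> X) \<and> s \<longlonglongrightarrow> a"
  have cy: "continuous_on S3 (F x)" if "x \<in> X" for x
  proof -
    have "continuous_on S3 (\<lambda>y. (\<lambda>(x, y). F x y) (x, y))"
      by (rule continuous_on_compose2[OF cont, of S3 "Pair x"])
        (use that in \<open>auto intro!: continuous_on_Pair continuous_on_const continuous_on_id\<close>)
    then show ?thesis by simp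
  qed
  show "((\<lambda>x. \<integral>y. F x y \<partial>mu) \<circ> s) \<longlonglongrightarrow> (\<integral>y. F a y \<partial>mu)"
    unfolding o_def
  proof (rule integral_dominated_convergence[where w="\<lambda>_. B"])
    show "F a \<in> borel_measurable mu" "\<And>i. F (s i) \<in> borel_measurable mu"
      using a s cy by (auto intro!: measurable_mu_continuous)
    show "AE x in mu. (\<lambda>i. F (s i) x) \<longlonglongrightarrow> F a x"
    proof (rule AE_I2)
      fix y assume y: "y \<in> space mu"
      have "(\<lambda>i. (\<lambda>(x, y). F x y) (s i, y)) \<longlonglongrightarrow> (\<lambda>(x, y). F x y) (a, y)"
        by (rule continuous_on_tendsto_compose[OF cont])
          (use a s y in \<open>auto intro!: tendsto_Pair\<close>)
      then show "(\<lambda>i. F (s i) y) \<longlonglongrightarrow> F a y" by simp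
    qed
    show "AE y in mu. norm (F (s i) y) \<le> B" for i
      by (rule AE_I2) (use bd s in simp)
  qed simp
qed

section \<open>Rotation fields and integration by parts\<close>

text \<open>Multiplication by the three quaternion units. At a point of the sphere the three values form an
  orthonormal basis of the tangent space.\<close>

definition quat :: "3 \<Rightarrow> real^4 \<Rightarrow> real^4" where
  "quat a x =
    (if a = 1 then (\<chi> i. if i = 1 then - x$2 else if i = 2 then x$1 else if i = 3 then - x$4 else x$3)
     else if a = 2 then (\<chi> i. if i = 1 then - x$3 else if i = 2 then x$4 else if i = 3 then x$1 else - x$2)
     else (\<chi> i. if i = 1 then - x$4 else if i = 2 then - x$3 else if i = 3 then x$2 else x$1))"

lemma inner_real4: "(x::real^4) \<bullet> y = x$1 * y$1 + x$2 * y$2 + x$3 * y$3 + x$4 * y$4"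
  by (simp add: inner_vec_def sum_4)

lemma quat_linear: "linear (quat a)"
  by (rule linearI) (auto simp: quat_def vec_eq_iff algebra_simps)

lemma quat_bounded_linear: "bounded_linear (quat a)"
  using quat_linear linear_linear by blast

lemma quat_quat: "quat a (quat a x) = - x"
  using exhaust_3[of a] by (auto simp: quat_def vec_eq_iff forall_4)

lemma quat_inner_self: "quat a x \<bullet> x = 0"
  using exhaust_3[of a] by (auto simp: quat_def inner_real4)

lemma quat_norm: "norm (quat a x) = norm x"
  using exhaust_3[of a] by (auto simp: quat_def norm_eq inner_real4)

lemma quat_frame:
  "(\<Sum>a\<in>UNIV. (quat a x \<bullet> y) * (quat a x \<bullet> z)) = (x \<bullet> x) * (y \<bullet> z) - (x \<bullet> y) * (x \<bullet> z)"
  by (simp add: sum_3 quat_def inner_real4 algebra_simps)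

lemma continuous_on_quat [continuous_intros]:
  "continuous_on X f \<Longrightarrow> continuous_on X (\<lambda>x. quat a (f x))"
  by (rule bounded_linear.continuous_on[OF quat_bounded_linear])

text \<open>The flow of the field \<open>quat a\<close>: since \<open>quat a\<close> squares to \<open>-1\<close>, this is its exponential.\<close>

definition rot :: "3 \<Rightarrow> real \<Rightarrow> real^4 \<Rightarrow> real^4" where
  "rot a t x = cos t *\<^sub>R x + sin t *\<^sub>R quat a x"

lemma rot_norm: "norm (rot a t x) = norm x"
proof -
  have "(norm (rot a t x))\<^sup>2 = (cos t)\<^sup>2 * (norm x)\<^sup>2 + (sin t)\<^sup>2 * (norm x)\<^sup>2"
    unfolding rot_def power2_norm_eq_inner using quat_norm[of a x] quat_inner_self[of a x]
    by (simp add: inner_left_distrib inner_right_distrib inner_commute power2_eq_square norm_eq)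
  also have "\<dots> = (norm x)\<^sup>2"
    by (simp add: distrib_right[symmetric])
  finally show ?thesis by simp
qed

lemma rot_orthogonal: "orthogonal_transformation (rot a t)"
proof -
  have "linear (rot a t)"
    unfolding rot_def using quat_linear[of a]
    by (intro linear_compose_add linear_compose_scale_right linear_id[unfolded id_def]) 
  then show ?thesis
    by (simp add: orthogonal_transformation rot_norm)
qed

lemma rot_has_derivative:
  assumes "(F has_derivative F') (at (rot a t x))"
  shows "((\<lambda>t. F (rot a t x)) has_real_derivative F' (quat a (rot a t x))) (at t)"
proof -
  have "((\<lambda>t. rot a t x) has_derivative (\<lambda>h. h *\<^sub>R quat a (rot a t x))) (at t)"
    unfolding rot_def
    by (auto intro!: derivative_eq_intros simp: linear_add[OF quat_linear] linear_scale[OF quat_linear] quat_quat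
        algebra_simps)
  then have "((\<lambda>t. F (rot a t x)) has_derivative (\<lambda>h. F' (h *\<^sub>R quat a (rot a t x)))) (at t)"
    by (rule has_derivative_compose) (use assms in simp)
  moreover have "linear F'"
    using assms has_derivative_linear by blast
  ultimately show ?thesis
    by (simp add: has_field_derivative_def linear_scale mult.commute[of _ "F' _"])
qed

text \<open>The rotations generated by the field preserve the measure, so the mean of a function along the
  flow is constant; its derivative at time 0 is the integral in question.\<close>

lemma integral_rotation_derivative:
  fixes F :: "real^4 \<Rightarrow> real"
  assumes der: "\<And>x. x \<in> S3 \<Longrightarrow> (F has_derivative F' x) (at x)"
    and cont: "continuous_on S3 (\<lambda>x. F' x (quat a x))"
  shows "(\<integral>x. F' x (quat a x) \<partial>mu) = 0"
proof -
  obtain C where C: "\<And>x. x \<in> S3 \<Longrightarrow> \<bar>F' x (quat a x)\<bar> \<le> C"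
    using continuous_compact_bound[OF compact_sphere cont] by metis
  have Fc: "continuous_on S3 F"
    by (intro continuous_at_imp_continuous_on ballI has_derivative_continuous[OF der])
  have deriv: "((\<lambda>t. F (rot a t x)) has_real_derivative F' (rot a t x) (quat a (rot a t x))) (at t)"
    if "x \<in> S3" for x t
    by (rule rot_has_derivative[OF der]) (use that in \<open>simp add: rot_norm\<close>)
  define h :: "nat \<Rightarrow> real" where "h = (\<lambda>n. 1 / (real n + 1))"
  have h: "h n > 0" "h \<longlonglongrightarrow> 0" for n
    using LIMSEQ_inverse_real_of_nat by (auto simp: h_def inverse_eq_divide add.commute)
  define s where "s n x = (F (rot a (h n) x) - F x) / h n" for n x
  have rc: "continuous_on S3 (\<lambda>x. F (rot a t x))" for t
  proof (rule continuous_on_compose2[OF Fc])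
    show "continuous_on S3 (rot a t)"
      unfolding rot_def by (intro continuous_intros)
    show "rot a t ` S3 \<subseteq> S3" by (auto simp: rot_norm)
  qed
  have "(\<lambda>n. \<integral>x. s n x \<partial>mu) \<longlonglongrightarrow> (\<integral>x. F' x (quat a x) \<partial>mu)"
  proof (rule integral_dominated_convergence[where w="\<lambda>_. C"])
    show "(\<lambda>x. F' x (quat a x)) \<in> borel_measurable mu"
      by (rule measurable_mu_continuous[OF cont])
    show "s n \<in> borel_measurable mu" for n
      unfolding s_def using h(1)[of n]
      by (intro measurable_mu_continuous continuous_intros rc Fc) auto
    show "AE x in mu. (\<lambda>n. s n x) \<longlonglongrightarrow> F' x (quat a x)"
    proof (rule AE_I2)
      fix x assume x: "x \<in> space mu"
      have "((\<lambda>t. (F (rot a (0 + t) x) - F (rot a 0 x)) / t) \<longlongrightarrow> F' x (quat a x)) (at 0)"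
        using deriv[of x 0] x unfolding DERIV_def by (simp add: rot_def)
      then have "(\<lambda>n. (F (rot a (0 + h n) x) - F (rot a 0 x)) / h n) \<longlonglongrightarrow> F' x (quat a x)"
        by (rule filterlim_compose) (use h in \<open>auto simp: filterlim_at less_imp_neq[symmetric] eventually_sequentially\<close>)
      then show "(\<lambda>n. s n x) \<longlonglongrightarrow> F' x (quat a x)"
        by (simp add: s_def rot_def)
    qed
    show "AE x in mu. norm (s n x) \<le> C" for n
    proof (rule AE_I2)
      fix x assume x: "x \<in> space mu"
      obtain z where "F (rot a (h n) x) - F (rot a 0 x) = (h n - 0) * F' (rot a z x) (quat a (rot a z x))"
        using MVT2[OF h(1)[of n] deriv] x by auto
      then have "s n x = F' (rot a z x) (quat a (rot a z x))"
        using h(1)[of n] by (simp add: s_def rot_def)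
      then show "norm (s n x) \<le> C"
        using C[of "rot a z x"] x by (simp add: rot_norm)
    qed
  qed simp
  moreover have "(\<integral>x. s n x \<partial>mu) = 0" for n
    unfolding s_def using integral_mu_orthogonal[OF rot_orthogonal Fc, of a "h n"]
    by (simp add: integrable_mu_continuous rc Fc)
  ultimately show ?thesis
    by (simp add: LIMSEQ_const_iff)
qed

section \<open>Smooth functions off the origin\<close>

lemma partial_deriv_eq: "(F has_derivative F') (at x) \<Longrightarrow> partial_deriv i F x = F' (axis i 1)"
  by (simp add: partial_deriv_def frechet_derivative_at[symmetric])

lemma has_derivative_on_open:
  "F differentiable_on U \<Longrightarrow> open U \<Longrightarrow> x \<in> U \<Longrightarrow> (F has_derivative frechet_derivative F (at x)) (at x)"
  by (meson differentiable_on_eq_differentiable_at frechet_derivative_works)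

lemma differentiable_on_openI:
  "(\<And>x. x \<in> U \<Longrightarrow> (F has_derivative F' x) (at x)) \<Longrightarrow> F differentiable_on U"
  by (meson differentiableI differentiable_at_imp_differentiable_on)

lemma C_k_on_cong:
  assumes "open U" "\<And>x. x \<in> U \<Longrightarrow> F x = G x" "C_k_on k U F"
  shows "C_k_on k U G"
  using assms(2,3)
proof (induction k arbitrary: F G)
  case 0
  then show ?case by (simp cong: continuous_on_cong)
next
  case (Suc k)
  have G: "(G has_derivative frechet_derivative F (at x)) (at x)" if "x \<in> U" for x
    by (rule has_derivative_transform_within_open[OF has_derivative_on_open[of F U] \<open>open U\<close> that])
      (use Suc that \<open>open U\<close> in auto)
  have "partial_deriv i F x = partial_deriv i G x" if "x \<in> U" for x i
    using partial_deriv_eq[OF G[OF that]] by (simp add: partial_deriv_def)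
  then have "C_k_on k U (partial_deriv i G)" for i
    using Suc.IH[of "partial_deriv i F" "partial_deriv i G"] Suc.prems by simp
  then show ?case
    using differentiable_on_openI[OF G] by simp
qed

lemma C_k_on_Suc_imp: "C_k_on (Suc k) U F \<Longrightarrow> C_k_on k U F"
  by (induction k arbitrary: F) (auto simp: differentiable_imp_continuous_on)

lemma C_k_on_add:
  assumes "open U" "C_k_on k U F" "C_k_on k U G"
  shows "C_k_on k U (\<lambda>x. F x + G x)"
  using assms(2,3)
proof (induction k arbitrary: F G)
  case 0
  then show ?case by (auto intro: continuous_intros)
next
  case (Suc k)
  note D = has_derivative_add[OF has_derivative_on_open[of F U] has_derivative_on_open[of G U]]
  have D': "((\<lambda>x. F x + G x) has_derivative (\<lambda>h. frechet_derivative F (at x) h + frechet_derivative G (at x) h)) (at x)"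
    if "x \<in> U" for x using D Suc.prems that \<open>open U\<close> by auto
  have "C_k_on k U (\<lambda>x. partial_deriv i F x + partial_deriv i G x)" for i
    using Suc by simp
  then have "C_k_on k U (partial_deriv i (\<lambda>x. F x + G x))" for i
    by (rule C_k_on_cong[OF \<open>open U\<close>, rotated]) (subst partial_deriv_eq[OF D'], simp, simp add: partial_deriv_def)
  then show ?case using differentiable_on_openI[OF D'] by simp
qed

lemma C_k_on_mult:
  assumes "open U" "C_k_on k U F" "C_k_on k U G"
  shows "C_k_on k U (\<lambda>x. F x * G x)"
  using assms(2,3)
proof (induction k arbitrary: F G)
  case 0
  then show ?case by (auto intro: continuous_intros)
next
  case (Suc k)
  note D = has_derivative_mult[OF has_derivative_on_open[of F U] has_derivative_on_open[of G U]]
  have D': "((\<lambda>x. F x * G x) has_derivative (\<lambda>h. F x * frechet_derivative G (at x) h + frechet_derivative F (at x) h * G x)) (at x)"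
    if "x \<in> U" for x using D Suc.prems that \<open>open U\<close> by auto
  have "C_k_on k U (\<lambda>x. F x * partial_deriv i G x + partial_deriv i F x * G x)" for i
    using Suc C_k_on_Suc_imp[OF Suc.prems(1)] C_k_on_Suc_imp[OF Suc.prems(2)]
    by (intro C_k_on_add[OF \<open>open U\<close>] Suc.IH) auto
  then have "C_k_on k U (partial_deriv i (\<lambda>x. F x * G x))" for i
    by (rule C_k_on_cong[OF \<open>open U\<close>, rotated]) (subst partial_deriv_eq[OF D'], simp, simp add: partial_deriv_def)
  then show ?case using differentiable_on_openI[OF D'] by simp
qed

lemma C_k_on_const: "open U \<Longrightarrow> C_k_on k U (\<lambda>_. c)"
proof (induction k arbitrary: c)
  case (Suc k)
  have "partial_deriv i (\<lambda>_. c) = (\<lambda>_. 0)" for i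
    by (rule ext) (simp add: partial_deriv_eq[OF has_derivative_const])
  then show ?case using Suc by simp
qed simp

lemma C_k_on_coord: "open U \<Longrightarrow> C_k_on k U (\<lambda>x. x $ j)"
proof (cases k)
  case (Suc k')
  assume "open U"
  have D: "((\<lambda>x::real^4. x $ j) has_derivative (\<lambda>h. h $ j)) (at x)" for x
    by (rule bounded_linear_imp_has_derivative[OF bounded_linear_vec_nth])
  have "partial_deriv i (\<lambda>x. x $ j) = (\<lambda>_. axis i 1 $ j)" for i
    by (rule ext) (simp add: partial_deriv_eq[OF D])
  then show ?thesis using Suc differentiable_on_openI[OF D] C_k_on_const[OF \<open>open U\<close>] by simp
qed (auto intro: continuous_intros)

definition Cinf :: "(real^4 \<Rightarrow> real) \<Rightarrow> bool" where
  "Cinf F \<longleftrightarrow> (\<forall>k. C_k_on k (- {0}) F)"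

lemma open_punctured: "open (- {0::real^4})" by auto

lemma smooth_S3_iff: "smooth_S3 f \<longleftrightarrow> Cinf (radial_ext f)"
  by (simp add: smooth_S3_def Cinf_def)

lemma Cinf_cong: "(\<And>x. x \<noteq> 0 \<Longrightarrow> F x = G x) \<Longrightarrow> Cinf F \<Longrightarrow> Cinf G"
  unfolding Cinf_def using C_k_on_cong[OF open_punctured] by (metis Compl_iff singletonI)

lemma Cinf_add: "Cinf F \<Longrightarrow> Cinf G \<Longrightarrow> Cinf (\<lambda>x. F x + G x)"
  by (simp add: Cinf_def C_k_on_add open_punctured)

lemma Cinf_mult: "Cinf F \<Longrightarrow> Cinf G \<Longrightarrow> Cinf (\<lambda>x. F x * G x)"
  by (simp add: Cinf_def C_k_on_mult open_punctured)

lemma Cinf_const: "Cinf (\<lambda>_. c)"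
  by (simp add: Cinf_def C_k_on_const open_punctured)

lemma Cinf_coord: "Cinf (\<lambda>x. x $ j)"
  by (simp add: Cinf_def C_k_on_coord open_punctured)

lemma Cinf_sum: "finite I \<Longrightarrow> (\<And>i. i \<in> I \<Longrightarrow> Cinf (F i)) \<Longrightarrow> Cinf (\<lambda>x. \<Sum>i\<in>I. F i x)"
  by (induction rule: finite_induct) (auto intro: Cinf_const Cinf_add)

lemma Cinf_partial: "Cinf F \<Longrightarrow> Cinf (partial_deriv i F)"
  unfolding Cinf_def by (metis C_k_on.simps(2))

lemma Cinf_has_derivative:
  "Cinf F \<Longrightarrow> x \<noteq> 0 \<Longrightarrow> (F has_derivative frechet_derivative F (at x)) (at x)"
  using has_derivative_on_open[OF _ open_punctured, of F x] C_k_on.simps(2)[of 0 "- {0}" F]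
  unfolding Cinf_def by blast

lemma Cinf_continuous: "Cinf F \<Longrightarrow> continuous_on S3 F"
  unfolding Cinf_def using continuous_on_subset[of "- {0}" F S3] C_k_on.simps(1)[of "- {0}" F] by fastforce
  
lemma Cinf_inverse_norm: "Cinf (\<lambda>x. inverse (norm x))"
  unfolding Cinf_def
proof
  fix k
  show "C_k_on k (- {0}) (\<lambda>x::real^4. inverse (norm x))"
  proof (induction k)
    case 0
    then show ?case by (auto intro!: continuous_intros)
  next
    case (Suc k)
    let ?I = "\<lambda>x::real^4. inverse (norm x)"
    have D: "(?I has_derivative (\<lambda>h. ((-1) * (x \<bullet> h)) * (?I x * (?I x * ?I x)))) (at x)" if "x \<noteq> 0" for x
    proof -
      have "(norm has_derivative (\<lambda>h. h \<bullet> sgn x)) (at x)"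
        using that by (rule has_derivative_norm)
      then have "(?I has_derivative (\<lambda>h. - (?I x * (h \<bullet> sgn x) * ?I x))) (at x)"
        using that by (intro Deriv.has_derivative_inverse) auto
      then show ?thesis
        by (simp add: sgn_div_norm inner_commute mult_ac)
    qed
    have "C_k_on k (- {0}) (\<lambda>x. ((-1) * x $ i) * (?I x * (?I x * ?I x)))" for i
      by (intro C_k_on_mult C_k_on_const C_k_on_coord Suc.IH open_punctured)
    then have "C_k_on k (- {0}) (partial_deriv i ?I)" for i
      by (rule C_k_on_cong[OF open_punctured, rotated]) (simp add: partial_deriv_eq[OF D] inner_axis)
    moreover have "?I differentiable_on - {0}"
      by (rule differentiable_on_openI[OF D]) simp
    ultimately show ?case by simp
  qed
qed

definition lie :: "3 \<Rightarrow> (real^4 \<Rightarrow> real) \<Rightarrow> real^4 \<Rightarrow> real" where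
  "lie a F x = frechet_derivative F (at x) (quat a x)"

lemma lie_eq: "(F has_derivative F') (at x) \<Longrightarrow> lie a F x = F' (quat a x)"
  by (simp add: lie_def frechet_derivative_at[symmetric])

lemma vec_eq_sum_axis: "(x::real^4) = (\<Sum>i\<in>UNIV. x $ i *\<^sub>R axis i 1)"
  by (simp add: vec_eq_iff axis_def if_distrib cong: if_cong)

lemma Cinf_derivative_partial:
  assumes "Cinf F" "x \<noteq> 0"
  shows "frechet_derivative F (at x) h = (\<Sum>i\<in>UNIV. h $ i * partial_deriv i F x)"
proof -
  have lin: "linear (frechet_derivative F (at x))"
    using Cinf_has_derivative[OF assms] has_derivative_linear by blast
  show ?thesis
    by (subst vec_eq_sum_axis[of h])
      (simp add: linear_sum[OF lin] linear_scale[OF lin] partial_deriv_def)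
qed

lemma lie_partial:
  "Cinf F \<Longrightarrow> x \<noteq> 0 \<Longrightarrow> lie a F x = (\<Sum>i\<in>UNIV. quat a x $ i * partial_deriv i F x)"
  unfolding lie_def by (rule Cinf_derivative_partial)

lemma Cinf_quat: "Cinf (\<lambda>x. quat a x $ i)"
proof -
  have q: "quat a x $ i = (\<Sum>j\<in>UNIV. quat a (axis j 1) $ i * x $ j)" for x
    by (subst vec_eq_sum_axis[of x])
      (simp add: linear_sum[OF quat_linear] linear_scale[OF quat_linear] sum_component mult.commute)
  show ?thesis
    by (rule Cinf_cong[OF q[symmetric]]) (intro Cinf_sum Cinf_mult Cinf_const Cinf_coord finite)
qed

lemma Cinf_lie: "Cinf F \<Longrightarrow> Cinf (lie a F)"
  by (rule Cinf_cong[of "\<lambda>x. \<Sum>i\<in>UNIV. quat a x $ i * partial_deriv i F x"])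
    (simp add: lie_partial, intro Cinf_sum Cinf_mult Cinf_quat Cinf_partial finite)

lemma lie_mult: "Cinf F \<Longrightarrow> Cinf G \<Longrightarrow> x \<noteq> 0 \<Longrightarrow> lie a (\<lambda>x. F x * G x) x = F x * lie a G x + lie a F x * G x"
  using lie_eq[OF has_derivative_mult[OF Cinf_has_derivative Cinf_has_derivative]] by (simp add: lie_def)

lemma lie_cong:
  assumes "\<And>y. y \<noteq> 0 \<Longrightarrow> F y = G y" "Cinf F" "x \<noteq> 0"
  shows "lie a F x = lie a G x"
proof -
  have "(G has_derivative frechet_derivative F (at x)) (at x)"
    by (rule has_derivative_transform_within_open[OF Cinf_has_derivative open_punctured])
      (use assms in auto)
  then show ?thesis
    using lie_eq[of G _ x a] by (simp add: lie_def)
qed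

lemma integrable_Cinf: "Cinf F \<Longrightarrow> integrable mu F"
  by (intro integrable_mu_continuous Cinf_continuous)

lemma S3_nonzero: "x \<in> S3 \<Longrightarrow> x \<noteq> (0::real^4)"
  by auto

lemma integral_lie:
  assumes "Cinf F"
  shows "(\<integral>x. lie a F x \<partial>mu) = 0"
proof -
  have l: "lie a F = (\<lambda>x. frechet_derivative F (at x) (quat a x))"
    by (rule ext) (simp add: lie_def)
  have "continuous_on S3 (\<lambda>x. frechet_derivative F (at x) (quat a x))"
    using Cinf_continuous[OF Cinf_lie[OF assms], of a] unfolding l .
  from integral_rotation_derivative[OF Cinf_has_derivative[OF assms S3_nonzero] this]
  show ?thesis unfolding l .
qed

lemma AE_mu_I: "(\<And>x. x \<in> S3 \<Longrightarrow> P x) \<Longrightarrow> AE x in mu. P x"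
  by (auto intro: AE_I2)

lemma integral_mu_cong: "(\<And>x. x \<in> S3 \<Longrightarrow> f x = g x) \<Longrightarrow> (\<integral>x. f x \<partial>mu) = (\<integral>x. g x \<partial>mu)"
  by (rule Bochner_Integration.integral_cong) auto

lemma integral_lie_by_parts:
  assumes F: "Cinf F" and G: "Cinf G"
  shows "(\<integral>x. lie a F x * G x \<partial>mu) = - (\<integral>x. F x * lie a G x \<partial>mu)"
proof -
  have "0 = (\<integral>x. lie a (\<lambda>x. F x * G x) x \<partial>mu)"
    using integral_lie[OF Cinf_mult[OF F G]] by simp
  also have "\<dots> = (\<integral>x. F x * lie a G x + lie a F x * G x \<partial>mu)"
    by (intro integral_mu_cong lie_mult F G S3_nonzero)
  also have "\<dots> = (\<integral>x. F x * lie a G x \<partial>mu) + (\<integral>x. lie a F x * G x \<partial>mu)"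
    by (intro Bochner_Integration.integral_add integrable_Cinf Cinf_mult Cinf_lie F G)
  finally show ?thesis by simp
qed

text \<open>On radially constant functions this is the Laplace-Beltrami operator. As \<open>quat a (quat a x) = - x\<close>,
  the first order part of a squared field is a radial derivative and vanishes.\<close>

definition lap :: "(real^4 \<Rightarrow> real) \<Rightarrow> real^4 \<Rightarrow> real" where
  "lap F x = (\<Sum>a\<in>UNIV. lie a (lie a F) x)"

lemma Cinf_lap: "Cinf F \<Longrightarrow> Cinf (lap F)"
  unfolding lap_def[abs_def] by (intro Cinf_sum Cinf_lie) auto

lemma integral_grad_grad:
  assumes F: "Cinf F" and G: "Cinf G"
  shows "(\<integral>x. (\<Sum>a\<in>UNIV. lie a F x * lie a G x) \<partial>mu) = - (\<integral>x. F x * lap G x \<partial>mu)"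
proof -
  have "(\<integral>x. (\<Sum>a\<in>UNIV. lie a F x * lie a G x) \<partial>mu) = (\<Sum>a\<in>UNIV. \<integral>x. lie a F x * lie a G x \<partial>mu)"
    by (intro Bochner_Integration.integral_sum integrable_Cinf Cinf_mult Cinf_lie F G)
  also have "\<dots> = (\<Sum>a\<in>UNIV. - (\<integral>x. F x * lie a (lie a G) x \<partial>mu))"
    by (intro sum.cong integral_lie_by_parts F Cinf_lie G refl)
  also have "\<dots> = - (\<integral>x. (\<Sum>a\<in>UNIV. F x * lie a (lie a G) x) \<partial>mu)"
    by (subst Bochner_Integration.integral_sum)
      (auto simp: sum_negf intro!: integrable_Cinf Cinf_mult Cinf_lie F G)
  finally show ?thesis by (simp add: lap_def sum_distrib_left)
qed

lemma integral_lap_symmetric: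
  assumes F: "Cinf F" and G: "Cinf G"
  shows "(\<integral>x. lap F x * G x \<partial>mu) = (\<integral>x. F x * lap G x \<partial>mu)"
  using integral_grad_grad[OF F G] integral_grad_grad[OF G F] by (simp add: mult.commute)

section \<open>Comparison with the gradient and Hessian of the sphere\<close>

lemma radial_ext_on_S3: "x \<in> S3 \<Longrightarrow> radial_ext f x = f x"
  by (simp add: radial_ext_def)

text \<open>Euler's identity for functions that are homogeneous of degree 0.\<close>

lemma radial_derivative_zero:
  assumes F: "Cinf (radial_ext f)" and x: "x \<noteq> 0"
  shows "(\<Sum>i\<in>UNIV. x $ i * partial_deriv i (radial_ext f) x) = 0"
proof -
  let ?F = "radial_ext f"
  have g: "((\<lambda>t::real. t *\<^sub>R x) has_derivative (\<lambda>h. h *\<^sub>R x)) (at 1)"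
    by (auto intro!: derivative_eq_intros)
  have "((\<lambda>t. ?F (t *\<^sub>R x)) has_derivative (\<lambda>h. frechet_derivative ?F (at x) (h *\<^sub>R x))) (at 1)"
    by (rule has_derivative_compose[OF g]) (use Cinf_has_derivative[OF F x] in simp)
  then have "((\<lambda>t. ?F x) has_derivative (\<lambda>h. frechet_derivative ?F (at x) (h *\<^sub>R x))) (at (1::real))"
  proof (rule has_derivative_transform_within_open[where s="{0<..}"])
    show "?F (t *\<^sub>R x) = ?F x" if "t \<in> {0<..}" for t
    proof -
      have "(t *\<^sub>R x) /\<^sub>R norm (t *\<^sub>R x) = x /\<^sub>R norm x"
        using that x by (simp add: field_simps)
      then show ?thesis unfolding radial_ext_def by (rule arg_cong)
    qed
  qed auto
  then have "(\<lambda>h. frechet_derivative ?F (at x) (h *\<^sub>R x)) = (\<lambda>h::real. 0)"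
    using has_derivative_const has_derivative_unique by blast
  from fun_cong[OF this, of 1] show ?thesis
    using Cinf_derivative_partial[OF F x, of x] by simp
qed

lemma quat_frame_unit:
  assumes "x \<in> S3"
  shows "(\<Sum>a\<in>UNIV. quat a x $ i * quat a x $ j) = (if i = j then 1 else 0) - x $ i * x $ j"
proof -
  have "axis i (1::real) $ j = (if i = j then 1 else 0)"
    by (auto simp: axis_def)
  then show ?thesis
    using quat_frame[of x "axis i 1" "axis j 1"] assms
    by (auto simp: inner_axis inner_axis_axis norm_eq_1)
qed

lemma grad_S3_inner:
  assumes F: "smooth_S3 f" and G: "smooth_S3 g" and x: "x \<in> S3"
  shows "grad_S3 f x \<bullet> grad_S3 g x = (\<Sum>a\<in>UNIV. lie a (radial_ext f) x * lie a (radial_ext g) x)"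
proof -
  let ?F = "\<lambda>i. partial_deriv i (radial_ext f) x" and ?G = "\<lambda>i. partial_deriv i (radial_ext g) x"
  have "(\<Sum>a\<in>UNIV. lie a (radial_ext f) x * lie a (radial_ext g) x)
     = (\<Sum>a\<in>UNIV. (\<Sum>i\<in>UNIV. \<Sum>j\<in>UNIV. (quat a x $ i * ?F i) * (quat a x $ j * ?G j)))"
    using F G S3_nonzero[OF x] by (simp add: smooth_S3_iff lie_partial sum_product)
  also have "\<dots> = (\<Sum>i\<in>UNIV. \<Sum>j\<in>UNIV. (\<Sum>a\<in>UNIV. quat a x $ i * quat a x $ j) * (?F i * ?G j))"
    by (subst sum.swap, rule sum.cong[OF refl], subst sum.swap) (simp add: sum_distrib_left sum_distrib_right mult_ac)
  also have "\<dots> = (\<Sum>i\<in>UNIV. ?F i * ?G i) - (\<Sum>i\<in>UNIV. x $ i * ?F i) * (\<Sum>j\<in>UNIV. x $ j * ?G j)"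
  proof -
    have "((if i = j then 1 else 0) - x $ i * x $ j) * (?F i * ?G j)
        = (if i = j then ?F i * ?G j else 0) - (x $ i * ?F i) * (x $ j * ?G j)" for i j
      by (simp add: algebra_simps)
    then show ?thesis
      unfolding quat_frame_unit[OF x] sum_product by (simp add: sum_subtractf)
  qed
  finally show ?thesis
    using radial_derivative_zero[of f x] F S3_nonzero[OF x]
    by (simp add: smooth_S3_iff grad_S3_def inner_vec_def)
qed

lemma lap_partial:
  assumes F: "Cinf (radial_ext f)" and x: "x \<in> S3"
  defines "H \<equiv> \<lambda>i j. partial_deriv i (partial_deriv j (radial_ext f)) x"
  shows "lap (radial_ext f) x = (\<Sum>i\<in>UNIV. \<Sum>j\<in>UNIV. ((if i = j then 1 else 0) - x $ i * x $ j) * H i j)"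
proof -
  let ?F = "radial_ext f"
  have x0: "x \<noteq> 0" using S3_nonzero[OF x] .
  have second: "lie a (lie a ?F) x =
     (\<Sum>j\<in>UNIV. - x $ j * partial_deriv j ?F x) + (\<Sum>j\<in>UNIV. \<Sum>i\<in>UNIV. quat a x $ i * quat a x $ j * H i j)" for a
  proof -
    have q: "((\<lambda>y. quat a y $ j) has_derivative (\<lambda>h. quat a h $ j)) (at x)" for j
      by (intro bounded_linear_imp_has_derivative bounded_linear_compose[OF bounded_linear_vec_nth quat_bounded_linear])
    have "((\<lambda>y. \<Sum>j\<in>UNIV. quat a y $ j * partial_deriv j ?F y) has_derivative
       (\<lambda>h. \<Sum>j\<in>UNIV. quat a x $ j * frechet_derivative (partial_deriv j ?F) (at x) h
          + quat a h $ j * partial_deriv j ?F x)) (at x)"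
      by (intro has_derivative_sum has_derivative_mult q Cinf_has_derivative Cinf_partial F x0)
    then have "lie a (\<lambda>y. \<Sum>j\<in>UNIV. quat a y $ j * partial_deriv j ?F y) x
      = (\<Sum>j\<in>UNIV. quat a x $ j * frechet_derivative (partial_deriv j ?F) (at x) (quat a x)
          + quat a (quat a x) $ j * partial_deriv j ?F x)"
      by (rule lie_eq)
    moreover have "lie a (\<lambda>y. \<Sum>j\<in>UNIV. quat a y $ j * partial_deriv j ?F y) x = lie a (lie a ?F) x"
      by (rule lie_cong) (use F x0 in \<open>auto simp: lie_partial intro!: Cinf_sum Cinf_mult Cinf_quat Cinf_partial\<close>)
    ultimately show ?thesis
      by (simp add: Cinf_derivative_partial[OF Cinf_partial[OF F] x0] H_def quat_quat sum.distrib
          sum_subtractf sum_negf sum_distrib_left mult_ac)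
  qed
  have "lap ?F x = (\<Sum>a\<in>(UNIV::3 set). \<Sum>j\<in>UNIV. \<Sum>i\<in>UNIV. quat a x $ i * quat a x $ j * H i j)"
    unfolding lap_def second using radial_derivative_zero[OF F x0]
    by (simp add: sum.distrib sum_negf)
  also have "\<dots> = (\<Sum>j\<in>UNIV. \<Sum>i\<in>UNIV. (\<Sum>a\<in>UNIV. quat a x $ i * quat a x $ j) * H i j)"
    by (subst sum.swap, rule sum.cong[OF refl], subst sum.swap) (simp add: sum_distrib_right)
  also have "\<dots> = (\<Sum>i\<in>UNIV. \<Sum>j\<in>UNIV. ((if i = j then 1 else 0) - x $ i * x $ j) * H i j)"
    unfolding quat_frame_unit[OF x] by (rule sum.swap)
  finally show ?thesis .
qed

lemma tangent_proj_idem: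
  assumes "x \<in> S3" shows "tangent_proj x ** tangent_proj x = tangent_proj x"
proof -
  have "x \<bullet> x = 1" using assms by (simp add: norm_eq_1)
  then have n: "(\<Sum>k\<in>UNIV. x $ k * x $ k) = 1" by (simp add: inner_vec_def)
  have "(\<Sum>k\<in>UNIV. x $ i * x $ k * (x $ k * x $ j)) = x $ i * x $ j * (\<Sum>k\<in>UNIV. x $ k * x $ k)" for i j
    by (simp add: sum_distrib_left mult_ac)
  then show ?thesis
    using n by (simp add: tangent_proj_def matrix_matrix_mult_def vec_eq_iff mat_def left_diff_distrib
        right_diff_distrib sum_subtractf if_distrib[of "\<lambda>z. z * _"] if_distrib[of "\<lambda>z. _ * z"] cong: if_cong)
qed

lemma trace_hess_S3:
  assumes F: "smooth_S3 f" and x: "x \<in> S3"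
  shows "trace (hess_S3 f x) = lap (radial_ext f) x"
proof -
  define H :: "real^4^4" where "H = (\<chi> i j. partial_deriv i (partial_deriv j (radial_ext f)) x)"
  have "trace (hess_S3 f x) = trace (tangent_proj x ** (tangent_proj x ** H))"
    unfolding hess_S3_def H_def[symmetric] by (rule trace_mul_sym)
  also have "\<dots> = trace (tangent_proj x ** H)"
    by (simp add: matrix_mul_assoc tangent_proj_idem[OF x])
  also have "\<dots> = (\<Sum>j\<in>UNIV. \<Sum>i\<in>UNIV. ((if i = j then 1 else 0) - x $ i * x $ j) * H $ i $ j)"
  proof -
    have "tangent_proj x $ j $ i = (if i = j then 1 else 0) - x $ i * x $ j" for i j
      by (simp add: tangent_proj_def mat_def)
    then show ?thesis by (simp add: trace_def matrix_matrix_mult_def)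
  qed
  also have "\<dots> = lap (radial_ext f) x"
    using lap_partial[OF F[unfolded smooth_S3_iff] x] by (subst sum.swap) (simp add: H_def)
  finally show ?thesis .
qed

section \<open>Chebyshev polynomials of the second kind\<close>

fun cheb :: "nat \<Rightarrow> real poly" where
  "cheb 0 = 1"
| "cheb (Suc 0) = [:0, 2:]"
| "cheb (Suc (Suc n)) = [:0, 2:] * cheb (Suc n) - cheb n"

text \<open>The Laplace-Beltrami operator on functions \<open>y \<mapsto> p (x \<bullet> y)\<close> with \<open>x\<close> on the sphere.\<close>

definition zonal_lap :: "real poly \<Rightarrow> real poly" where
  "zonal_lap p = [:1, 0, -1:] * pderiv (pderiv p) - [:0, 3:] * pderiv p"

text \<open>The two recursions for the derivative support each other in the induction; differentiating the
  first one and eliminating with the second one yields the differential equation.\<close>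

lemma cheb_derivative:
  "(1 - x\<^sup>2) * poly (pderiv (cheb (Suc n))) x = (real n + 2) * poly (cheb n) x - (real n + 1) * x * poly (cheb (Suc n)) x
   \<and> x * poly (pderiv (cheb (Suc n))) x - poly (pderiv (cheb n)) x = (real n + 1) * poly (cheb (Suc n)) x"
proof (induction n)
  case 0
  then show ?case by (simp add: pderiv_pCons power2_eq_square algebra_simps)
next
  case (Suc n)
  define U0 U1 D0 D1 where "U0 = poly (cheb n) x" "U1 = poly (cheb (Suc n)) x"
    "D0 = poly (pderiv (cheb n)) x" "D1 = poly (pderiv (cheb (Suc n))) x"
  define m where "m = real n"
  have a: "(1 - x\<^sup>2) * D1 = (m + 2) * U0 - (m + 1) * x * U1" and b: "D0 = x * D1 - (m + 1) * U1"
    using Suc unfolding U0_U1_D0_D1_def m_def by (simp_all add: algebra_simps)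
  have U2: "poly (cheb (Suc (Suc n))) x = 2 * x * U1 - U0"
    by (simp add: U0_U1_D0_D1_def)
  have D2: "poly (pderiv (cheb (Suc (Suc n)))) x = 2 * U1 + 2 * x * D1 - D0"
    by (simp add: U0_U1_D0_D1_def pderiv_mult pderiv_diff pderiv_smult pderiv_pCons algebra_simps)
  have "(1 - x\<^sup>2) * (2 * U1 + 2 * x * D1 - D0) = (m + 3) * (1 - x\<^sup>2) * U1 + x * ((1 - x\<^sup>2) * D1)"
    unfolding b by (simp add: algebra_simps)
  also have "\<dots> = (m + 3) * U1 - (m + 2) * x * (2 * x * U1 - U0)"
    unfolding a by (simp add: algebra_simps power2_eq_square)
  finally have 1: "(1 - x\<^sup>2) * (2 * U1 + 2 * x * D1 - D0) = (m + 3) * U1 - (m + 2) * x * (2 * x * U1 - U0)" .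
  have "x * (2 * U1 + 2 * x * D1 - D0) - D1 = (m + 3) * x * U1 - (1 - x\<^sup>2) * D1"
    unfolding b by (simp add: algebra_simps power2_eq_square)
  also have "\<dots> = (m + 2) * (2 * x * U1 - U0)"
    unfolding a by (simp add: algebra_simps)
  finally have 2: "x * (2 * U1 + 2 * x * D1 - D0) - D1 = (m + 2) * (2 * x * U1 - U0)" .
  show ?case
    unfolding D2 U2 using 1 2
    by (simp only: U0_U1_D0_D1_def(2)[symmetric] U0_U1_D0_D1_def(4)[symmetric] of_nat_Suc m_def add.assoc)
      (simp add: algebra_simps)
qed

text \<open>Up to normalization \<open>cheb k (x \<bullet> y)\<close> is the zonal spherical harmonic of degree \<open>k\<close>.\<close>

lemma zonal_lap_cheb: "zonal_lap (cheb k) = smult (- (real k * (real k + 2))) (cheb k)"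
proof (cases k)
  case 0
  then show ?thesis by (simp add: zonal_lap_def pderiv_1)
next
  case (Suc n)
  have "poly ([:1, 0, -1:] * pderiv (cheb (Suc n))) x =
     poly (smult (real n + 2) (cheb n) - smult (real n + 1) ([:0, 1:] * cheb (Suc n))) x" for x
    using cheb_derivative[of x n] by (simp add: power2_eq_square algebra_simps)
  then have "[:1, 0, -1:] * pderiv (cheb (Suc n)) =
     smult (real n + 2) (cheb n) - smult (real n + 1) ([:0, 1:] * cheb (Suc n))"
    by (simp add: poly_eq_poly_eq_iff[symmetric] fun_eq_iff)
  then have "pderiv ([:1, 0, -1:] * pderiv (cheb (Suc n))) =
     pderiv (smult (real n + 2) (cheb n) - smult (real n + 1) ([:0, 1:] * cheb (Suc n)))"
    by simp
  then have d: "poly (pderiv ([:1, 0, -1:] * pderiv (cheb (Suc n)))) x =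
     poly (pderiv (smult (real n + 2) (cheb n) - smult (real n + 1) ([:0, 1:] * cheb (Suc n)))) x" for x
    by simp
  have "poly (zonal_lap (cheb (Suc n))) x = - (real (Suc n) * (real (Suc n) + 2)) * poly (cheb (Suc n)) x" for x
  proof -
    define U1 D0 D1 E1 where "U1 = poly (cheb (Suc n)) x"
      "D0 = poly (pderiv (cheb n)) x" "D1 = poly (pderiv (cheb (Suc n))) x"
      "E1 = poly (pderiv (pderiv (cheb (Suc n)))) x"
    define m where "m = real n"
    have b: "D0 = x * D1 - (m + 1) * U1"
      using cheb_derivative[of x n] by (simp add: U1_D0_D1_E1_def m_def)
    have "(1 - x * x) * E1 - 2 * x * D1 = (m + 2) * D0 - (m + 1) * (U1 + x * D1)"
      using d[of x] by (simp add: pderiv_mult pderiv_diff pderiv_add pderiv_minus pderiv_smult pderiv_pCons U1_D0_D1_E1_def m_def algebra_simps)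
    then have "(1 - x * x) * E1 - 3 * x * D1 = - ((m + 1) * (m + 3)) * U1"
      unfolding b by (simp add: algebra_simps)
    then show ?thesis
      by (simp add: zonal_lap_def U1_D0_D1_E1_def m_def algebra_simps)
  qed
  then show ?thesis
    unfolding Suc by (simp only: poly_eq_poly_eq_iff[symmetric] fun_eq_iff poly_smult simp_thms)
qed

lemma cheb_cos: "sin t * poly (cheb n) (cos t) = sin ((real n + 1) * t)"
proof (induction n rule: cheb.induct)
  case 2
  then show ?case using sin_double[of t] by (simp add: mult_ac)
next
  case (3 n)
  have "sin t * poly (cheb (Suc (Suc n))) (cos t)
     = 2 * cos t * (sin t * poly (cheb (Suc n)) (cos t)) - sin t * poly (cheb n) (cos t)"
    by (simp add: algebra_simps)
  also have "\<dots> = 2 * cos t * sin (real (Suc n) * t + t) - sin (real n * t + t)"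
    using 3 by (simp only: distrib_right mult_1)
  also have "\<dots> = sin (real (Suc (Suc n)) * t + t)"
  proof -
    define a where "a = real (Suc n) * t + t"
    have 1: "real n * t + t = a - t" and 2: "real (Suc (Suc n)) * t + t = a + t"
      by (simp_all add: a_def distrib_right)
    show ?thesis unfolding 1 2 a_def[symmetric] sin_add sin_diff by simp
  qed
  finally show ?case by (simp only: distrib_right mult_1)
qed simp

text \<open>The points with \<open>sin t = 0\<close> are covered by this recursion, but not by the quotient of sines.\<close>

lemma cheb_Suc_cos: "poly (cheb (Suc n)) (cos t) = cos t * poly (cheb n) (cos t) + cos ((real n + 1) * t)"
proof (induction n)
  case (Suc n)
  have "poly (cheb (Suc (Suc n))) (cos t) = cos t * poly (cheb (Suc n)) (cos t)
     + (cos t * (cos t * poly (cheb n) (cos t) + cos ((real n + 1) * t)) - poly (cheb n) (cos t))"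
    using Suc by (simp add: algebra_simps)
  also have "cos t * (cos t * poly (cheb n) (cos t) + cos ((real n + 1) * t)) - poly (cheb n) (cos t)
     = cos t * cos ((real n + 1) * t) - ((sin t)\<^sup>2) * poly (cheb n) (cos t)"
    unfolding sin_squared_eq by (simp add: algebra_simps power2_eq_square)
  also have "(sin t)\<^sup>2 * poly (cheb n) (cos t) = sin t * sin ((real n + 1) * t)"
    by (simp add: cheb_cos[symmetric] power2_eq_square)
  also have "cos t * cos ((real n + 1) * t) - sin t * sin ((real n + 1) * t) = cos ((real (Suc n) + 1) * t)"
    using cos_add[of t "(real n + 1) * t"] by (simp add: algebra_simps)
  finally show ?case .
qed simp

lemma cheb_bound:
  assumes "\<bar>s\<bar> \<le> 1" shows "\<bar>poly (cheb n) s\<bar> \<le> real n + 1"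
proof -
  obtain t where t: "s = cos t" using assms by (metis cos_arccos_abs)
  show ?thesis unfolding t
  proof (induction n)
    case (Suc n)
    have "\<bar>poly (cheb (Suc n)) (cos t)\<bar> \<le> \<bar>cos t\<bar> * \<bar>poly (cheb n) (cos t)\<bar> + \<bar>cos ((real n + 1) * t)\<bar>"
      unfolding cheb_Suc_cos by (metis abs_mult abs_triangle_ineq)
    also have "\<dots> \<le> 1 * (real n + 1) + 1"
      by (intro add_mono mult_mono Suc abs_cos_le_one) auto
    finally show ?case by simp
  qed simp
qed

section \<open>The Poisson kernel\<close>

definition poisson :: "real \<Rightarrow> real \<Rightarrow> real" where
  "poisson r s = (1 - r\<^sup>2) / (1 - 2 * r * s + r\<^sup>2)\<^sup>2"

lemma summable_square_power:
  assumes "0 \<le> r" "r < 1" shows "summable (\<lambda>k. (real k + 1)\<^sup>2 * r ^ k)"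
proof -
  have 0: "summable (\<lambda>n. diffs (\<lambda>_. 1) n * x ^ n)" if "norm x < 1" for x :: real
    by (rule termdiff_converges[OF that]) (simp add: summable_geometric)
  have "summable (\<lambda>n. diffs (diffs (\<lambda>_. 1)) n * r ^ n)"
    by (rule termdiff_converges[of _ 1]) (use assms 0 in auto)
  then show ?thesis
  proof (rule summable_comparison_test'[where N=0])
    fix n
    have "(real n + 1)\<^sup>2 \<le> (real n + 1) * (real n + 2)"
      by (simp add: power2_eq_square)
    then have "(real n + 1)\<^sup>2 * r ^ n \<le> ((real n + 1) * (real n + 2)) * r ^ n"
      using assms by (intro mult_right_mono) auto
    then show "norm ((real n + 1)\<^sup>2 * r ^ n) \<le> diffs (diffs (\<lambda>_. 1)) n * r ^ n"
      using assms by (simp add: diffs_def add.commute mult_ac)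
  qed
qed

lemma poisson_bound:
  assumes "0 \<le> r" "r < 1" "\<bar>s\<bar> \<le> 1"
  shows "\<bar>(real k + 1) * r ^ k * poly (cheb k) s\<bar> \<le> (real k + 1)\<^sup>2 * r ^ k"
proof -
  have "\<bar>(real k + 1) * r ^ k * poly (cheb k) s\<bar> = ((real k + 1) * r ^ k) * \<bar>poly (cheb k) s\<bar>"
    using assms by (simp add: abs_mult)
  also have "\<dots> \<le> ((real k + 1) * r ^ k) * (real k + 1)"
    using assms by (intro mult_left_mono cheb_bound) auto
  finally show ?thesis by (simp add: power2_eq_square mult_ac)
qed

lemma poisson_denominator:
  assumes "0 \<le> r" "r < 1" "\<bar>s\<bar> \<le> (1::real)"
  shows "1 - 2 * r * s + r\<^sup>2 > 0"
proof -
  have "(1 - r)\<^sup>2 \<le> 1 - 2 * r * s + r\<^sup>2"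
    using assms by (simp add: power2_eq_square algebra_simps mult_left_le)
  moreover have "(1 - r)\<^sup>2 > 0" using assms by simp
  ultimately show ?thesis by linarith
qed

text \<open>The recursion of the Chebyshev polynomials determines both the generating function and the
  series at hand, which is the generating function differentiated after multiplication by \<open>r\<close>.\<close>

lemma poisson_sums:
  assumes r: "0 \<le> r" "r < 1" and s: "\<bar>s\<bar> \<le> 1"
  shows "(\<lambda>k. (real k + 1) * r ^ k * poly (cheb k) s) sums poisson r s"
proof -
  define v where "v k = r ^ k * poly (cheb k) s" for k
  have rec: "v (Suc (Suc k)) = 2 * r * s * v (Suc k) - r\<^sup>2 * v k" for k
    by (simp add: v_def algebra_simps power2_eq_square)
  have v0: "v 0 = 1" "v 1 = 2 * r * s"
    by (simp_all add: v_def)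
  have sS: "summable (\<lambda>k. (real k + 1) * v k)"
    by (rule summable_comparison_test'[OF summable_square_power[OF r], where N=0])
      (use poisson_bound[OF r s] in \<open>simp add: v_def mult_ac\<close>)
  have sA: "summable v"
  proof (rule summable_comparison_test'[OF summable_square_power[OF r], where N=0])
    fix k
    have "\<bar>v k\<bar> \<le> (real k + 1) * \<bar>v k\<bar>" by (simp add: mult_le_cancel_right1)
    also have "\<dots> \<le> (real k + 1)\<^sup>2 * r ^ k"
      using poisson_bound[OF r s, of k] by (simp add: v_def abs_mult mult_ac)
    finally show "norm (v k) \<le> (real k + 1)\<^sup>2 * r ^ k" by simp
  qed
  define A S where "A = suminf v" "S = (\<Sum>k. (real k + 1) * v k)"
  have A0: "v sums A" using sA by (simp add: A_S_def summable_sums)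
  have S0: "(\<lambda>k. (real k + 1) * v k) sums S" using sS by (simp add: A_S_def summable_sums)
  have A1: "(\<lambda>k. v (Suc k)) sums (A - 1)" using A0 v0 sums_Suc_iff[of v "A - 1"] by simp
  have A2: "(\<lambda>k. v (Suc (Suc k))) sums (A - 1 - 2 * r * s)"
    using A1 v0 sums_Suc_iff[of "\<lambda>k. v (Suc k)" "A - 1 - 2 * r * s"] by simp
  have S1: "(\<lambda>k. (real (Suc k) + 1) * v (Suc k)) sums (S - 1)"
    using S0 v0 sums_Suc_iff[of "\<lambda>k. (real k + 1) * v k" "S - 1"] by simp
  have S2: "(\<lambda>k. (real (Suc (Suc k)) + 1) * v (Suc (Suc k))) sums (S - 1 - 4 * r * s)"
    using S1 v0 sums_Suc_iff[of "\<lambda>k. (real (Suc k) + 1) * v (Suc k)" "S - 1 - 4 * r * s"] by simp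
  have "(\<lambda>k. 2 * r * s * v (Suc k) - r\<^sup>2 * v k) sums (2 * r * s * (A - 1) - r\<^sup>2 * A)"
    by (intro sums_diff sums_mult A1 A0)
  then have eqA: "A - 1 - 2 * r * s = 2 * r * s * (A - 1) - r\<^sup>2 * A"
    using A2 unfolding rec by (rule sums_unique2[rotated])
  have "(\<lambda>k. 2 * r * s * ((real (Suc k) + 1) * v (Suc k) + v (Suc k)) - r\<^sup>2 * ((real k + 1) * v k + 2 * v k))
      sums (2 * r * s * ((S - 1) + (A - 1)) - r\<^sup>2 * (S + 2 * A))"
    by (intro sums_diff sums_add sums_mult A1 A0 S1 S0)
  moreover have "(\<lambda>k. 2 * r * s * ((real (Suc k) + 1) * v (Suc k) + v (Suc k)) - r\<^sup>2 * ((real k + 1) * v k + 2 * v k))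
      = (\<lambda>k. (real (Suc (Suc k)) + 1) * v (Suc (Suc k)))"
    unfolding rec by (simp add: algebra_simps)
  ultimately have "(\<lambda>k. (real (Suc (Suc k)) + 1) * v (Suc (Suc k)))
      sums (2 * r * s * ((S - 1) + (A - 1)) - r\<^sup>2 * (S + 2 * A))"
    by (simp only:)
  then have eqS: "S - 1 - 4 * r * s = 2 * r * s * ((S - 1) + (A - 1)) - r\<^sup>2 * (S + 2 * A)"
    by (rule sums_unique2[OF S2])
  define d where "d = 1 - 2 * r * s + r\<^sup>2"
  have d: "d > 0" unfolding d_def by (rule poisson_denominator[OF r s])
  have Ad: "A * d = 1" using eqA by (simp add: d_def algebra_simps)
  have Sd: "S * d = 1 + 2 * (r * s - r\<^sup>2) * A" using eqS by (simp add: d_def algebra_simps)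
  have "S * d\<^sup>2 = (S * d) * d" by (simp add: power2_eq_square)
  also have "\<dots> = d + 2 * (r * s - r\<^sup>2) * (A * d)" unfolding Sd by (simp add: algebra_simps)
  also have "\<dots> = 1 - r\<^sup>2" unfolding Ad by (simp add: d_def algebra_simps)
  finally have "S = poisson r s"
    using d by (simp add: poisson_def d_def field_simps)
  then show ?thesis using S0 by (simp add: v_def mult_ac)
qed

lemma poisson_strict_mono:
  assumes r: "0 < r" "r < 1" and s: "-1 \<le> s" "s < s'" "s' \<le> 1"
  shows "poisson r s < poisson r s'"
proof -
  have "0 < 1 - 2 * r * s' + r\<^sup>2" "1 - 2 * r * s' + r\<^sup>2 < 1 - 2 * r * s + r\<^sup>2"
    using poisson_denominator[of r s'] r s by auto
  then have "(1 - 2 * r * s' + r\<^sup>2)\<^sup>2 < (1 - 2 * r * s + r\<^sup>2)\<^sup>2"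
    by (intro power_strict_mono) auto
  moreover have "1 - r\<^sup>2 > 0" using r by (simp add: power_less_one_iff abs_square_less_1)
  ultimately show ?thesis
    unfolding poisson_def using \<open>0 < 1 - 2 * r * s' + r\<^sup>2\<close>
    by (intro divide_strict_left_mono mult_pos_pos) auto
qed

lemma poisson_nonneg:
  assumes "0 \<le> r" "r < 1" shows "poisson r s \<ge> 0"
  unfolding poisson_def using assms by (simp add: power_le_one)

lemma poisson_away_from_pole:
  assumes r: "1/2 \<le> r" "r < 1" and s: "\<bar>s\<bar> \<le> 1" "s \<le> 1 - \<delta>" and d: "\<delta> > 0"
  shows "poisson r s \<le> (1 - r\<^sup>2) / \<delta>\<^sup>2"
proof -
  have "r * s \<le> r * (1 - \<delta>)" "2 * (r * \<delta>) \<ge> \<delta>"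
    using r s d by (auto intro!: mult_left_mono simp: mult_le_cancel_right1)
  then have "1 - 2 * r * s + r\<^sup>2 \<ge> (1 - r)\<^sup>2 + \<delta>"
    by (simp add: power2_eq_square algebra_simps)
  then have "1 - 2 * r * s + r\<^sup>2 \<ge> \<delta>" by (smt (verit) zero_le_power2)
  then have "(1 - 2 * r * s + r\<^sup>2)\<^sup>2 \<ge> \<delta>\<^sup>2" using d by (intro power_mono) auto
  moreover have "1 - r\<^sup>2 \<ge> 0" using r by (simp add: power_le_one)
  ultimately show ?thesis unfolding poisson_def
    using d by (intro divide_left_mono mult_pos_pos) auto
qed

section \<open>The inverse of the Paneitz operator as a zonal kernel\<close>

text \<open>The eigenvalue of \<open>\<Delta>\<^sup>2 + \<Delta>/2 - (15/16 - \<epsilon>)\<close> on spherical harmonics of degree \<open>k\<close>, where \<open>- \<Delta>\<close> has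
  the eigenvalue \<open>(k + 1)\<^sup>2 - 1\<close>.\<close>

definition lam :: "real \<Rightarrow> nat \<Rightarrow> real" where
  "lam \<epsilon> k = (real k + 1) ^ 4 - 5/2 * (real k + 1)\<^sup>2 + 9/16 + \<epsilon>"

text \<open>Up to the factor \<open>mass\<close>, \<open>(k + 1) * cheb k (x \<bullet> y)\<close> is the kernel of the orthogonal projection to the
  spherical harmonics of degree \<open>k\<close>.\<close>

definition kern :: "real \<Rightarrow> real \<Rightarrow> real" where
  "kern \<epsilon> s = - (\<Sum>k. (real k + 1) / lam \<epsilon> k * poly (cheb k) s)"

lemma lam_0: "lam \<epsilon> 0 = \<epsilon> - 15/16"
  by (simp add: lam_def)

lemma lam_Suc_factor: "lam 0 (Suc j) = (real j + 1/2) * (real j + 3/2) * (real j + 5/2) * (real j + 7/2)"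
  by (simp add: lam_def power2_eq_square power4_eq_xxxx field_simps)

lemma lam_Suc_pos: "lam 0 (Suc j) > 0"
  unfolding lam_Suc_factor by (intro mult_pos_pos) auto

lemma lam_mono: "\<epsilon> \<ge> 0 \<Longrightarrow> lam 0 k \<le> lam \<epsilon> k"
  by (simp add: lam_def)

text \<open>Partial fractions make the series telescope. Its value is the reciprocal of \<open>- lam 0 0\<close>, which says
  that for \<open>\<epsilon> = 0\<close> the kernel vanishes on the diagonal.\<close>

lemma lam_sums: "(\<lambda>j. (real j + 2)\<^sup>2 / lam 0 (Suc j)) sums (16/15)"
proof -
  define g where "g j = 1 / (real j + 1/2)" for j
  define F where "F j = 3/8 * (g j + g (Suc j) + g (Suc (Suc j))) - 1/8 * g (Suc j)" for j
  have g0: "g \<longlonglongrightarrow> 0"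
    unfolding g_def by real_asymp
  have "F \<longlonglongrightarrow> 3/8 * (0 + 0 + 0) - 1/8 * 0"
    unfolding F_def by (intro tendsto_intros g0 LIMSEQ_Suc)
  then have "F \<longlonglongrightarrow> 0" by simp
  then have "(\<lambda>j. F j - F (Suc j)) sums (F 0 - 0)"
    by (rule telescope_sums')
  moreover have "F 0 = 16/15" by (simp add: F_def g_def)
  moreover have "F j - F (Suc j) = (real j + 2)\<^sup>2 / lam 0 (Suc j)" for j
  proof -
    define x where "x = real j"
    have x: "x + 1/2 > 0" "x + 3/2 > 0" "x + 5/2 > 0" "x + 7/2 > 0" by (auto simp: x_def)
    have "F j - F (Suc j) = 3/8 * (1 / (x + 1/2) - 1 / (x + 7/2)) - 1/8 * (1 / (x + 3/2) - 1 / (x + 5/2))"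
      by (simp add: F_def g_def x_def algebra_simps)
    also have "1 / (x + 1/2) - 1 / (x + 7/2) = 3 / ((x + 1/2) * (x + 7/2))"
      using x by (simp add: divide_simps)
    also have "1 / (x + 3/2) - 1 / (x + 5/2) = 1 / ((x + 3/2) * (x + 5/2))"
      using x by (simp add: divide_simps)
    also have "3/8 * (3 / ((x + 1/2) * (x + 7/2))) - 1/8 * (1 / ((x + 3/2) * (x + 5/2)))
       = (9/8 * ((x + 3/2) * (x + 5/2)) - 1/8 * ((x + 1/2) * (x + 7/2))) / ((x + 1/2) * (x + 3/2) * (x + 5/2) * (x + 7/2))"
    proof -
      define a b where "a = (x + 1/2) * (x + 7/2)" "b = (x + 3/2) * (x + 5/2)"
      have "a \<noteq> 0" "b \<noteq> 0" using x by (auto simp: a_b_def)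
      then have "3/8 * (3 / a) - 1/8 * (1 / b) = (9/8 * b - 1/8 * a) / (a * b)"
        by (simp add: field_simps)
      then show ?thesis by (simp add: a_b_def mult_ac)
    qed
    also have "9/8 * ((x + 3/2) * (x + 5/2)) - 1/8 * ((x + 1/2) * (x + 7/2)) = (x + 2)\<^sup>2"
      by (simp add: power2_eq_square field_simps)
    finally show ?thesis by (simp add: lam_Suc_factor x_def)
  qed
  ultimately show ?thesis by simp
qed

text \<open>The operator with eigenvalues \<open>lam \<epsilon>\<close>, expressed on zonal functions.\<close>

definition zonal_P :: "real \<Rightarrow> real poly \<Rightarrow> real poly" where
  "zonal_P \<epsilon> p = zonal_lap (zonal_lap p) + smult (1/2) (zonal_lap p) - smult (15/16 - \<epsilon>) p"

lemma zonal_lap_add: "zonal_lap (p + q) = zonal_lap p + zonal_lap q"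
  by (simp add: zonal_lap_def pderiv_add smult_add_right algebra_simps)

lemma zonal_lap_smult: "zonal_lap (smult c p) = smult c (zonal_lap p)"
  by (simp add: zonal_lap_def pderiv_smult smult_diff_right)

lemma zonal_P_add: "zonal_P \<epsilon> (p + q) = zonal_P \<epsilon> p + zonal_P \<epsilon> q"
  by (simp add: zonal_P_def zonal_lap_add smult_add_right algebra_simps)

lemma zonal_P_smult: "zonal_P \<epsilon> (smult c p) = smult c (zonal_P \<epsilon> p)"
  by (simp add: zonal_P_def zonal_lap_smult smult_add_right smult_diff_right mult.commute)

lemma zonal_P_cheb: "zonal_P \<epsilon> (cheb k) = smult (lam \<epsilon> k) (cheb k)"
proof -
  define c where "c = - (real k * (real k + 2))"
  have "zonal_P \<epsilon> (cheb k) = smult (c * c + 1/2 * c - (15/16 - \<epsilon>)) (cheb k)"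
    unfolding zonal_P_def zonal_lap_cheb c_def[symmetric] zonal_lap_smult
    by (simp add: smult_add_left smult_diff_left)
  also have "c * c + 1/2 * c - (15/16 - \<epsilon>) = lam \<epsilon> k"
    by (simp add: c_def lam_def power2_eq_square power4_eq_xxxx algebra_simps)
  finally show ?thesis .
qed

definition kern_poly :: "real \<Rightarrow> real \<Rightarrow> nat \<Rightarrow> real poly" where
  "kern_poly \<epsilon> r n = (\<Sum>k<n. smult (- (r ^ k * (real k + 1) / lam \<epsilon> k)) (cheb k))"

definition poisson_poly :: "real \<Rightarrow> nat \<Rightarrow> real poly" where
  "poisson_poly r n = (\<Sum>k<n. smult ((real k + 1) * r ^ k) (cheb k))"

context
  fixes \<epsilon> :: real
  assumes eps: "0 < \<epsilon>" "\<epsilon> < 15/16"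
begin

lemma lam_nonzero: "lam \<epsilon> k \<noteq> 0"
proof (cases k)
  case (Suc j)
  then show ?thesis using lam_Suc_pos[of j] lam_mono[of \<epsilon> k] eps by auto
qed (use eps lam_0 in auto)

lemma lam_Suc_pos': "lam \<epsilon> (Suc j) > 0"
  using lam_Suc_pos[of j] lam_mono[of \<epsilon> "Suc j"] eps by auto

lemma zonal_P_kern_poly: "zonal_P \<epsilon> (kern_poly \<epsilon> r n) = - poisson_poly r n"
proof (induction n)
  case 0
  have "zonal_P \<epsilon> 0 = 0" by (simp add: zonal_P_def zonal_lap_def)
  then show ?case by (simp add: kern_poly_def poisson_poly_def)
next
  case (Suc n)
  have "zonal_P \<epsilon> (kern_poly \<epsilon> r (Suc n)) = zonal_P \<epsilon> (kern_poly \<epsilon> r n)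
      + smult (- (r ^ n * (real n + 1) / lam \<epsilon> n) * lam \<epsilon> n) (cheb n)"
    unfolding kern_poly_def sum.lessThan_Suc zonal_P_add zonal_P_smult zonal_P_cheb smult_smult ..
  also have "- (r ^ n * (real n + 1) / lam \<epsilon> n) * lam \<epsilon> n = - ((real n + 1) * r ^ n)"
    using lam_nonzero[of n] by simp
  finally show ?case
    unfolding Suc by (simp add: poisson_poly_def)
qed

lemma summable_Suc_square_lam: "summable (\<lambda>j. (real j + 2)\<^sup>2 / lam \<epsilon> (Suc j))"
  and suminf_Suc_square_lam: "(\<Sum>j. (real j + 2)\<^sup>2 / lam \<epsilon> (Suc j)) \<le> 16/15"
proof -
  have le: "(real j + 2)\<^sup>2 / lam \<epsilon> (Suc j) \<le> (real j + 2)\<^sup>2 / lam 0 (Suc j)" for j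
    using lam_Suc_pos[of j] lam_Suc_pos'[of j] lam_mono[of \<epsilon> "Suc j"] eps
    by (intro divide_left_mono mult_pos_pos) auto
  show s: "summable (\<lambda>j. (real j + 2)\<^sup>2 / lam \<epsilon> (Suc j))"
    by (rule summable_comparison_test'[OF sums_summable[OF lam_sums], where N=0])
      (use le lam_Suc_pos' in \<open>simp add: abs_of_pos\<close>)
  show "(\<Sum>j. (real j + 2)\<^sup>2 / lam \<epsilon> (Suc j)) \<le> 16/15"
    using suminf_le[OF le s sums_summable[OF lam_sums]] sums_unique[OF lam_sums] by simp
qed

lemma summable_square_lam: "summable (\<lambda>k. (real k + 1)\<^sup>2 / \<bar>lam \<epsilon> k\<bar>)"
proof -
  have "summable (\<lambda>k. (real (Suc k) + 1)\<^sup>2 / \<bar>lam \<epsilon> (Suc k)\<bar>)"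
    using summable_Suc_square_lam lam_Suc_pos' by (simp add: abs_of_pos add.commute)
  then show ?thesis by (subst (asm) summable_Suc_iff)
qed

lemma kern_term_bound:
  assumes "\<bar>s\<bar> \<le> 1"
  shows "\<bar>(real k + 1) / lam \<epsilon> k * poly (cheb k) s\<bar> \<le> (real k + 1)\<^sup>2 / \<bar>lam \<epsilon> k\<bar>"
proof -
  have "\<bar>(real k + 1) / lam \<epsilon> k * poly (cheb k) s\<bar> = (real k + 1) / \<bar>lam \<epsilon> k\<bar> * \<bar>poly (cheb k) s\<bar>"
    by (simp add: abs_mult)
  also have "\<dots> \<le> (real k + 1) / \<bar>lam \<epsilon> k\<bar> * (real k + 1)"
    by (intro mult_left_mono cheb_bound assms) auto
  finally show ?thesis by (simp add: power2_eq_square)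
qed

lemma summable_kern: "\<bar>s\<bar> \<le> 1 \<Longrightarrow> summable (\<lambda>k. (real k + 1) / lam \<epsilon> k * poly (cheb k) s)"
  by (rule summable_comparison_test'[OF summable_square_lam, where N=0])
    (use kern_term_bound in simp)

lemma continuous_on_kern: "continuous_on {-1..1} (kern \<epsilon>)"
proof -
  have "uniform_limit {-1..1} (\<lambda>n s. \<Sum>k<n. (real k + 1) / lam \<epsilon> k * poly (cheb k) s)
      (\<lambda>s. \<Sum>k. (real k + 1) / lam \<epsilon> k * poly (cheb k) s) sequentially"
    by (rule Weierstrass_m_test[OF _ summable_square_lam]) (subst real_norm_def, rule kern_term_bound, auto)
  then have "continuous_on {-1..1} (\<lambda>s. \<Sum>k. (real k + 1) / lam \<epsilon> k * poly (cheb k) s)"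
    by (rule uniform_limit_theorem[rotated]) (auto intro!: always_eventually continuous_intros simp: lam_nonzero)
  then show ?thesis
    unfolding kern_def[abs_def] by (intro continuous_intros)
qed

text \<open>The coefficient of degree 0 dominates all others together: at \<open>\<epsilon> = 0\<close> it balances them at \<open>s = 1\<close>, and
  increasing \<open>\<epsilon>\<close> increases it and decreases the others.\<close>

lemma kern_pos:
  assumes s: "\<bar>s\<bar> \<le> 1"
  shows "kern \<epsilon> s > 0"
proof -
  let ?f = "\<lambda>k. (real k + 1) / lam \<epsilon> k * poly (cheb k) s"
  have S: "summable (\<lambda>k. ?f (Suc k))"
    using summable_kern[OF s] by (subst summable_Suc_iff)
  have "kern \<epsilon> s = - ?f 0 - (\<Sum>k. ?f (Suc k))"
    unfolding kern_def using suminf_split_head[OF summable_kern[OF s]] by simp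
  moreover have "(\<Sum>k. ?f (Suc k)) \<le> (\<Sum>j. (real j + 2)\<^sup>2 / lam \<epsilon> (Suc j))"
  proof (rule suminf_le[OF _ S summable_Suc_square_lam])
    show "?f (Suc k) \<le> (real k + 2)\<^sup>2 / lam \<epsilon> (Suc k)" for k
      using order_trans[OF abs_ge_self kern_term_bound[OF s, of "Suc k"]] lam_Suc_pos'[of k]
      by (simp add: abs_of_pos add.commute)
  qed
  moreover have "- ?f 0 = 1 / (15/16 - \<epsilon>)"
    using eps by (simp add: lam_0 divide_simps)
  moreover have "1 / (15/16 - \<epsilon>) > 16/15"
    using eps by (simp add: divide_simps)
  ultimately show ?thesis
    using suminf_Suc_square_lam by linarith
qed

text \<open>Abel summation is uniform here because the coefficients are absolutely summable.\<close>

lemma kern_poly_close: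
  assumes "\<delta> > 0"
  shows "\<exists>r0<1. \<exists>N. \<forall>r n s. r0 \<le> r \<and> 0 \<le> r \<and> r < 1 \<and> N \<le> n \<and> \<bar>s\<bar> \<le> 1 \<longrightarrow>
           \<bar>poly (kern_poly \<epsilon> r n) s - kern \<epsilon> s\<bar> \<le> \<delta>"
proof -
  define a where "a k = (real k + 1)\<^sup>2 / \<bar>lam \<epsilon> k\<bar>" for k
  define A where "A = suminf a"
  have a: "summable a" unfolding a_def[abs_def] by (rule summable_square_lam)
  have a0: "a k \<ge> 0" for k by (simp add: a_def)
  have A0: "A \<ge> 0" unfolding A_def by (rule suminf_nonneg[OF a a0])
  have "(\<lambda>n. \<Sum>k<n. a k) \<longlonglongrightarrow> A" unfolding A_def by (rule summable_LIMSEQ[OF a])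
  then obtain M where M: "\<bar>(\<Sum>k<M. a k) - A\<bar> < \<delta>/2"
    using assms by (auto simp: lim_sequentially dist_real_def dest!: spec[of _ "\<delta>/2"])
  have "((\<lambda>r. (1 - r ^ M) * A) \<longlongrightarrow> (1 - 1 ^ M) * A) (at_left (1::real))"
    by (intro tendsto_intros)
  then have "eventually (\<lambda>r. (1 - r ^ M) * A < \<delta>/2) (at_left (1::real))"
    using assms by (intro order_tendstoD(2)[where y="(1 - 1 ^ M) * A"]) auto
  then obtain r0 where r0: "r0 < 1" "\<And>r. r0 < r \<Longrightarrow> r < 1 \<Longrightarrow> (1 - r ^ M) * A < \<delta>/2"
    using eventually_at_left_field[of _ "1::real"] by auto
  have "\<bar>poly (kern_poly \<epsilon> r n) s - kern \<epsilon> s\<bar> \<le> \<delta>"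
    if r: "(r0 + 1)/2 \<le> r" "0 \<le> r" "r < 1" and n: "M \<le> n" and s: "\<bar>s\<bar> \<le> 1" for r n s
  proof -
    define f where "f k = (real k + 1) / lam \<epsilon> k * poly (cheb k) s" for k
    have f: "\<bar>f k\<bar> \<le> a k" for k unfolding f_def a_def by (rule kern_term_bound[OF s])
    have "poly (kern_poly \<epsilon> r n) s = - (\<Sum>k<n. r ^ k * f k)"
      by (simp add: kern_poly_def poly_sum f_def sum_negf mult.assoc)
    then have 1: "(\<lambda>k. if k \<in> {..<n} then r ^ k * f k else 0) sums (- poly (kern_poly \<epsilon> r n) s)"
      using sums_If_finite_set[of "{..<n}" "\<lambda>k. r ^ k * f k"] by simp
    have 2: "f sums (- kern \<epsilon> s)"
      using summable_sums[OF summable_kern[OF s]] by (simp add: kern_def f_def[abs_def])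
    have 3: "(\<lambda>k. (if k \<in> {..<n} then r ^ k * f k else 0) - f k) sums (kern \<epsilon> s - poly (kern_poly \<epsilon> r n) s)"
      using sums_diff[OF 1 2] by simp
    have "(\<lambda>k. if k \<in> {..<M} then a k else 0) sums (\<Sum>k<M. a k)"
      by (rule sums_If_finite_set) simp
    then have 4: "(\<lambda>k. (1 - r ^ M) * a k + (a k - (if k \<in> {..<M} then a k else 0))) sums
        ((1 - r ^ M) * A + (A - (\<Sum>k<M. a k)))"
      using a by (intro sums_add sums_mult sums_diff) (auto simp: A_def summable_sums)
    have abs_contract: "\<bar>x * y - y\<bar> = (1 - x) * \<bar>y\<bar>" if "x \<le> 1" for x y :: real
    proof -
      have "x * y - y = - ((1 - x) * y)" by (simp add: algebra_simps)
      then show ?thesis using that by (simp only: abs_minus_cancel abs_mult)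
    qed
    have b: "\<bar>(if k \<in> {..<n} then r ^ k * f k else 0) - f k\<bar>
        \<le> (1 - r ^ M) * a k + (a k - (if k \<in> {..<M} then a k else 0))" for k
    proof -
      have rM: "r ^ M \<le> 1" using r by (simp add: power_le_one)
      have rk: "0 \<le> r ^ k" "r ^ k \<le> 1" using r by (auto simp: power_le_one)
      show ?thesis
      proof (cases "k < M")
        case True
        have "\<bar>r ^ k * f k - f k\<bar> = (1 - r ^ k) * \<bar>f k\<bar>"
          using rk by (intro abs_contract)
        also have "\<dots> \<le> (1 - r ^ M) * a k"
          using rM rk f True r by (intro mult_mono) (auto intro: power_decreasing)
        finally show ?thesis using True n by simp
      next
        case False
        have "\<bar>(if k \<in> {..<n} then r ^ k * f k else 0) - f k\<bar> \<le> \<bar>f k\<bar>"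
        proof (cases "k < n")
          case True
          have "\<bar>r ^ k * f k - f k\<bar> = (1 - r ^ k) * \<bar>f k\<bar>"
            using rk by (intro abs_contract)
          also have "\<dots> \<le> 1 * \<bar>f k\<bar>" using rk by (intro mult_right_mono) auto
          finally show ?thesis using True by simp
        qed simp
        also have "\<dots> \<le> a k" by (rule f)
        also have "\<dots> \<le> (1 - r ^ M) * a k + a k" using rM a0[of k] by simp
        finally show ?thesis using False by simp
      qed
    qed
    have "\<bar>kern \<epsilon> s - poly (kern_poly \<epsilon> r n) s\<bar> \<le> (1 - r ^ M) * A + (A - (\<Sum>k<M. a k))"
      using norm_suminf_le[of "\<lambda>k. (if k \<in> {..<n} then r ^ k * f k else 0) - f k", OF _ sums_summable[OF 4]]
        b sums_unique[OF 3] sums_unique[OF 4] by simp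
    also have "\<dots> \<le> \<delta>"
    proof -
      have "r0 < r" using r(1) r0(1) by simp
      then have "(1 - r ^ M) * A < \<delta>/2" using r0(2) r by blast
      moreover have "A - sum a {..<M} < \<delta>/2" using M by linarith
      ultimately show ?thesis by simp
    qed
    finally show ?thesis by (simp add: abs_minus_commute)
  qed
  moreover have "(r0 + 1)/2 < 1" using r0 by simp
  ultimately show ?thesis by blast
qed

end

lemma poisson_poly_close:
  assumes r: "0 \<le> r" "r < 1" and "\<delta> > 0"
  shows "\<exists>N. \<forall>n\<ge>N. \<forall>s. \<bar>s\<bar> \<le> 1 \<longrightarrow> \<bar>poly (poisson_poly r n) s - poisson r s\<bar> \<le> \<delta>"
proof -
  have "uniform_limit {-1..1} (\<lambda>n s. \<Sum>k<n. (real k + 1) * r ^ k * poly (cheb k) s)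
      (\<lambda>s. \<Sum>k. (real k + 1) * r ^ k * poly (cheb k) s) sequentially"
    by (rule Weierstrass_m_test[OF _ summable_square_power[OF r]]) (subst real_norm_def, rule poisson_bound[OF r], auto)
  then have "\<forall>\<^sub>F n in sequentially. \<forall>s\<in>{-1..1}. dist (\<Sum>k<n. (real k + 1) * r ^ k * poly (cheb k) s)
      (\<Sum>k. (real k + 1) * r ^ k * poly (cheb k) s) < \<delta>"
    using \<open>\<delta> > 0\<close> by (rule uniform_limitD)
  then obtain N where N: "\<And>n s. n \<ge> N \<Longrightarrow> s \<in> {-1..1} \<Longrightarrow> dist (\<Sum>k<n. (real k + 1) * r ^ k * poly (cheb k) s)
      (\<Sum>k. (real k + 1) * r ^ k * poly (cheb k) s) < \<delta>"
    unfolding eventually_sequentially by blast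
  have "\<bar>poly (poisson_poly r n) s - poisson r s\<bar> \<le> \<delta>" if "n \<ge> N" "\<bar>s\<bar> \<le> 1" for n s
  proof -
    have "(\<Sum>k. (real k + 1) * r ^ k * poly (cheb k) s) = poisson r s"
      using sums_unique[OF poisson_sums[OF r that(2)]] by simp
    moreover have "s \<in> {-1..1}" using that(2) by (auto simp: abs_le_iff)
    ultimately show ?thesis
      using N[OF that(1), of s] by (simp add: poisson_poly_def poly_sum dist_real_def less_imp_le)
  qed
  then show ?thesis by blast
qed

section \<open>Monotonicity of the kernel\<close>

text \<open>For \<open>sg\<close> equal to \<open>-1\<close> and \<open>1\<close> the squares are the two roots of \<open>z\<^sup>2 - 5/2 z + 9/16 + \<epsilon>\<close>, so \<open>lam \<epsilon> k\<close> factors as the product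
  of the differences of \<open>(k + 1)\<^sup>2\<close> and the roots.\<close>

definition weight_root :: "real \<Rightarrow> real \<Rightarrow> real" where
  "weight_root sg \<epsilon> = sqrt (5/4 + sg * sqrt (1 - \<epsilon>))"

text \<open>The inverse Laplace transform of \<open>n \<mapsto> 1 / ((n\<^sup>2 - a\<^sup>2) (n\<^sup>2 - b\<^sup>2))\<close>. It represents \<open>1 / lam \<epsilon> k\<close> for
  \<open>k \<ge> 1\<close>, because \<open>b < 2\<close>; degree 0 only contributes a constant to the kernel.\<close>

definition weight :: "real \<Rightarrow> real \<Rightarrow> real" where
  "weight \<epsilon> t = (let a = weight_root (-1) \<epsilon>; b = weight_root 1 \<epsilon> in (sinh (b * t) / b - sinh (a * t) / a) / (b\<^sup>2 - a\<^sup>2))"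

lemma has_integral_exp_sinh:
  fixes n b :: real
  assumes "0 < b" "b < n"
  shows "((\<lambda>t. exp (- n * t) * (sinh (b * t) / b)) has_integral 1 / (n\<^sup>2 - b\<^sup>2)) {0..}"
proof -
  have 1: "((\<lambda>t. exp (- (n - b) * t)) has_integral exp (- (n - b) * 0) / (n - b)) {0..}"
    by (rule has_integral_exp_minus_to_infinity) (use assms in simp)
  have 2: "((\<lambda>t. exp (- (n + b) * t)) has_integral exp (- (n + b) * 0) / (n + b)) {0..}"
    by (rule has_integral_exp_minus_to_infinity) (use assms in simp)
  have "((\<lambda>t. (1 / (2 * b)) * (exp (- (n - b) * t) - exp (- (n + b) * t))) has_integral
     (1 / (2 * b)) * (exp (- (n - b) * 0) / (n - b) - exp (- (n + b) * 0) / (n + b))) {0..}"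
    by (intro has_integral_mult_right has_integral_diff 1 2)
  moreover have "(1 / (2 * b)) * (exp (- (n - b) * t) - exp (- (n + b) * t)) = exp (- n * t) * (sinh (b * t) / b)" for t
  proof -
    have "exp (- (n - b) * t) = exp (- n * t) * exp (b * t)" "exp (- (n + b) * t) = exp (- n * t) * exp (- (b * t))"
      by (simp_all add: exp_add[symmetric] algebra_simps)
    then show ?thesis
      using assms by (simp add: sinh_field_def field_simps)
  qed
  moreover have "(1 / (2 * b)) * (exp (- (n - b) * 0) / (n - b) - exp (- (n + b) * 0) / (n + b)) = 1 / (n\<^sup>2 - b\<^sup>2)"
  proof -
    have "n - b \<noteq> 0" "n + b \<noteq> 0" "b \<noteq> 0" using assms by auto
    moreover have "n\<^sup>2 - b\<^sup>2 = (n - b) * (n + b)" by (simp add: power2_eq_square algebra_simps)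
    ultimately show ?thesis by (simp add: divide_simps)
  qed
  ultimately show ?thesis by simp
qed

lemma sinh_quotient_mono:
  fixes a b t :: real
  assumes "0 < a" "a < b" "0 < t"
  shows "sinh (a * t) / a < sinh (b * t) / b"
proof -
  let ?h = "\<lambda>t. sinh (b * t) / b - sinh (a * t) / a"
  have "?h 0 < ?h t"
  proof (rule DERIV_pos_imp_increasing_open[OF \<open>0 < t\<close>])
    fix x assume x: "0 < x" "x < t"
    have "(?h has_real_derivative (cosh (b * x) - cosh (a * x))) (at x)"
      using assms by (auto intro!: derivative_eq_intros)
    moreover have "cosh (b * x) - cosh (a * x) > 0"
      using assms x by (simp add: cosh_real_strict_mono)
    ultimately show "\<exists>y. (?h has_real_derivative y) (at x) \<and> y > 0" by blast
  qed (use assms in \<open>auto intro!: continuous_intros\<close>)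
  then show ?thesis by simp
qed

context
  fixes \<epsilon> :: real
  assumes eps: "0 < \<epsilon>" "\<epsilon> < 15/16"
begin

lemma weight_roots:
  defines "a \<equiv> weight_root (-1) \<epsilon>" and "b \<equiv> weight_root 1 \<epsilon>"
  shows "0 < a" "a < b" "b < 2" "a\<^sup>2 + b\<^sup>2 = 5/2" "a\<^sup>2 * b\<^sup>2 = 9/16 + \<epsilon>"
proof -
  define q where "q = sqrt (1 - \<epsilon>)"
  have q: "0 < q" "q < 1" "q\<^sup>2 = 1 - \<epsilon>" using eps by (auto simp: q_def)
  have a2: "a\<^sup>2 = 5/4 - q" and b2: "b\<^sup>2 = 5/4 + q"
    using q by (auto simp: a_def b_def weight_root_def q_def[symmetric])
  show "0 < a" using q by (simp add: a_def weight_root_def q_def[symmetric])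
  show "a < b" using q by (simp add: a_def b_def weight_root_def q_def[symmetric])
  have "b\<^sup>2 < 2\<^sup>2" using b2 q by simp
  then show "b < 2" by (rule power_less_imp_less_base) simp
  show "a\<^sup>2 + b\<^sup>2 = 5/2" by (simp add: a2 b2)
  show "a\<^sup>2 * b\<^sup>2 = 9/16 + \<epsilon>" unfolding a2 b2 using q(3) by (simp add: algebra_simps power2_eq_square)
qed

lemma weight_pos: "t > 0 \<Longrightarrow> weight \<epsilon> t > 0"
  using weight_roots(1,2) sinh_quotient_mono[of "weight_root (-1) \<epsilon>" "weight_root 1 \<epsilon>" t]
  by (simp add: weight_def Let_def power_strict_mono)

lemma weight_laplace:
  "((\<lambda>t. exp (- (real k + 2) * t) * weight \<epsilon> t) has_integral 1 / lam \<epsilon> (Suc k)) {0..}"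
proof -
  define a b where "a = weight_root (-1) \<epsilon>" "b = weight_root 1 \<epsilon>"
  note ab = weight_roots[folded a_b_def]
  define n where "n = real k + 2"
  have n: "b < n" "a < n" using ab by (auto simp: n_def)
  have b2: "b\<^sup>2 - a\<^sup>2 > 0" using ab by (simp add: power_strict_mono)
  have nb: "n\<^sup>2 - b\<^sup>2 > 0" "n\<^sup>2 - a\<^sup>2 > 0" using ab n by (simp_all add: power_strict_mono)
  have "((\<lambda>t. (1 / (b\<^sup>2 - a\<^sup>2)) * (exp (- n * t) * (sinh (b * t) / b) - exp (- n * t) * (sinh (a * t) / a)))
     has_integral (1 / (b\<^sup>2 - a\<^sup>2)) * (1 / (n\<^sup>2 - b\<^sup>2) - 1 / (n\<^sup>2 - a\<^sup>2))) {0..}"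
    using ab n by (intro has_integral_mult_right has_integral_diff has_integral_exp_sinh) auto
  moreover have "(1 / (b\<^sup>2 - a\<^sup>2)) * (1 / (n\<^sup>2 - b\<^sup>2) - 1 / (n\<^sup>2 - a\<^sup>2)) = 1 / lam \<epsilon> (Suc k)"
  proof -
    have "lam \<epsilon> (Suc k) = n ^ 4 - (a\<^sup>2 + b\<^sup>2) * n\<^sup>2 + a\<^sup>2 * b\<^sup>2"
      unfolding ab by (simp add: lam_def n_def add.commute)
    also have "\<dots> = (n\<^sup>2 - b\<^sup>2) * (n\<^sup>2 - a\<^sup>2)" by (simp add: power2_eq_square power4_eq_xxxx algebra_simps)
    finally have l: "lam \<epsilon> (Suc k) = (n\<^sup>2 - b\<^sup>2) * (n\<^sup>2 - a\<^sup>2)" .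
    have "1 / x - 1 / y = (y - x) / (x * y)" if "x > 0" "y > 0" for x y :: real
      using that by (simp add: field_simps)
    then have "1 / (n\<^sup>2 - b\<^sup>2) - 1 / (n\<^sup>2 - a\<^sup>2) = (b\<^sup>2 - a\<^sup>2) / lam \<epsilon> (Suc k)"
      using nb l by simp
    then show ?thesis using b2 by simp
  qed
  moreover have "(1 / (b\<^sup>2 - a\<^sup>2)) * (exp (- n * t) * (sinh (b * t) / b) - exp (- n * t) * (sinh (a * t) / a))
     = exp (- (real k + 2) * t) * weight \<epsilon> t" for t
  proof -
    have "(1 / D) * (e * X - e * Y) = e * ((X - Y) / D)" for D e X Y :: real
      by (simp add: right_diff_distrib diff_divide_distrib)
    then show ?thesis
      unfolding weight_def Let_def a_b_def[symmetric] n_def[symmetric] .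
  qed
  ultimately show ?thesis by simp
qed

text \<open>The Laplace transform writes the difference of two kernel values as an average, with positive
  weight, of differences of Poisson kernels.\<close>

lemma kern_strict_antimono:
  assumes s: "-1 \<le> s" "s < s'" "s' \<le> 1"
  shows "kern \<epsilon> s' < kern \<epsilon> s"
proof -
  have abs: "\<bar>s\<bar> \<le> 1" "\<bar>s'\<bar> \<le> 1" using s by auto
  define c where "c k = poly (cheb (Suc k)) s' - poly (cheb (Suc k)) s" for k
  define g where "g k t = indicator {0..} t *\<^sub>R (exp (- (real k + 2) * t) * weight \<epsilon> t)" for k and t :: real
  define f where "f k t = g k t * ((real k + 2) * c k)" for k t
  have w0: "weight \<epsilon> t \<ge> 0" if "t \<ge> 0" for t
    using weight_pos[of t] that by (cases "t = 0") (auto simp: weight_def less_imp_le)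
  have abi: "(\<lambda>t. exp (- (real k + 2) * t) * weight \<epsilon> t) absolutely_integrable_on {0..}" for k
    by (rule nonnegative_absolutely_integrable_1) (use weight_laplace w0 in \<open>auto simp: integrable_on_def\<close>)
  have gi: "integrable lebesgue (g k)" for k
    using abi[of k] unfolding set_integrable_def g_def .
  have gI: "(\<integral>t. g k t \<partial>lebesgue) = 1 / lam \<epsilon> (Suc k)" for k
    using set_lebesgue_integral_eq_integral(2)[OF abi[of k]] weight_laplace[of k]
    unfolding set_lebesgue_integral_def g_def by (simp add: integral_unique)
  have g0: "g k t \<ge> 0" for k t
    using w0[of t] by (auto simp: g_def indicator_def)
  have cb: "\<bar>c k\<bar> \<le> 2 * (real k + 2)" for k
    using cheb_bound[OF abs(1), of "Suc k"] cheb_bound[OF abs(2), of "Suc k"] by (simp add: c_def)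
  have fi: "integrable lebesgue (f k)" for k
    unfolding f_def using gi by simp
  have fsum: "summable (\<lambda>k. \<integral>t. norm (f k t) \<partial>lebesgue)"
  proof (rule summable_comparison_test'[OF summable_mult[OF summable_Suc_square_lam[OF eps], of 2], where N=0])
    fix k
    have "(\<integral>t. norm (f k t) \<partial>lebesgue) = 1 / lam \<epsilon> (Suc k) * ((real k + 2) * \<bar>c k\<bar>)"
      using g0 by (simp add: f_def abs_mult gI)
    also have "\<dots> \<le> 1 / lam \<epsilon> (Suc k) * ((real k + 2) * (2 * (real k + 2)))"
      using cb[of k] lam_Suc_pos'[OF eps, of k] by (intro mult_left_mono) auto
    also have "\<dots> = 2 * ((real k + 2)\<^sup>2 / lam \<epsilon> (Suc k))"
    proof -
      have "1 / L * (x * (2 * x)) = 2 * (x\<^sup>2 / L)" for x L :: real by (simp add: power2_eq_square)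
      then show ?thesis .
    qed
    finally have "(\<integral>t. norm (f k t) \<partial>lebesgue) \<le> 2 * ((real k + 2)\<^sup>2 / lam \<epsilon> (Suc k))" .
    then show "norm (\<integral>t. norm (f k t) \<partial>lebesgue) \<le> 2 * ((real k + 2)\<^sup>2 / lam \<epsilon> (Suc k))" by simp
  qed
  define W where "W t = (if t > 0 then weight \<epsilon> t * exp (- t) * (poisson (exp (- t)) s' - poisson (exp (- t)) s) else 0)" for t
  have Wpos: "W t > 0" if "t > 0" for t
    using that weight_pos[OF that] poisson_strict_mono[of "exp (- t)" s s'] s by (simp add: W_def)
  have f_eq: "f k t = (weight \<epsilon> t * exp (- t)) * ((real (Suc k) + 1) * exp (- t) ^ Suc k * poly (cheb (Suc k)) s'
       - (real (Suc k) + 1) * exp (- t) ^ Suc k * poly (cheb (Suc k)) s)" if "t > 0" for k t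
  proof -
    have "exp (- (real k + 2) * t) = exp (- t) * exp (- t) ^ Suc k"
      by (simp add: exp_of_nat_mult[symmetric] exp_add[symmetric] algebra_simps)
    then show ?thesis
      using that by (simp add: f_def g_def c_def algebra_simps)
  qed
  have f_np: "f k t = 0" if "t \<le> 0" for k t
    using that by (cases "t = 0") (auto simp: f_def g_def weight_def)
  have fs: "(\<lambda>k. f k t) sums W t" for t
  proof (cases "t > 0")
    case True
    have r: "0 \<le> exp (- t)" "exp (- t) < 1" using True by auto
    let ?p = "\<lambda>s k. (real k + 1) * exp (- t) ^ k * poly (cheb k) s"
    have "(\<lambda>k. ?p s (Suc k)) sums (poisson (exp (- t)) s - 1)" if "\<bar>s\<bar> \<le> 1" for s
      using poisson_sums[OF r that] by (subst sums_Suc_iff) simp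
    from sums_mult[OF sums_diff[OF this[OF abs(2)] this[OF abs(1)]], of "weight \<epsilon> t * exp (- t)"]
    have "(\<lambda>k. f k t) sums (weight \<epsilon> t * exp (- t) * ((poisson (exp (- t)) s' - 1) - (poisson (exp (- t)) s - 1)))"
      unfolding f_eq[OF True] .
    then show ?thesis using True by (simp add: W_def)
  next
    case False
    then show ?thesis by (simp add: f_np W_def)
  qed
  have fa: "summable (\<lambda>k. norm (f k t))" for t
  proof (cases "t > 0")
    case True
    have r: "0 \<le> exp (- t)" "exp (- t) < 1" using True by auto
    let ?b = "\<lambda>k. (real k + 1)\<^sup>2 * exp (- t) ^ k"
    have "summable (\<lambda>k. (weight \<epsilon> t * exp (- t)) * (2 * ?b (Suc k)))"
      using summable_square_power[OF r] by (intro summable_mult) (subst summable_Suc_iff)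
    then show ?thesis
    proof (rule summable_comparison_test'[where N=0])
      fix k
      let ?p = "\<lambda>s k. (real k + 1) * exp (- t) ^ k * poly (cheb k) s"
      have "\<bar>?p s' (Suc k) - ?p s (Suc k)\<bar> \<le> 2 * ?b (Suc k)"
        using poisson_bound[OF r abs(1), of "Suc k"] poisson_bound[OF r abs(2), of "Suc k"] by linarith
      then have "(weight \<epsilon> t * exp (- t)) * \<bar>?p s' (Suc k) - ?p s (Suc k)\<bar> \<le> (weight \<epsilon> t * exp (- t)) * (2 * ?b (Suc k))"
        using w0[of t] True by (intro mult_left_mono) auto
      moreover have "norm (f k t) = (weight \<epsilon> t * exp (- t)) * \<bar>?p s' (Suc k) - ?p s (Suc k)\<bar>"
        unfolding f_eq[OF True] real_norm_def abs_mult using w0[of t] True by simp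
      ultimately show "norm (norm (f k t)) \<le> (weight \<epsilon> t * exp (- t)) * (2 * ?b (Suc k))" by simp
    qed
  next
    case False
    then show ?thesis by (simp add: f_np)
  qed
  have W_eq: "W = (\<lambda>t. \<Sum>k. f k t)"
    using sums_unique[OF fs] by (intro ext) simp
  have Wi: "integrable lebesgue W"
    unfolding W_eq by (rule integrable_suminf) (use fi fa fsum in auto)
  have "(\<lambda>k. \<integral>t. f k t \<partial>lebesgue) sums (\<integral>t. W t \<partial>lebesgue)"
    unfolding W_eq by (rule sums_integral) (use fi fa fsum in auto)
  moreover have "(\<integral>t. f k t \<partial>lebesgue) = (real (Suc k) + 1) / lam \<epsilon> (Suc k) * poly (cheb (Suc k)) s'
     - (real (Suc k) + 1) / lam \<epsilon> (Suc k) * poly (cheb (Suc k)) s" for k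
  proof -
    have "(\<integral>t. f k t \<partial>lebesgue) = 1 / lam \<epsilon> (Suc k) * ((real k + 2) * c k)"
      by (simp add: f_def gI)
    then show ?thesis
      by (simp add: c_def algebra_simps diff_divide_distrib add_divide_distrib)
  qed
  moreover have "(\<lambda>k. (real (Suc k) + 1) / lam \<epsilon> (Suc k) * poly (cheb (Suc k)) s) sums (- kern \<epsilon> s - 1 / lam \<epsilon> 0)"
    if "\<bar>s\<bar> \<le> 1" for s
    using summable_sums[OF summable_kern[OF eps that]] by (subst sums_Suc_iff) (simp add: kern_def)
  ultimately have "(\<integral>t. W t \<partial>lebesgue) = (- kern \<epsilon> s' - 1 / lam \<epsilon> 0) - (- kern \<epsilon> s - 1 / lam \<epsilon> 0)"
    using sums_diff[OF _ _, of _ "- kern \<epsilon> s' - 1 / lam \<epsilon> 0" _ "- kern \<epsilon> s - 1 / lam \<epsilon> 0"] abs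
    by (simp add: sums_unique2)
  moreover have "(\<integral>t. W t \<partial>lebesgue) > 0"
  proof -
    have W0: "W t \<ge> 0" for t using Wpos[of t] by (cases "t > 0") (auto simp: W_def)
    have "(\<integral>t. W t \<partial>lebesgue) \<noteq> 0"
    proof
      assume "(\<integral>t. W t \<partial>lebesgue) = 0"
      then have "AE t in lebesgue. W t = 0"
        using integral_nonneg_eq_0_iff_AE[OF Wi] W0 by simp
      then have "AE t in lebesgue. \<not> t \<in> {0<..<1::real}"
      proof eventually_elim
        case (elim t)
        then show ?case using Wpos[of t] by auto
      qed
      then have "{0<..<1::real} \<in> null_sets lebesgue"
        by (subst (asm) AE_iff_null_sets[symmetric]) auto
      then show False
        using negligible_iff_null_sets[of "{0<..<1::real}"] open_not_negligible[of "{0<..<1::real}"] by auto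
    qed
    then show ?thesis using integral_nonneg_AE[of W lebesgue] W0 by (simp add: less_le)
  qed
  ultimately show ?thesis by simp
qed

end

section \<open>Zonal integral operators\<close>

definition zint :: "real poly \<Rightarrow> (real^4 \<Rightarrow> real) \<Rightarrow> real^4 \<Rightarrow> real" where
  "zint p f x = (\<integral>y. poly p (x \<bullet> y) * f y \<partial>mu)"

lemma integrable_zint:
  "continuous_on S3 f \<Longrightarrow> integrable mu (\<lambda>y. poly p (x \<bullet> y) * f y)"
  by (intro integrable_mu_continuous continuous_intros)

lemma continuous_on_coord_mult:
  fixes f :: "real^4 \<Rightarrow> real"
  shows "continuous_on S3 f \<Longrightarrow> continuous_on S3 (\<lambda>y. y $ i * f y)"
  by (intro continuous_intros)

lemma zint_0: "zint 0 f x = 0"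
  by (simp add: zint_def)

lemma zint_add: "continuous_on S3 f \<Longrightarrow> zint (p + q) f x = zint p f x + zint q f x"
  by (simp add: zint_def distrib_right integrable_zint)

lemma zint_diff: "continuous_on S3 f \<Longrightarrow> zint (p - q) f x = zint p f x - zint q f x"
  by (simp add: zint_def left_diff_distrib integrable_zint)

lemma zint_smult: "zint (smult c p) f x = c * zint p f x"
  by (simp add: zint_def mult.assoc)

lemma zint_pCons_0:
  assumes f: "continuous_on S3 f"
  shows "zint (pCons 0 p) f x = (\<Sum>i\<in>UNIV. x $ i * zint p (\<lambda>y. y $ i * f y) x)"
proof -
  have "zint (pCons 0 p) f x = (\<integral>y. (\<Sum>i\<in>UNIV. x $ i * (poly p (x \<bullet> y) * (y $ i * f y))) \<partial>mu)"
    unfolding zint_def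
    by (rule integral_mu_cong) (simp add: inner_vec_def sum_distrib_left sum_distrib_right mult_ac)
  also have "\<dots> = (\<Sum>i\<in>UNIV. \<integral>y. x $ i * (poly p (x \<bullet> y) * (y $ i * f y)) \<partial>mu)"
    by (intro Bochner_Integration.integral_sum integrable_mult_right integrable_zint continuous_on_coord_mult f)
  finally show ?thesis by (simp add: zint_def)
qed

lemma zint_pCons:
  assumes f: "continuous_on S3 f"
  shows "zint (pCons a p) f x = a * (\<integral>y. f y \<partial>mu) + (\<Sum>i\<in>UNIV. x $ i * zint p (\<lambda>y. y $ i * f y) x)"
proof -
  have "zint (pCons a p) f x = zint ([:a:] + pCons 0 p) f x" by simp
  also have "\<dots> = a * (\<integral>y. f y \<partial>mu) + zint (pCons 0 p) f x"
    unfolding zint_add[OF f] by (simp add: zint_def)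
  finally show ?thesis unfolding zint_pCons_0[OF f] .
qed

text \<open>Induction over the coefficients replaces differentiation under the integral sign: a factor
  \<open>x \<bullet> y\<close> of the kernel splits into coordinates of \<open>x\<close>, which leave the integral, and coordinates of
  \<open>y\<close>, which are absorbed by \<open>f\<close>.\<close>

lemma zint_has_derivative:
  assumes "continuous_on S3 f"
  shows "(zint p f has_derivative (\<lambda>h. \<Sum>i\<in>UNIV. h $ i * zint (pderiv p) (\<lambda>y. y $ i * f y) x)) (at x)"
  using assms
proof (induction p arbitrary: f)
  case 0
  then show ?case by (simp add: zint_0[abs_def])
next
  case (pCons a p)
  note f = pCons.prems
  note yf = continuous_on_coord_mult[OF f]
  have e: "zint (pCons a p) f = (\<lambda>x. a * (\<integral>y. f y \<partial>mu) + (\<Sum>i\<in>UNIV. x $ i * zint p (\<lambda>y. y $ i * f y) x))"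
    by (rule ext) (rule zint_pCons[OF f])
  have "((\<lambda>x. x $ i * zint p (\<lambda>y. y $ i * f y) x) has_derivative
      (\<lambda>h. x $ i * (\<Sum>j\<in>UNIV. h $ j * zint (pderiv p) (\<lambda>y. y $ j * (y $ i * f y)) x) + h $ i * zint p (\<lambda>y. y $ i * f y) x)) (at x)" for i
    by (intro has_derivative_mult pCons.IH yf bounded_linear_imp_has_derivative bounded_linear_vec_nth)
  then have D: "(zint (pCons a p) f has_derivative
      (\<lambda>h. 0 + (\<Sum>i\<in>UNIV. x $ i * (\<Sum>j\<in>UNIV. h $ j * zint (pderiv p) (\<lambda>y. y $ j * (y $ i * f y)) x) + h $ i * zint p (\<lambda>y. y $ i * f y) x))) (at x)"
    unfolding e by (intro has_derivative_add has_derivative_const has_derivative_sum)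
  have eq: "0 + (\<Sum>i\<in>UNIV. x $ i * (\<Sum>j\<in>UNIV. h $ j * zint (pderiv p) (\<lambda>y. y $ j * (y $ i * f y)) x) + h $ i * zint p (\<lambda>y. y $ i * f y) x)
     = (\<Sum>j\<in>UNIV. h $ j * zint (pderiv (pCons a p)) (\<lambda>y. y $ j * f y) x)" for h
  proof -
    have "(\<Sum>i\<in>UNIV. x $ i * (\<Sum>j\<in>UNIV. h $ j * zint (pderiv p) (\<lambda>y. y $ j * (y $ i * f y)) x))
       = (\<Sum>j\<in>UNIV. h $ j * (\<Sum>i\<in>UNIV. x $ i * zint (pderiv p) (\<lambda>y. y $ i * (y $ j * f y)) x))"
      unfolding sum_distrib_left by (subst sum.swap) (simp add: mult_ac)
    then show ?thesis
      by (simp add: pderiv_pCons zint_add[OF yf] zint_pCons_0[OF yf] sum.distrib distrib_left)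
  qed
  show ?case using D unfolding eq .
qed

lemma continuous_on_zint: "continuous_on S3 f \<Longrightarrow> continuous_on X (zint p f)"
  by (rule continuous_at_imp_continuous_on, rule ballI, rule has_derivative_continuous, erule zint_has_derivative)

lemma smooth_zint:
  assumes "continuous_on S3 f" shows "Cinf (radial_ext (zint p f))"
  using assms
proof (induction p arbitrary: f)
  case 0
  have "radial_ext (zint 0 f) = (\<lambda>_. 0)" by (rule ext) (simp add: radial_ext_def zint_0)
  then show ?case by (simp add: Cinf_const)
next
  case (pCons a p)
  note f = pCons.prems
  have "radial_ext (zint (pCons a p) f) = (\<lambda>x. a * (\<integral>y. f y \<partial>mu)
     + (\<Sum>i\<in>UNIV. (inverse (norm x) * x $ i) * radial_ext (zint p (\<lambda>y. y $ i * f y)) x))"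
    by (rule ext) (simp add: radial_ext_def zint_pCons[OF f])
  moreover have "Cinf \<dots>"
    by (intro Cinf_add Cinf_const Cinf_sum Cinf_mult Cinf_inverse_norm Cinf_coord pCons.IH
        continuous_on_coord_mult f finite)
  ultimately show ?case by simp
qed

text \<open>The flow of a rotation field preserves the norm, so it commutes with radial extension.\<close>

lemma lie_radial_ext:
  assumes smooth: "Cinf (radial_ext G)"
    and der: "\<And>x. (G has_derivative G' x) (at x)" and x: "x \<noteq> 0"
  shows "lie a (radial_ext G) x = radial_ext (\<lambda>x. G' x (quat a x)) x"
proof -
  let ?u = "x /\<^sub>R norm x"
  have rot0: "rot a 0 y = y" for y by (simp add: rot_def)
  have "((\<lambda>t. radial_ext G (rot a t x)) has_real_derivative
      frechet_derivative (radial_ext G) (at x) (quat a (rot a 0 x))) (at 0)"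
    by (rule rot_has_derivative) (use Cinf_has_derivative[OF smooth x] in \<open>simp add: rot0\<close>)
  then have 1: "((\<lambda>t. radial_ext G (rot a t x)) has_real_derivative lie a (radial_ext G) x) (at 0)"
    by (simp add: rot0 lie_def)
  have "((\<lambda>t. G (rot a t ?u)) has_real_derivative G' ?u (quat a (rot a 0 ?u))) (at 0)"
    by (rule rot_has_derivative) (use der[of ?u] in \<open>simp add: rot0\<close>)
  moreover have "(\<lambda>t. G (rot a t ?u)) = (\<lambda>t. radial_ext G (rot a t x))"
  proof
    fix t
    have "rot a t ?u = rot a t x /\<^sub>R norm (rot a t x)"
      unfolding rot_norm by (simp add: rot_def linear_scale[OF quat_linear] scaleR_add_right mult.commute)
    then show "G (rot a t ?u) = radial_ext G (rot a t x)"
      by (simp only: radial_ext_def)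
  qed
  ultimately have 2: "((\<lambda>t. radial_ext G (rot a t x)) has_real_derivative G' ?u (quat a ?u)) (at 0)"
    by (simp only: rot0)
  show ?thesis
    using DERIV_unique[OF 1 2] by (simp add: radial_ext_def)
qed

lemma lap_cong:
  assumes "\<And>y. y \<noteq> 0 \<Longrightarrow> F y = G y" "Cinf F" "x \<noteq> 0"
  shows "lap F x = lap G x"
proof -
  have "lie a (lie a F) x = lie a (lie a G) x" for a
    using assms by (intro lie_cong Cinf_lie) auto
  then show ?thesis by (simp add: lap_def)
qed

text \<open>Every derivative falls on the kernel, so the Laplacian acts on the polynomial.\<close>

lemma lap_zint:
  assumes f: "continuous_on S3 f" and x: "x \<noteq> 0"
  shows "lap (radial_ext (zint p f)) x = radial_ext (zint (zonal_lap p) f) x"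
proof -
  note yf = continuous_on_coord_mult[OF f]
  define p1 p2 where "p1 = pderiv p" "p2 = pderiv p1"
  define H where "H a x = (\<Sum>i\<in>UNIV. quat a x $ i * zint p1 (\<lambda>y. y $ i * f y) x)" for a x
  define H' where "H' a x h = (\<Sum>i\<in>UNIV. quat a x $ i * (\<Sum>j\<in>UNIV. h $ j * zint p2 (\<lambda>y. y $ j * (y $ i * f y)) x)
     + quat a h $ i * zint p1 (\<lambda>y. y $ i * f y) x)" for a x h
  have 1: "lie a (radial_ext (zint p f)) x = radial_ext (H a) x" if "x \<noteq> 0" for a x
    using lie_radial_ext[OF smooth_zint[OF f] zint_has_derivative[OF f] that]
    by (simp add: H_def[abs_def] p1_p2_def)
  have HC: "Cinf (radial_ext (H a))" for a
    by (rule Cinf_cong[OF 1 Cinf_lie[OF smooth_zint[OF f]]])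
  have HD: "(H a has_derivative H' a x) (at x)" for a x
    unfolding H_def[abs_def] H'_def[abs_def] p1_p2_def
    by (intro has_derivative_sum has_derivative_mult zint_has_derivative yf bounded_linear_imp_has_derivative
        bounded_linear_compose[OF bounded_linear_vec_nth quat_bounded_linear])
  have 2: "lie a (lie a (radial_ext (zint p f))) x = radial_ext (\<lambda>x. H' a x (quat a x)) x" for a
  proof -
    have "lie a (lie a (radial_ext (zint p f))) x = lie a (radial_ext (H a)) x"
      using 1 by (intro lie_cong Cinf_lie smooth_zint f x)
    also have "\<dots> = radial_ext (\<lambda>x. H' a x (quat a x)) x"
      by (rule lie_radial_ext[OF HC HD x])
    finally show ?thesis .
  qed
  have 3: "(\<Sum>a\<in>UNIV. H' a x (quat a x)) = zint (zonal_lap p) f x" if "x \<in> S3" for x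
  proof -
    let ?Z = "\<lambda>i j. zint p2 (\<lambda>y. y $ j * (y $ i * f y)) x"
    let ?z = "\<lambda>i. zint p1 (\<lambda>y. y $ i * f y) x"
    have "(\<Sum>a\<in>UNIV. H' a x (quat a x)) =
       (\<Sum>a\<in>(UNIV::3 set). \<Sum>i\<in>UNIV. \<Sum>j\<in>UNIV. quat a x $ i * quat a x $ j * ?Z i j) - 3 * (\<Sum>i\<in>UNIV. x $ i * ?z i)"
      by (simp add: H'_def quat_quat sum.distrib sum_distrib_left sum_subtractf sum_negf mult.assoc)
    also have "(\<Sum>a\<in>(UNIV::3 set). \<Sum>i\<in>UNIV. \<Sum>j\<in>UNIV. quat a x $ i * quat a x $ j * ?Z i j)
       = (\<Sum>i\<in>UNIV. \<Sum>j\<in>UNIV. (\<Sum>a\<in>UNIV. quat a x $ i * quat a x $ j) * ?Z i j)"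
      by (subst sum.swap, rule sum.cong[OF refl], subst sum.swap) (simp add: sum_distrib_right)
    also have "\<dots> = (\<Sum>i\<in>UNIV. ?Z i i) - (\<Sum>i\<in>UNIV. x $ i * (\<Sum>j\<in>UNIV. x $ j * ?Z i j))"
    proof -
      have "((if i = j then 1 else 0) - x $ i * x $ j) * ?Z i j
          = (if i = j then ?Z i j else 0) - x $ i * (x $ j * ?Z i j)" for i j
        by (simp add: left_diff_distrib)
      then show ?thesis
        unfolding quat_frame_unit[OF that] by (simp add: sum_subtractf sum_distrib_left)
    qed
    also have "(\<Sum>i\<in>UNIV. x $ i * (\<Sum>j\<in>UNIV. x $ j * ?Z i j)) = zint (pCons 0 (pCons 0 p2)) f x"
      by (simp add: zint_pCons_0[OF f] zint_pCons_0[OF yf])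
    also have "(\<Sum>i\<in>UNIV. ?Z i i) = zint p2 f x"
    proof -
      have "(\<Sum>i\<in>UNIV. ?Z i i) = (\<integral>y. (\<Sum>i\<in>UNIV. poly p2 (x \<bullet> y) * (y $ i * (y $ i * f y))) \<partial>mu)"
        unfolding zint_def
        by (intro Bochner_Integration.integral_sum[symmetric] integrable_zint continuous_on_coord_mult f)
      also have "\<dots> = zint p2 f x"
        unfolding zint_def
      proof (rule integral_mu_cong)
        fix y assume "y \<in> S3"
        then have "(\<Sum>i\<in>UNIV. y $ i * y $ i) = 1"
          using norm_eq_1[of y] by (simp add: inner_vec_def)
        moreover have "(\<Sum>i\<in>UNIV. poly p2 (x \<bullet> y) * (y $ i * (y $ i * f y))) = (\<Sum>i\<in>UNIV. y $ i * y $ i) * (poly p2 (x \<bullet> y) * f y)"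
          by (simp add: sum_distrib_left sum_distrib_right mult_ac)
        ultimately show "(\<Sum>i\<in>UNIV. poly p2 (x \<bullet> y) * (y $ i * (y $ i * f y))) = poly p2 (x \<bullet> y) * f y" by simp
      qed
      finally show ?thesis .
    qed
    also have "(\<Sum>i\<in>UNIV. x $ i * ?z i) = zint (pCons 0 p1) f x"
      by (rule zint_pCons_0[OF f, symmetric])
    also have "zint p2 f x - zint (pCons 0 (pCons 0 p2)) f x - 3 * zint (pCons 0 p1) f x
      = zint (p2 - pCons 0 (pCons 0 p2) - smult 3 (pCons 0 p1)) f x"
      unfolding zint_diff[OF f] zint_smult ..
    also have "p2 - pCons 0 (pCons 0 p2) - smult 3 (pCons 0 p1) = zonal_lap p"
      by (simp add: zonal_lap_def p1_p2_def)
    finally show ?thesis .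
  qed
  have "x /\<^sub>R norm x \<in> S3" using x by simp
  from 3[OF this] show ?thesis
    unfolding lap_def 2 by (simp only: radial_ext_def)
qed

definition paneitz :: "real \<Rightarrow> (real^4 \<Rightarrow> real) \<Rightarrow> real^4 \<Rightarrow> real" where
  "paneitz \<epsilon> F x = lap (lap F) x + 1/2 * lap F x - (15/16 - \<epsilon>) * F x"

lemma paneitz_zint:
  assumes f: "continuous_on S3 f" and x: "x \<in> S3"
  shows "paneitz \<epsilon> (radial_ext (zint p f)) x = zint (zonal_P \<epsilon> p) f x"
proof -
  have x0: "x \<noteq> 0" using S3_nonzero[OF x] .
  have "lap (lap (radial_ext (zint p f))) x = lap (radial_ext (zint (zonal_lap p) f)) x"
    by (rule lap_cong) (auto simp: lap_zint f x0 intro!: Cinf_lap smooth_zint f)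
  then show ?thesis
    by (simp add: paneitz_def lap_zint[OF f x0] radial_ext_on_S3[OF x] zonal_P_def zint_add[OF f] zint_diff[OF f] zint_smult)
qed

section \<open>The Poisson kernel on the sphere\<close>

lemma integral_zonal_lap:
  assumes x: "x \<in> S3"
  shows "(\<integral>y. poly (zonal_lap p) (x \<bullet> y) \<partial>mu) = 0"
proof -
  define p1 p2 where "p1 = pderiv p" "p2 = pderiv p1"
  define F' where "F' a y h = poly p1 (x \<bullet> y) * (x \<bullet> quat a h) + (x \<bullet> h) * poly p2 (x \<bullet> y) * (x \<bullet> quat a y)" for a y h
  have D: "((\<lambda>y. poly p1 (x \<bullet> y) * (x \<bullet> quat a y)) has_derivative F' a y) (at y)" for a y
  proof -
    have "((\<lambda>y. x \<bullet> y) has_derivative (\<lambda>h. x \<bullet> h)) (at y)"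
      by (intro bounded_linear_imp_has_derivative bounded_linear_inner_right)
    moreover have "(poly p1 has_real_derivative poly p2 (x \<bullet> y)) (at (x \<bullet> y))"
      unfolding p1_p2_def by (rule poly_DERIV)
    ultimately have 1: "((\<lambda>y. poly p1 (x \<bullet> y)) has_derivative (\<lambda>h. (x \<bullet> h) * poly p2 (x \<bullet> y))) (at y)"
      using DERIV_compose_FDERIV by blast
    have 2: "((\<lambda>y. x \<bullet> quat a y) has_derivative (\<lambda>h. x \<bullet> quat a h)) (at y)"
      by (intro bounded_linear_imp_has_derivative bounded_linear_compose[OF bounded_linear_inner_right quat_bounded_linear])
    show ?thesis unfolding F'_def[abs_def] by (rule has_derivative_mult[OF 1 2])
  qed
  have c: "continuous_on S3 (\<lambda>y. F' a y (quat a y))" for a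
    unfolding F'_def by (intro continuous_intros)
  have "poly (zonal_lap p) (x \<bullet> y) = (\<Sum>a\<in>UNIV. F' a y (quat a y))" if y: "y \<in> S3" for y
  proof -
    have "(\<Sum>a\<in>UNIV. F' a y (quat a y)) =
       - 3 * (x \<bullet> y) * poly p1 (x \<bullet> y) + (\<Sum>a\<in>UNIV. (quat a y \<bullet> x) * (quat a y \<bullet> x)) * poly p2 (x \<bullet> y)"
      by (simp add: F'_def quat_quat sum.distrib sum_distrib_left sum_distrib_right sum_subtractf sum_negf inner_commute[of x] mult_ac)
    also have "\<dots> = - 3 * (x \<bullet> y) * poly p1 (x \<bullet> y) + (1 - (x \<bullet> y)\<^sup>2) * poly p2 (x \<bullet> y)"
    proof -
      have "(\<Sum>a\<in>UNIV. (quat a y \<bullet> x) * (quat a y \<bullet> x)) = 1 - (x \<bullet> y)\<^sup>2"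
        unfolding quat_frame using x y by (simp add: norm_eq_1 power2_eq_square inner_commute[of y x])
      then show ?thesis by (simp only:)
    qed
    finally show ?thesis
      by (simp add: zonal_lap_def p1_p2_def power2_eq_square algebra_simps)
  qed
  then have "(\<integral>y. poly (zonal_lap p) (x \<bullet> y) \<partial>mu) = (\<integral>y. (\<Sum>a\<in>UNIV. F' a y (quat a y)) \<partial>mu)"
    by (rule integral_mu_cong)
  also have "\<dots> = (\<Sum>a\<in>UNIV. \<integral>y. F' a y (quat a y) \<partial>mu)"
    by (intro Bochner_Integration.integral_sum integrable_mu_continuous c)
  also have "\<dots> = 0"
    using integral_rotation_derivative[OF D c] by simp
  finally show ?thesis .
qed

lemma integral_cheb:
  assumes "x \<in> S3" "k > 0"
  shows "(\<integral>y. poly (cheb k) (x \<bullet> y) \<partial>mu) = 0"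
  using integral_zonal_lap[OF assms(1), of "cheb k"] assms(2) by (simp add: zonal_lap_cheb)

lemma integral_const_mu: "(\<integral>y. c \<partial>mu) = c * mass"
  by (simp add: mass_def)

lemma integral_poisson_poly:
  assumes x: "x \<in> S3"
  shows "(\<integral>y. poly (poisson_poly r (Suc n)) (x \<bullet> y) \<partial>mu) = mass"
proof -
  have "(\<integral>y. poly (poisson_poly r (Suc n)) (x \<bullet> y) \<partial>mu)
      = (\<integral>y. (\<Sum>k<Suc n. ((real k + 1) * r ^ k) * poly (cheb k) (x \<bullet> y)) \<partial>mu)"
    by (simp add: poisson_poly_def poly_sum del: sum.lessThan_Suc)
  also have "\<dots> = (\<Sum>k<Suc n. \<integral>y. ((real k + 1) * r ^ k) * poly (cheb k) (x \<bullet> y) \<partial>mu)"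
    by (intro Bochner_Integration.integral_sum integrable_mu_continuous continuous_intros)
  also have "\<dots> = (\<Sum>k<Suc n. if k = 0 then mass else 0)"
    by (rule sum.cong) (auto simp: integral_cheb[OF x] mass_def)
  finally show ?thesis by (simp add: sum.lessThan_Suc_shift del: sum.lessThan_Suc)
qed

lemma inner_S3_le: "x \<in> S3 \<Longrightarrow> y \<in> S3 \<Longrightarrow> \<bar>x \<bullet> y\<bar> \<le> 1" for x y :: "real^4"
  using Cauchy_Schwarz_ineq2[of x y] by simp

lemma integral_abs_diff_le:
  fixes f g :: "real^4 \<Rightarrow> real"
  assumes "continuous_on S3 f" "continuous_on S3 g" "\<And>y. y \<in> S3 \<Longrightarrow> \<bar>f y - g y\<bar> \<le> c"
  shows "\<bar>(\<integral>y. f y \<partial>mu) - (\<integral>y. g y \<partial>mu)\<bar> \<le> c * mass"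
proof -
  note i = integrable_mu_continuous[OF assms(1)] integrable_mu_continuous[OF assms(2)]
  have "\<bar>(\<integral>y. f y \<partial>mu) - (\<integral>y. g y \<partial>mu)\<bar> = \<bar>\<integral>y. f y - g y \<partial>mu\<bar>"
    using i by simp
  also have "\<dots> \<le> (\<integral>y. \<bar>f y - g y\<bar> \<partial>mu)"
    by (rule integral_abs_bound)
  also have "\<dots> \<le> (\<integral>y. c \<partial>mu)"
    using i assms(3) by (intro integral_mono_AE AE_mu_I) auto
  also have "\<dots> = c * mass" by (rule integral_const_mu)
  finally show ?thesis .
qed

lemma continuous_on_poisson:
  assumes "0 \<le> r" "r < 1" "x \<in> S3" shows "continuous_on S3 (\<lambda>y. poisson r (x \<bullet> y))"
  unfolding poisson_def
proof (intro continuous_intros ballI)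
  fix y assume "y \<in> S3"
  then have "1 - 2 * r * (x \<bullet> y) + r\<^sup>2 > 0"
    by (intro poisson_denominator assms(1,2) inner_S3_le[OF assms(3)])
  then show "(1 - 2 * r * (x \<bullet> y) + r\<^sup>2)\<^sup>2 \<noteq> 0" by simp
qed

lemma integral_poisson:
  assumes r: "0 \<le> r" "r < 1" and x: "x \<in> S3"
  shows "(\<integral>y. poisson r (x \<bullet> y) \<partial>mu) = mass"
proof -
  have "\<bar>(\<integral>y. poisson r (x \<bullet> y) \<partial>mu) - mass\<bar> \<le> \<delta> * mass" if d: "\<delta> > 0" for \<delta>
  proof -
    obtain N where N: "\<And>n s. n \<ge> N \<Longrightarrow> \<bar>s\<bar> \<le> 1 \<Longrightarrow> \<bar>poly (poisson_poly r n) s - poisson r s\<bar> \<le> \<delta>"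
      using poisson_poly_close[OF r d] by blast
    have "\<bar>(\<integral>y. poisson r (x \<bullet> y) \<partial>mu) - (\<integral>y. poly (poisson_poly r (Suc N)) (x \<bullet> y) \<partial>mu)\<bar> \<le> \<delta> * mass"
      using N[of "Suc N"] inner_S3_le[OF x]
      by (intro integral_abs_diff_le continuous_on_poisson r x continuous_intros) (simp add: abs_minus_commute)
    then show ?thesis unfolding integral_poisson_poly[OF x] .
  qed
  from this[of "\<delta> / mass" for \<delta>] have "\<bar>(\<integral>y. poisson r (x \<bullet> y) \<partial>mu) - mass\<bar> \<le> \<delta>" if "\<delta> > 0" for \<delta>
    using that mass_pos by simp
  then show ?thesis
    using field_le_epsilon[of "\<bar>(\<integral>y. poisson r (x \<bullet> y) \<partial>mu) - mass\<bar>" 0] by simp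
qed

text \<open>Since the Poisson kernel has constant mass and concentrates on the diagonal, it is an
  approximate identity.\<close>

lemma poisson_approximate_identity:
  assumes f: "continuous_on S3 f" and d: "\<delta> > 0"
  shows "\<exists>r0<1. \<forall>r x. r0 \<le> r \<and> 0 \<le> r \<and> r < 1 \<and> x \<in> S3 \<longrightarrow>
      \<bar>(\<integral>y. poisson r (x \<bullet> y) * f y \<partial>mu) - mass * f x\<bar> \<le> \<delta>"
proof -
  obtain B where B: "\<And>x. x \<in> S3 \<Longrightarrow> \<bar>f x\<bar> \<le> B"
    using continuous_compact_bound[OF compact_sphere f] by metis
  have B0: "B \<ge> 0" using B[of "axis 1 1"] by simp
  define \<eta> where "\<eta> = \<delta> / (2 * mass)"
  have eta: "\<eta> > 0" using d mass_pos by (simp add: \<eta>_def)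
  obtain t where t: "t > 0" "\<And>x y. x \<in> S3 \<Longrightarrow> y \<in> S3 \<Longrightarrow> dist y x < t \<Longrightarrow> dist (f y) (f x) < \<eta>"
    using compact_uniformly_continuous[OF f compact_sphere] eta unfolding uniformly_continuous_on_def by metis
  define c where "c = t\<^sup>2 / 2"
  have c: "c > 0" using t by (simp add: c_def)
  have "((\<lambda>r. 2 * B * ((1 - r\<^sup>2) / c\<^sup>2) * mass) \<longlongrightarrow> 2 * B * ((1 - 1\<^sup>2) / c\<^sup>2) * mass) (at_left (1::real))"
    using c by (intro tendsto_intros) auto
  then have "eventually (\<lambda>r. 2 * B * ((1 - r\<^sup>2) / c\<^sup>2) * mass < \<delta>/2) (at_left (1::real))"
    using d by (intro order_tendstoD(2)[where y="2 * B * ((1 - 1\<^sup>2) / c\<^sup>2) * mass"]) auto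
  then obtain r0 where r0: "r0 < 1" "\<And>r. r0 < r \<Longrightarrow> r < 1 \<Longrightarrow> 2 * B * ((1 - r\<^sup>2) / c\<^sup>2) * mass < \<delta>/2"
    using eventually_at_left_field[of _ "1::real"] by auto
  have "\<bar>(\<integral>y. poisson r (x \<bullet> y) * f y \<partial>mu) - mass * f x\<bar> \<le> \<delta>"
    if r: "max (1/2) ((r0 + 1)/2) \<le> r" "r < 1" and x: "x \<in> S3" for r x
  proof -
    have r': "0 \<le> r" "1/2 \<le> r" "r0 < r" using r r0(1) by auto
    let ?Q = "\<lambda>y. poisson r (x \<bullet> y)"
    define C where "C = 2 * B * ((1 - r\<^sup>2) / c\<^sup>2)"
    have C0: "C \<ge> 0" using B0 r' r by (simp add: C_def power_le_one)
    note Qc = continuous_on_poisson[OF r'(1) r(2) x]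
    have "\<bar>(\<integral>y. ?Q y * f y \<partial>mu) - mass * f x\<bar> = \<bar>\<integral>y. ?Q y * (f y - f x) \<partial>mu\<bar>"
    proof -
      have "(\<integral>y. ?Q y * (f y - f x) \<partial>mu) = (\<integral>y. ?Q y * f y - f x * ?Q y \<partial>mu)"
        by (simp add: algebra_simps)
      also have "\<dots> = (\<integral>y. ?Q y * f y \<partial>mu) - (\<integral>y. f x * ?Q y \<partial>mu)"
        by (intro Bochner_Integration.integral_diff integrable_mu_continuous continuous_intros Qc f)
      finally show ?thesis by (simp add: integral_poisson[OF r'(1) r(2) x] mult.commute)
    qed
    also have "\<dots> \<le> (\<integral>y. \<bar>?Q y * (f y - f x)\<bar> \<partial>mu)" by (rule integral_abs_bound)
    also have "\<dots> \<le> (\<integral>y. \<eta> * ?Q y + C \<partial>mu)"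
    proof (intro integral_mono_AE AE_mu_I)
      show "integrable mu (\<lambda>y. \<bar>?Q y * (f y - f x)\<bar>)" "integrable mu (\<lambda>y. \<eta> * ?Q y + C)"
        by (intro integrable_mu_continuous continuous_intros Qc f)+
      fix y assume y: "y \<in> S3"
      have Q0: "?Q y \<ge> 0" by (rule poisson_nonneg[OF r'(1) r(2)])
      show "\<bar>?Q y * (f y - f x)\<bar> \<le> \<eta> * ?Q y + C"
      proof (cases "dist y x < t")
        case True
        then have "\<bar>f y - f x\<bar> \<le> \<eta>" using t(2)[OF x y] by (simp add: dist_real_def)
        then have "?Q y * \<bar>f y - f x\<bar> \<le> ?Q y * \<eta>" using Q0 by (rule mult_left_mono)
        then show ?thesis using Q0 C0 by (simp add: abs_mult mult.commute)
      next
        case False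
        have "(norm (y - x))\<^sup>2 = 2 - 2 * (x \<bullet> y)"
          using x y by (simp add: norm_eq_1 power2_norm_eq_inner inner_diff_left inner_diff_right inner_commute)
        moreover have "(norm (y - x))\<^sup>2 \<ge> t\<^sup>2"
          using False t(1) by (intro power_mono) (auto simp: dist_norm)
        ultimately have "x \<bullet> y \<le> 1 - c" by (simp add: c_def)
        then have "?Q y \<le> (1 - r\<^sup>2) / c\<^sup>2"
          by (intro poisson_away_from_pole r'(2) r(2) inner_S3_le[OF x y] c)
        moreover have "\<bar>f y - f x\<bar> \<le> 2 * B" using B[OF x] B[OF y] by linarith
        ultimately have "?Q y * \<bar>f y - f x\<bar> \<le> (1 - r\<^sup>2) / c\<^sup>2 * (2 * B)"
          using Q0 r' r by (intro mult_mono) (auto simp: power_le_one)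
        moreover have "\<eta> * ?Q y \<ge> 0" using Q0 eta by simp
        ultimately show ?thesis using Q0 by (simp add: abs_mult C_def mult.commute)
      qed
    qed
    also have "\<dots> = \<eta> * mass + C * mass"
      using integrable_mu_continuous[OF Qc]
      by (simp add: integral_poisson[OF r'(1) r(2) x] integral_const_mu mass_def)
    also have "\<dots> \<le> \<delta>"
      using r0(2)[OF r'(3) r(2)] mass_pos by (simp add: C_def \<eta>_def)
    finally show ?thesis .
  qed
  moreover have "max (1/2) ((r0 + 1)/2) < 1" using r0 by simp
  ultimately show ?thesis by blast
qed

definition green :: "real \<Rightarrow> (real^4 \<Rightarrow> real) \<Rightarrow> real^4 \<Rightarrow> real" where
  "green \<epsilon> f x = (\<integral>y. kern \<epsilon> (x \<bullet> y) * f y \<partial>mu) / mass"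

lemma continuous_on_kern_inner:
  assumes "0 < \<epsilon>" "\<epsilon> < 15/16" 
  shows "continuous_on (S3 \<times> S3) (\<lambda>(x, y). kern \<epsilon> (x \<bullet> y))"
  unfolding case_prod_beta
proof (rule continuous_on_compose2[OF continuous_on_kern[OF assms]])
  show "continuous_on (S3 \<times> S3) (\<lambda>p::(real^4) \<times> (real^4). fst p \<bullet> snd p)"
    by (intro continuous_intros)
  show "(\<lambda>p::(real^4) \<times> (real^4). fst p \<bullet> snd p) ` (S3 \<times> S3) \<subseteq> {-1..1}"
  proof
    fix s assume "s \<in> (\<lambda>p::(real^4) \<times> (real^4). fst p \<bullet> snd p) ` (S3 \<times> S3)"
    then obtain x y :: "real^4" where "x \<in> S3" "y \<in> S3" "s = x \<bullet> y" by auto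
    then show "s \<in> {-1..1}" using inner_S3_le[of x y] unfolding abs_le_iff by auto
  qed
qed

lemma continuous_on_kern_inner1:
  assumes "0 < \<epsilon>" "\<epsilon> < 15/16" "x \<in> S3"
  shows "continuous_on S3 (\<lambda>y. kern \<epsilon> (x \<bullet> y))"
proof (rule continuous_on_compose2[OF continuous_on_kern[OF assms(1,2)]])
  show "continuous_on S3 (\<lambda>y. x \<bullet> y)"
    by (intro continuous_intros)
  show "(\<lambda>y. x \<bullet> y) ` S3 \<subseteq> {-1..1}"
  proof
    fix s assume "s \<in> (\<lambda>y. x \<bullet> y) ` S3"
    then obtain y where "y \<in> S3" "s = x \<bullet> y" by auto
    then show "s \<in> {-1..1}" using inner_S3_le[of x y] assms(3) unfolding abs_le_iff by auto
  qed
qed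

text \<open>This is the sense in which \<open>green \<epsilon>\<close> inverts \<open>- paneitz \<epsilon>\<close>. The polynomials are truncations of the
  Abel means of the kernel series; \<open>- zonal_P \<epsilon>\<close> turns them into truncated Poisson kernels, which form
  an approximate identity.\<close>

lemma green_approximation:
  assumes eps: "0 < \<epsilon>" "\<epsilon> < 15/16" and f: "continuous_on S3 f" and d: "\<delta> > 0"
  shows "\<exists>p. \<forall>x\<in>S3. \<bar>zint p f x - green \<epsilon> f x\<bar> \<le> \<delta> \<and> \<bar>- zint (zonal_P \<epsilon> p) f x - f x\<bar> \<le> \<delta>"
proof -
  obtain B where B: "\<And>x. x \<in> S3 \<Longrightarrow> \<bar>f x\<bar> \<le> B"
    using continuous_compact_bound[OF compact_sphere f] by metis
  have B0: "B \<ge> 0" using B[of "axis 1 1"] by simp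
  define e where "e = \<delta> / (2 * (B + 1))"
  have e: "e > 0" using d B0 by (simp add: e_def)
  have eB: "e * B \<le> \<delta> / 2"
  proof -
    have "\<delta> * B \<le> \<delta> * (B + 1)" using d by simp
    then show ?thesis using B0 by (simp add: e_def field_simps)
  qed
  obtain r1 N1 where 1: "r1 < 1" "\<And>r n s. r1 \<le> r \<Longrightarrow> 0 \<le> r \<Longrightarrow> r < 1 \<Longrightarrow> N1 \<le> n \<Longrightarrow> \<bar>s\<bar> \<le> 1 \<Longrightarrow>
           \<bar>poly (kern_poly \<epsilon> r n) s - kern \<epsilon> s\<bar> \<le> e"
    using kern_poly_close[OF eps e] by blast
  obtain r2 where 2: "r2 < 1" "\<And>r x. r2 \<le> r \<Longrightarrow> 0 \<le> r \<Longrightarrow> r < 1 \<Longrightarrow> x \<in> S3 \<Longrightarrow>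
      \<bar>(\<integral>y. poisson r (x \<bullet> y) * f y \<partial>mu) - mass * f x\<bar> \<le> \<delta> * mass / 2"
    using poisson_approximate_identity[OF f, of "\<delta> * mass / 2"] d mass_pos by (auto simp: zero_less_mult_iff)
  define r where "r = max 0 (max r1 r2)"
  have r: "r1 \<le> r" "r2 \<le> r" "0 \<le> r" "r < 1" using 1(1) 2(1) by (auto simp: r_def)
  obtain N2 where 3: "\<And>n s. n \<ge> N2 \<Longrightarrow> \<bar>s\<bar> \<le> 1 \<Longrightarrow> \<bar>poly (poisson_poly r n) s - poisson r s\<bar> \<le> e"
    using poisson_poly_close[OF r(3,4) e] by blast
  define n where "n = max N1 N2"
  define p where "p = smult (1 / mass) (kern_poly \<epsilon> r n)"
  have close: "\<bar>(\<integral>y. a y * f y \<partial>mu) - (\<integral>y. b y * f y \<partial>mu)\<bar> \<le> \<delta> / 2 * mass"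
    if "continuous_on S3 a" "continuous_on S3 b" "\<And>y. y \<in> S3 \<Longrightarrow> \<bar>a y - b y\<bar> \<le> e" for a b
  proof -
    have "\<bar>a y * f y - b y * f y\<bar> \<le> \<delta> / 2" if y: "y \<in> S3" for y
    proof -
      have "\<bar>a y * f y - b y * f y\<bar> = \<bar>a y - b y\<bar> * \<bar>f y\<bar>" by (simp add: abs_mult[symmetric] left_diff_distrib)
      also have "\<dots> \<le> e * B" using \<open>\<And>y. y \<in> S3 \<Longrightarrow> \<bar>a y - b y\<bar> \<le> e\<close>[OF y] B[OF y] e by (intro mult_mono) auto
      finally show ?thesis using eB by simp
    qed
    then show ?thesis using that f by (intro integral_abs_diff_le continuous_intros) auto
  qed
  have "\<bar>zint p f x - green \<epsilon> f x\<bar> \<le> \<delta>" if x: "x \<in> S3" for x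
  proof -
    have "\<bar>(\<integral>y. poly (kern_poly \<epsilon> r n) (x \<bullet> y) * f y \<partial>mu) - (\<integral>y. kern \<epsilon> (x \<bullet> y) * f y \<partial>mu)\<bar> \<le> \<delta> / 2 * mass"
      using 1(2)[OF r(1,3,4)] inner_S3_le[OF x]
      by (intro close continuous_intros continuous_on_kern_inner1 eps x) (auto simp: n_def)
    moreover have "zint p f x - green \<epsilon> f x =
       ((\<integral>y. poly (kern_poly \<epsilon> r n) (x \<bullet> y) * f y \<partial>mu) - (\<integral>y. kern \<epsilon> (x \<bullet> y) * f y \<partial>mu)) / mass"
      unfolding p_def zint_smult by (simp add: green_def zint_def diff_divide_distrib)
    ultimately have "\<bar>zint p f x - green \<epsilon> f x\<bar> \<le> \<delta> / 2"
      using mass_pos by (simp add: abs_divide divide_le_eq)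
    then show ?thesis using d by simp
  qed
  moreover have "\<bar>- zint (zonal_P \<epsilon> p) f x - f x\<bar> \<le> \<delta>" if x: "x \<in> S3" for x
  proof -
    have "\<bar>(\<integral>y. poly (poisson_poly r n) (x \<bullet> y) * f y \<partial>mu) - (\<integral>y. poisson r (x \<bullet> y) * f y \<partial>mu)\<bar> \<le> \<delta> / 2 * mass"
      using 3 inner_S3_le[OF x]
      by (intro close continuous_intros continuous_on_poisson r x) (auto simp: n_def)
    moreover have "\<bar>(\<integral>y. poisson r (x \<bullet> y) * f y \<partial>mu) - mass * f x\<bar> \<le> \<delta> * mass / 2"
      by (rule 2(2)[OF r(2,3,4) x])
    ultimately have "\<bar>(\<integral>y. poly (poisson_poly r n) (x \<bullet> y) * f y \<partial>mu) - mass * f x\<bar> \<le> \<delta> * mass"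
      by linarith
    moreover have "zonal_P \<epsilon> p = smult (1 / mass) (- poisson_poly r n)"
      by (simp add: p_def zonal_P_smult zonal_P_kern_poly[OF eps])
    then have "- zint (zonal_P \<epsilon> p) f x = (\<integral>y. poly (poisson_poly r n) (x \<bullet> y) * f y \<partial>mu) / mass"
      by (simp add: zint_def)
    then have "- zint (zonal_P \<epsilon> p) f x - f x = ((\<integral>y. poly (poisson_poly r n) (x \<bullet> y) * f y \<partial>mu) - mass * f x) / mass"
      using mass_pos by (simp add: field_simps)
    ultimately show ?thesis
      using mass_pos by (simp add: abs_divide divide_le_eq)
  qed
  ultimately show ?thesis by blast
qed

section \<open>Square integrable limits\<close>

definition L2 :: "(real^4 \<Rightarrow> 'a::euclidean_space) \<Rightarrow> bool" where
  "L2 g \<longleftrightarrow> g \<in> borel_measurable mu \<and> integrable mu (\<lambda>x. (norm (g x))\<^sup>2)"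

lemma L2_continuous:
  fixes g :: "real^4 \<Rightarrow> 'a::euclidean_space"
  shows "continuous_on S3 g \<Longrightarrow> L2 g"
  by (auto simp: L2_def intro!: measurable_mu_continuous integrable_mu_continuous continuous_intros)

lemma norm_add_square: "(norm (a + b))\<^sup>2 \<le> 2 * (norm a)\<^sup>2 + 2 * (norm b)\<^sup>2" for a b :: "'a::real_normed_vector"
proof -
  have "(norm (a + b))\<^sup>2 \<le> (norm a + norm b)\<^sup>2"
    by (intro power_mono norm_triangle_ineq) simp
  also have "\<dots> \<le> 2 * (norm a)\<^sup>2 + 2 * (norm b)\<^sup>2"
    using sum_squares_bound[of "norm a" "norm b"] by (simp add: power2_sum)
  finally show ?thesis .
qed

lemma L2_add:
  fixes f g :: "real^4 \<Rightarrow> 'a::euclidean_space"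
  assumes "L2 f" "L2 g" shows "L2 (\<lambda>x. f x + g x)"
  unfolding L2_def
proof
  have [measurable]: "f \<in> borel_measurable mu" "g \<in> borel_measurable mu" using assms by (auto simp: L2_def)
  show "(\<lambda>x. f x + g x) \<in> borel_measurable mu" by measurable
  show "integrable mu (\<lambda>x. (norm (f x + g x))\<^sup>2)"
  proof (rule Bochner_Integration.integrable_bound)
    show "integrable mu (\<lambda>x. 2 * (norm (f x))\<^sup>2 + 2 * (norm (g x))\<^sup>2)"
      using assms by (auto simp: L2_def)
    show "AE x in mu. norm ((norm (f x + g x))\<^sup>2) \<le> norm (2 * (norm (f x))\<^sup>2 + 2 * (norm (g x))\<^sup>2)"
      using norm_add_square by (intro AE_I2) (simp add: abs_of_nonneg)
  qed measurable
qed

lemma L2_scaleR: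
  fixes g :: "real^4 \<Rightarrow> 'a::euclidean_space"
  assumes "L2 g" shows "L2 (\<lambda>x. c *\<^sub>R g x)"
  using assms by (auto simp: L2_def power_mult_distrib)

lemma L2_diff:
  fixes f g :: "real^4 \<Rightarrow> 'a::euclidean_space"
  assumes "L2 f" "L2 g" shows "L2 (\<lambda>x. f x - g x)"
  using L2_add[OF assms(1) L2_scaleR[OF assms(2), of "-1"]] by simp

lemma integrable_L2_inner:
  fixes f g :: "real^4 \<Rightarrow> 'a::euclidean_space"
  assumes "L2 f" "L2 g" shows "integrable mu (\<lambda>x. f x \<bullet> g x)"
proof (rule Bochner_Integration.integrable_bound)
  have [measurable]: "f \<in> borel_measurable mu" "g \<in> borel_measurable mu" using assms by (auto simp: L2_def)
  show "(\<lambda>x. f x \<bullet> g x) \<in> borel_measurable mu" by measurable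
  show "integrable mu (\<lambda>x. (norm (f x))\<^sup>2 + (norm (g x))\<^sup>2)"
    using assms by (auto simp: L2_def)
  show "AE x in mu. norm (f x \<bullet> g x) \<le> norm ((norm (f x))\<^sup>2 + (norm (g x))\<^sup>2)"
  proof (rule AE_I2)
    fix x
    have "\<bar>f x \<bullet> g x\<bar> \<le> norm (f x) * norm (g x)" by (rule Cauchy_Schwarz_ineq2)
    also have "\<dots> \<le> (norm (f x))\<^sup>2 + (norm (g x))\<^sup>2"
      using sum_squares_bound[of "norm (f x)" "norm (g x)"]
        mult_nonneg_nonneg[OF norm_ge_zero[of "f x"] norm_ge_zero[of "g x"]] by linarith
    finally show "norm (f x \<bullet> g x) \<le> norm ((norm (f x))\<^sup>2 + (norm (g x))\<^sup>2)" by (simp add: abs_of_nonneg)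
  qed
qed

lemma L2_tendsto_iff:
  fixes f :: "nat \<Rightarrow> real^4 \<Rightarrow> 'a::euclidean_space"
  assumes f: "\<And>n. L2 (f n)"
  shows "L2_tendsto f g \<longleftrightarrow> L2 g \<and> (\<lambda>n. \<integral>x. (norm (f n x - g x))\<^sup>2 \<partial>mu) \<longlonglongrightarrow> 0"
proof
  assume l: "L2_tendsto f g"
  then have [measurable]: "g \<in> borel_measurable mu" by (simp add: L2_tendsto_def)
  have [measurable]: "f n \<in> borel_measurable mu" for n using f by (simp add: L2_def)
  have lim: "(\<lambda>n. \<integral>\<^sup>+x. ennreal ((norm (f n x - g x))\<^sup>2) \<partial>mu) \<longlonglongrightarrow> 0"
    using l by (simp add: L2_tendsto_def)
  then have "eventually (\<lambda>n. (\<integral>\<^sup>+x. ennreal ((norm (f n x - g x))\<^sup>2) \<partial>mu) < 1) sequentially"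
    by (rule order_tendstoD) simp
  then obtain n where n: "(\<integral>\<^sup>+x. ennreal ((norm (f n x - g x))\<^sup>2) \<partial>mu) < 1"
    by (auto simp: eventually_sequentially)
  have "L2 (\<lambda>x. f n x - g x)"
    unfolding L2_def using n by (auto intro!: integrableI_bounded simp: less_trans[OF n])
  from L2_diff[OF f[of n] this] have g: "L2 g" by simp
  have "(\<integral>\<^sup>+x. ennreal ((norm (f n x - g x))\<^sup>2) \<partial>mu) = ennreal (\<integral>x. (norm (f n x - g x))\<^sup>2 \<partial>mu)" for n
    using L2_diff[OF f[of n] g] by (intro nn_integral_eq_integral) (auto simp: L2_def)
  then have "(\<lambda>n. ennreal (\<integral>x. (norm (f n x - g x))\<^sup>2 \<partial>mu)) \<longlonglongrightarrow> ennreal 0"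
    using lim by simp
  then have "(\<lambda>n. \<integral>x. (norm (f n x - g x))\<^sup>2 \<partial>mu) \<longlonglongrightarrow> 0"
    by (subst (asm) tendsto_ennreal_iff) (auto intro!: always_eventually)
  then show "L2 g \<and> (\<lambda>n. \<integral>x. (norm (f n x - g x))\<^sup>2 \<partial>mu) \<longlonglongrightarrow> 0" using g by simp
next
  assume r: "L2 g \<and> (\<lambda>n. \<integral>x. (norm (f n x - g x))\<^sup>2 \<partial>mu) \<longlonglongrightarrow> 0"
  then have g: "L2 g" by simp
  have "(\<integral>\<^sup>+x. ennreal ((norm (f n x - g x))\<^sup>2) \<partial>mu) = ennreal (\<integral>x. (norm (f n x - g x))\<^sup>2 \<partial>mu)" for n
    using L2_diff[OF f[of n] g] by (intro nn_integral_eq_integral) (auto simp: L2_def)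
  moreover have "(\<lambda>n. ennreal (\<integral>x. (norm (f n x - g x))\<^sup>2 \<partial>mu)) \<longlonglongrightarrow> ennreal 0"
    using r by (intro tendsto_ennrealI) simp
  ultimately show "L2_tendsto f g" using g by (simp add: L2_tendsto_def L2_def)
qed

lemma L2_tendsto_L2:
  fixes f :: "nat \<Rightarrow> real^4 \<Rightarrow> 'a::euclidean_space"
  assumes "\<And>n. L2 (f n)" "L2_tendsto f g" shows "L2 g"
  using assms L2_tendsto_iff[of f g] by simp

lemma L2_tendsto_diff:
  fixes f f' :: "nat \<Rightarrow> real^4 \<Rightarrow> 'a::euclidean_space"
  assumes f: "\<And>n. L2 (f n)" and f': "\<And>n. L2 (f' n)" and l: "L2_tendsto f g" "L2_tendsto f' g'"
  shows "L2_tendsto (\<lambda>n x. f n x - f' n x) (\<lambda>x. g x - g' x)"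
proof -
  have g: "L2 g" "(\<lambda>n. \<integral>x. (norm (f n x - g x))\<^sup>2 \<partial>mu) \<longlonglongrightarrow> 0" using l L2_tendsto_iff[OF f] by auto
  have g': "L2 g'" "(\<lambda>n. \<integral>x. (norm (f' n x - g' x))\<^sup>2 \<partial>mu) \<longlonglongrightarrow> 0" using l L2_tendsto_iff[OF f'] by auto
  have "(\<lambda>n. \<integral>x. (norm ((f n x - f' n x) - (g x - g' x)))\<^sup>2 \<partial>mu) \<longlonglongrightarrow> 0"
  proof (rule tendsto_sandwich[OF always_eventually always_eventually tendsto_const])
    show "\<forall>n. 0 \<le> (\<integral>x. (norm ((f n x - f' n x) - (g x - g' x)))\<^sup>2 \<partial>mu)" by simp
    show "(\<lambda>n. 2 * (\<integral>x. (norm (f n x - g x))\<^sup>2 \<partial>mu) + 2 * (\<integral>x. (norm (f' n x - g' x))\<^sup>2 \<partial>mu)) \<longlonglongrightarrow> 0"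
      using tendsto_add[OF tendsto_mult_left[OF g(2), of 2] tendsto_mult_left[OF g'(2), of 2]] by simp
    show "\<forall>n. (\<integral>x. (norm ((f n x - f' n x) - (g x - g' x)))\<^sup>2 \<partial>mu)
      \<le> 2 * (\<integral>x. (norm (f n x - g x))\<^sup>2 \<partial>mu) + 2 * (\<integral>x. (norm (f' n x - g' x))\<^sup>2 \<partial>mu)"
    proof
      fix n
      have i: "integrable mu (\<lambda>x. (norm (f n x - g x))\<^sup>2)" "integrable mu (\<lambda>x. (norm (f' n x - g' x))\<^sup>2)"
        "integrable mu (\<lambda>x. (norm ((f n x - f' n x) - (g x - g' x)))\<^sup>2)"
        using L2_diff[OF f[of n] g(1)] L2_diff[OF f'[of n] g'(1)] L2_diff[OF L2_diff[OF f[of n] f'[of n]] L2_diff[OF g(1) g'(1)]]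
        by (auto simp: L2_def)
      have "(norm ((f n x - f' n x) - (g x - g' x)))\<^sup>2 \<le> 2 * (norm (f n x - g x))\<^sup>2 + 2 * (norm (f' n x - g' x))\<^sup>2" for x
        using norm_add_square[of "f n x - g x" "- (f' n x - g' x)"] by (simp only: norm_minus_cancel) (simp add: algebra_simps)
      then have "(\<integral>x. (norm ((f n x - f' n x) - (g x - g' x)))\<^sup>2 \<partial>mu)
         \<le> (\<integral>x. 2 * (norm (f n x - g x))\<^sup>2 + 2 * (norm (f' n x - g' x))\<^sup>2 \<partial>mu)"
        using i by (intro integral_mono) auto
      also have "\<dots> = 2 * (\<integral>x. (norm (f n x - g x))\<^sup>2 \<partial>mu) + 2 * (\<integral>x. (norm (f' n x - g' x))\<^sup>2 \<partial>mu)"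
        using i by simp
      finally show "(\<integral>x. (norm ((f n x - f' n x) - (g x - g' x)))\<^sup>2 \<partial>mu)
      \<le> 2 * (\<integral>x. (norm (f n x - g x))\<^sup>2 \<partial>mu) + 2 * (\<integral>x. (norm (f' n x - g' x))\<^sup>2 \<partial>mu)" .
    qed
  qed
  then show ?thesis
    using L2_diff[OF g(1) g'(1)] by (subst L2_tendsto_iff) (auto intro: L2_diff f f')
qed

lemma L2_tendsto_inner:
  fixes f :: "nat \<Rightarrow> real^4 \<Rightarrow> 'a::euclidean_space"
  assumes f: "\<And>n. L2 (f n)" and l: "L2_tendsto f g" and b: "L2 b"
  shows "(\<lambda>n. \<integral>x. f n x \<bullet> b x \<partial>mu) \<longlonglongrightarrow> (\<integral>x. g x \<bullet> b x \<partial>mu)"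
proof -
  have g: "L2 g" "(\<lambda>n. \<integral>x. (norm (f n x - g x))\<^sup>2 \<partial>mu) \<longlonglongrightarrow> 0" using l L2_tendsto_iff[OF f] by auto
  define B where "B = (\<integral>x. (norm (b x))\<^sup>2 \<partial>mu)"
  have B0: "B \<ge> 0" by (simp add: B_def)
  define I where "I n = (\<integral>x. (norm (f n x - g x))\<^sup>2 \<partial>mu)" for n
  have bound: "\<bar>(\<integral>x. f n x \<bullet> b x \<partial>mu) - (\<integral>x. g x \<bullet> b x \<partial>mu)\<bar> \<le> I n / c + c * B" if c: "c > 0" for n c
  proof -
    have d: "L2 (\<lambda>x. f n x - g x)" by (rule L2_diff[OF f g(1)])
    have "(\<integral>x. f n x \<bullet> b x \<partial>mu) - (\<integral>x. g x \<bullet> b x \<partial>mu) = (\<integral>x. (f n x - g x) \<bullet> b x \<partial>mu)"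
      using integrable_L2_inner[OF f[of n] b] integrable_L2_inner[OF g(1) b] by (simp add: inner_diff_left)
    also have "\<bar>\<dots>\<bar> \<le> (\<integral>x. \<bar>(f n x - g x) \<bullet> b x\<bar> \<partial>mu)" by (rule integral_abs_bound)
    also have "\<dots> \<le> (\<integral>x. (norm (f n x - g x))\<^sup>2 / c + c * (norm (b x))\<^sup>2 \<partial>mu)"
    proof (rule integral_mono)
      show "integrable mu (\<lambda>x. \<bar>(f n x - g x) \<bullet> b x\<bar>)" using integrable_L2_inner[OF d b] by simp
      show "integrable mu (\<lambda>x. (norm (f n x - g x))\<^sup>2 / c + c * (norm (b x))\<^sup>2)"
        using d b by (auto simp: L2_def)
      fix x
      define s t where "s = norm (f n x - g x)" "t = norm (b x)"
      have st: "s \<ge> 0" "t \<ge> 0" by (auto simp: s_t_def)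
      have "2 * (s / sqrt c) * (sqrt c * t) \<le> (s / sqrt c)\<^sup>2 + (sqrt c * t)\<^sup>2" by (rule sum_squares_bound)
      then have "2 * (s * t) \<le> s\<^sup>2 / c + c * t\<^sup>2" using c by (simp add: power_divide power_mult_distrib)
      moreover have "s * t \<ge> 0" using st by simp
      moreover have "\<bar>(f n x - g x) \<bullet> b x\<bar> \<le> s * t" unfolding s_t_def by (rule Cauchy_Schwarz_ineq2)
      ultimately show "\<bar>(f n x - g x) \<bullet> b x\<bar> \<le> (norm (f n x - g x))\<^sup>2 / c + c * (norm (b x))\<^sup>2"
        unfolding s_t_def by linarith
    qed
    also have "\<dots> = I n / c + c * B"
      using d b by (simp add: I_def B_def L2_def)
    finally show ?thesis .
  qed
  show ?thesis
  proof (rule LIMSEQ_I)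
    fix \<delta> :: real assume d: "\<delta> > 0"
    define c where "c = \<delta> / (2 * (B + 1))"
    have c: "c > 0" using d B0 by (simp add: c_def)
    have cB: "c * B \<le> \<delta> / 2"
    proof -
      have "\<delta> * B \<le> \<delta> * (B + 1)" using d by simp
      then show ?thesis using B0 by (simp add: c_def field_simps)
    qed
    have "I \<longlonglongrightarrow> 0" using g(2) by (simp add: I_def[abs_def])
    then have "eventually (\<lambda>n. I n < c * (\<delta> / 2)) sequentially"
      by (rule order_tendstoD) (use c d in simp)
    then obtain N where N: "\<And>n. n \<ge> N \<Longrightarrow> I n < c * (\<delta> / 2)" by (auto simp: eventually_sequentially)
    have "norm ((\<integral>x. f n x \<bullet> b x \<partial>mu) - (\<integral>x. g x \<bullet> b x \<partial>mu)) < \<delta>" if "n \<ge> N" for n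
    proof -
      have "I n / c < \<delta> / 2" using N[OF that] c by (simp add: divide_less_eq mult.commute)
      then show ?thesis using bound[OF c, of n] cB unfolding real_norm_def by linarith
    qed
    then show "\<exists>N. \<forall>n\<ge>N. norm ((\<integral>x. f n x \<bullet> b x \<partial>mu) - (\<integral>x. g x \<bullet> b x \<partial>mu)) < \<delta>" by blast
  qed
qed

text \<open>Each member of the sequence is orthogonal to the limit, so by Pythagoras the limit is no longer
  than its distance to the sequence.\<close>

lemma L2_limit_zero:
  fixes f :: "nat \<Rightarrow> real^4 \<Rightarrow> 'a::euclidean_space"
  assumes f: "\<And>n. L2 (f n)" and l: "L2_tendsto f g"
    and orth: "\<And>n. (\<lambda>m. \<integral>x. f m x \<bullet> f n x \<partial>mu) \<longlonglongrightarrow> 0"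
  shows "AE x in mu. g x = 0"
proof -
  have g: "L2 g" "(\<lambda>n. \<integral>x. (norm (f n x - g x))\<^sup>2 \<partial>mu) \<longlonglongrightarrow> 0" using l L2_tendsto_iff[OF f] by auto
  have 0: "(\<integral>x. g x \<bullet> f n x \<partial>mu) = 0" for n
    using LIMSEQ_unique[OF L2_tendsto_inner[OF f l f] orth] .
  have "(\<integral>x. (norm (g x))\<^sup>2 \<partial>mu) \<le> (\<integral>x. (norm (f n x - g x))\<^sup>2 \<partial>mu)" for n
  proof -
    have i: "integrable mu (\<lambda>x. (norm (f n x))\<^sup>2)" "integrable mu (\<lambda>x. (norm (g x))\<^sup>2)" "integrable mu (\<lambda>x. g x \<bullet> f n x)"
      using f[of n] g(1) integrable_L2_inner[OF g(1) f[of n]] by (auto simp: L2_def)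
    have "(\<integral>x. (norm (f n x - g x))\<^sup>2 \<partial>mu) = (\<integral>x. (norm (f n x))\<^sup>2 + (norm (g x))\<^sup>2 - 2 * (g x \<bullet> f n x) \<partial>mu)"
      by (rule integral_mu_cong) (simp add: power2_norm_eq_inner inner_diff_left inner_diff_right inner_commute)
    also have "\<dots> = (\<integral>x. (norm (f n x))\<^sup>2 \<partial>mu) + (\<integral>x. (norm (g x))\<^sup>2 \<partial>mu)"
      using i by (simp add: 0)
    finally show ?thesis by simp
  qed
  then have "(\<integral>x. (norm (g x))\<^sup>2 \<partial>mu) \<le> 0"
    by (intro LIMSEQ_le_const[OF g(2)]) blast
  then have "(\<integral>x. (norm (g x))\<^sup>2 \<partial>mu) = 0"
    by (simp add: order_antisym)
  then have "AE x in mu. (norm (g x))\<^sup>2 = 0"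
    using g(1) integral_nonneg_eq_0_iff_AE[of mu "\<lambda>x. (norm (g x))\<^sup>2"] by (simp add: L2_def)
  then show ?thesis by simp
qed

section \<open>Weak derivatives\<close>

lemma smooth_S3_add_cmult: "smooth_S3 f \<Longrightarrow> smooth_S3 g \<Longrightarrow> smooth_S3 (\<lambda>x. f x + c * g x)"
  unfolding smooth_S3_iff
  using Cinf_add[OF _ Cinf_mult[OF Cinf_const[of c]], of "radial_ext f" "radial_ext g"]
  by (simp add: radial_ext_def[abs_def])

lemma radial_ext_add_cmult: "radial_ext (\<lambda>x. f x + c * g x) = (\<lambda>x. radial_ext f x + c * radial_ext g x)"
  by (rule ext) (simp add: radial_ext_def)

lemma partial_deriv_add_cmult:
  assumes "Cinf F" "Cinf G" "x \<noteq> 0"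
  shows "partial_deriv i (\<lambda>x. F x + c * G x) x = partial_deriv i F x + c * partial_deriv i G x"
  using partial_deriv_eq[OF has_derivative_add[OF Cinf_has_derivative[OF assms(1,3)]
        has_derivative_mult_right[OF Cinf_has_derivative[OF assms(2,3)], of c]], of i]
  by (simp add: partial_deriv_def)

lemma partial_deriv_cong:
  assumes "\<And>y. y \<noteq> 0 \<Longrightarrow> F y = G y" "Cinf F" "x \<noteq> 0"
  shows "partial_deriv i F x = partial_deriv i G x"
proof -
  have "(G has_derivative frechet_derivative F (at x)) (at x)"
    by (rule has_derivative_transform_within_open[OF Cinf_has_derivative open_punctured])
      (use assms in auto)
  then show ?thesis
    using partial_deriv_eq[of G _ x i] by (simp add: partial_deriv_def)
qed

lemma grad_S3_add_cmult:
  assumes "smooth_S3 f" "smooth_S3 g" "x \<in> S3"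
  shows "grad_S3 (\<lambda>x. f x + c * g x) x = grad_S3 f x + c *\<^sub>R grad_S3 g x"
  using assms S3_nonzero[OF assms(3)]
  by (simp add: grad_S3_def smooth_S3_iff radial_ext_add_cmult partial_deriv_add_cmult vec_eq_iff)

lemma hess_S3_add_cmult:
  assumes f: "smooth_S3 f" and g: "smooth_S3 g" and x: "x \<in> S3"
  shows "hess_S3 (\<lambda>x. f x + c * g x) x = hess_S3 f x + c *\<^sub>R hess_S3 g x"
proof -
  let ?F = "radial_ext f" and ?G = "radial_ext g"
  have FG: "Cinf ?F" "Cinf ?G" using f g by (auto simp: smooth_S3_iff)
  have x0: "x \<noteq> 0" by (rule S3_nonzero[OF x])
  have "partial_deriv i (partial_deriv j (\<lambda>x. ?F x + c * ?G x)) x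
     = partial_deriv i (partial_deriv j ?F) x + c * partial_deriv i (partial_deriv j ?G) x" for i j
  proof -
    have "partial_deriv i (\<lambda>x. partial_deriv j ?F x + c * partial_deriv j ?G x) x = partial_deriv i (partial_deriv j (\<lambda>x. ?F x + c * ?G x)) x"
      by (rule partial_deriv_cong) (auto simp: partial_deriv_add_cmult FG x0 intro!: Cinf_add Cinf_mult Cinf_const Cinf_partial FG)
    then show ?thesis
      by (simp add: partial_deriv_add_cmult[OF Cinf_partial Cinf_partial, OF FG x0])
  qed
  then have "(\<chi> i j. partial_deriv i (partial_deriv j (\<lambda>x. ?F x + c * ?G x)) x)
     = (\<chi> i j. partial_deriv i (partial_deriv j ?F) x) + c *\<^sub>R (\<chi> i j. partial_deriv i (partial_deriv j ?G) x)"
    by (simp add: vec_eq_iff)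
  moreover have "A ** (M + c *\<^sub>R N) ** A = A ** M ** A + c *\<^sub>R (A ** N ** A)" for A M N :: "real^4^4"
  proof -
    have "A ** (M + c *\<^sub>R N) = A ** M + c *\<^sub>R (A ** N)"
      by (simp add: matrix_matrix_mult_def vec_eq_iff sum.distrib sum_distrib_left algebra_simps)
    moreover have "(M + c *\<^sub>R N) ** A = M ** A + c *\<^sub>R (N ** A)" for M N :: "real^4^4"
      by (simp add: matrix_matrix_mult_def vec_eq_iff sum.distrib sum_distrib_left algebra_simps)
    ultimately show ?thesis by simp
  qed
  ultimately show ?thesis
    unfolding hess_S3_def radial_ext_add_cmult by simp
qed

lemma continuous_grad_S3:
  assumes "smooth_S3 f" shows "continuous_on S3 (grad_S3 f)"
  unfolding grad_S3_def[abs_def] using assms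
  by (intro continuous_on_vec_lambda Cinf_continuous Cinf_partial) (simp add: smooth_S3_iff)

lemma continuous_hess_S3:
  assumes "smooth_S3 f" shows "continuous_on S3 (hess_S3 f)"
proof -
  have F: "continuous_on S3 (partial_deriv i (partial_deriv j (radial_ext f)))" for i j
    using assms by (intro Cinf_continuous Cinf_partial) (simp add: smooth_S3_iff)
  have "continuous_on S3 (\<lambda>x. tangent_proj x $ i $ j)" for i j
    by (cases "i = j") (auto simp: tangent_proj_def mat_def intro!: continuous_intros)
  note c = this F
  show ?thesis
    unfolding hess_S3_def[abs_def] matrix_matrix_mult_def
    by (simp, intro continuous_on_vec_lambda continuous_intros c)
qed

lemma continuous_smooth:
  assumes "smooth_S3 f" shows "continuous_on S3 f"
proof -
  have "continuous_on S3 (radial_ext f)" using assms by (simp add: smooth_S3_iff Cinf_continuous)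
  then show ?thesis by (rule continuous_on_eq) (simp add: radial_ext_on_S3)
qed

lemma continuous_lap: "smooth_S3 f \<Longrightarrow> continuous_on S3 (lap (radial_ext f))"
  by (intro Cinf_continuous Cinf_lap) (simp add: smooth_S3_iff)

lemma trace_square_le: "(trace M)\<^sup>2 \<le> 16 * (norm M)\<^sup>2" for M :: "real^4^4"
proof -
  have "\<bar>trace M\<bar> \<le> (\<Sum>i\<in>UNIV. \<bar>M $ i $ i\<bar>)" unfolding trace_def by (rule sum_abs)
  also have "\<dots> \<le> (\<Sum>i\<in>(UNIV::4 set). norm M)"
  proof (rule sum_mono)
    fix i :: 4
    show "\<bar>M $ i $ i\<bar> \<le> norm M"
      using component_le_norm_cart[of "M $ i" i] Finite_Cartesian_Product.norm_nth_le[of M i] by linarith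
  qed
  finally have "\<bar>trace M\<bar> \<le> 4 * norm M" by simp
  then have "\<bar>trace M\<bar>\<^sup>2 \<le> (4 * norm M)\<^sup>2" by (intro power_mono) auto
  then show ?thesis by (simp add: power_mult_distrib)
qed

lemma borel_measurable_trace [measurable]:
  "T \<in> borel_measurable M \<Longrightarrow> (\<lambda>x. trace (T x :: real^4^4)) \<in> borel_measurable M"
proof -
  assume T: "T \<in> borel_measurable M"
  have "continuous_on UNIV (trace :: real^4^4 \<Rightarrow> real)"
    unfolding trace_def by (intro continuous_intros)
  from measurable_compose[OF T borel_measurable_continuous_onI[OF this]] show ?thesis .
qed

lemma L2_trace:
  assumes "L2 (T :: real^4 \<Rightarrow> real^4^4)" shows "L2 (\<lambda>x. trace (T x))"
proof -
  have [measurable]: "T \<in> borel_measurable mu" using assms by (simp add: L2_def)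
  have "integrable mu (\<lambda>x. (trace (T x))\<^sup>2)"
  proof (rule Bochner_Integration.integrable_bound)
    show "integrable mu (\<lambda>x. 16 * (norm (T x))\<^sup>2)" using assms by (simp add: L2_def)
    show "AE x in mu. norm ((trace (T x))\<^sup>2) \<le> norm (16 * (norm (T x))\<^sup>2)"
      using trace_square_le by (intro AE_I2) simp
  qed measurable
  then show ?thesis by (simp add: L2_def)
qed

lemma L2_tendsto_trace:
  assumes f: "\<And>n. L2 (f n)" and l: "L2_tendsto f (T :: real^4 \<Rightarrow> real^4^4)"
  shows "L2_tendsto (\<lambda>n x. trace (f n x)) (\<lambda>x. trace (T x))"
proof -
  have T: "L2 T" "(\<lambda>n. \<integral>x. (norm (f n x - T x))\<^sup>2 \<partial>mu) \<longlonglongrightarrow> 0" using l L2_tendsto_iff[OF f] by auto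
  have "(\<lambda>n. \<integral>x. (norm (trace (f n x) - trace (T x)))\<^sup>2 \<partial>mu) \<longlonglongrightarrow> 0"
  proof (rule tendsto_sandwich[OF always_eventually always_eventually tendsto_const])
    show "(\<lambda>n. 16 * (\<integral>x. (norm (f n x - T x))\<^sup>2 \<partial>mu)) \<longlonglongrightarrow> 0"
      using tendsto_mult_left[OF T(2), of 16] by simp
    show "\<forall>n. 0 \<le> (\<integral>x. (norm (trace (f n x) - trace (T x)))\<^sup>2 \<partial>mu)" by simp
    show "\<forall>n. (\<integral>x. (norm (trace (f n x) - trace (T x)))\<^sup>2 \<partial>mu) \<le> 16 * (\<integral>x. (norm (f n x - T x))\<^sup>2 \<partial>mu)"
    proof
      fix n
      have d: "L2 (\<lambda>x. f n x - T x)" by (rule L2_diff[OF f T(1)])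
      have "(\<integral>x. (norm (trace (f n x) - trace (T x)))\<^sup>2 \<partial>mu) \<le> (\<integral>x. 16 * (norm (f n x - T x))\<^sup>2 \<partial>mu)"
      proof (rule integral_mono)
        show "integrable mu (\<lambda>x. (norm (trace (f n x) - trace (T x)))\<^sup>2)"
          using L2_trace[OF d] by (simp add: L2_def trace_sub)
        show "integrable mu (\<lambda>x. 16 * (norm (f n x - T x))\<^sup>2)" using d by (simp add: L2_def)
        show "(norm (trace (f n x) - trace (T x)))\<^sup>2 \<le> 16 * (norm (f n x - T x))\<^sup>2" for x
          using trace_square_le[of "f n x - T x"] by (simp add: trace_sub)
      qed
      then show "(\<integral>x. (norm (trace (f n x) - trace (T x)))\<^sup>2 \<partial>mu) \<le> 16 * (\<integral>x. (norm (f n x - T x))\<^sup>2 \<partial>mu)" by simp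
    qed
  qed
  then show ?thesis
    using L2_trace[OF T(1)] by (subst L2_tendsto_iff) (auto intro: L2_trace f)
qed

lemma L2_tendsto_cong:
  assumes "\<And>n x. x \<in> S3 \<Longrightarrow> f n x = f' n x" "L2_tendsto f g"
  shows "L2_tendsto f' g"
proof -
  have "(\<integral>\<^sup>+x. ennreal ((norm (f n x - g x))\<^sup>2) \<partial>mu) = (\<integral>\<^sup>+x. ennreal ((norm (f' n x - g x))\<^sup>2) \<partial>mu)" for n
    by (rule nn_integral_cong) (simp add: assms(1))
  then show ?thesis using assms(2) by (simp add: L2_tendsto_def)
qed

lemma weak_derivs_approx:
  assumes "has_weak_derivs \<phi> V T"
  obtains f where "\<And>n. smooth_S3 (f n)" "L2_tendsto f \<phi>" "L2_tendsto (\<lambda>n. grad_S3 (f n)) V"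
    "L2_tendsto (\<lambda>n. hess_S3 (f n)) T" "L2_tendsto (\<lambda>n. lap (radial_ext (f n))) (\<lambda>x. trace (T x))"
proof -
  obtain f where f: "\<And>n. smooth_S3 (f n)" "L2_tendsto f \<phi>" "L2_tendsto (\<lambda>n. grad_S3 (f n)) V"
    "L2_tendsto (\<lambda>n. hess_S3 (f n)) T"
    using assms by (auto simp: has_weak_derivs_def)
  have "L2_tendsto (\<lambda>n x. trace (hess_S3 (f n) x)) (\<lambda>x. trace (T x))"
    by (rule L2_tendsto_trace[OF _ f(4)]) (intro L2_continuous continuous_hess_S3 f)
  then have "L2_tendsto (\<lambda>n. lap (radial_ext (f n))) (\<lambda>x. trace (T x))"
    by (rule L2_tendsto_cong[rotated]) (rule trace_hess_S3[OF f(1)])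
  with f that show ?thesis by blast
qed

lemma weak_derivs_L2:
  assumes "has_weak_derivs \<phi> V T"
  shows "L2 \<phi>" "L2 V" "L2 T" "L2 (\<lambda>x. trace (T x))"
proof -
  obtain f where f: "\<And>n. smooth_S3 (f n)" "L2_tendsto f \<phi>" "L2_tendsto (\<lambda>n. grad_S3 (f n)) V"
    "L2_tendsto (\<lambda>n. hess_S3 (f n)) T" "L2_tendsto (\<lambda>n. lap (radial_ext (f n))) (\<lambda>x. trace (T x))"
    using weak_derivs_approx[OF assms] by blast
  show "L2 \<phi>" by (rule L2_tendsto_L2[OF L2_continuous[OF continuous_smooth[OF f(1)]] f(2)])
  show "L2 V" by (rule L2_tendsto_L2[OF L2_continuous[OF continuous_grad_S3[OF f(1)]] f(3)])
  show "L2 T" by (rule L2_tendsto_L2[OF L2_continuous[OF continuous_hess_S3[OF f(1)]] f(4)])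
  then show "L2 (\<lambda>x. trace (T x))" by (rule L2_trace)
qed

lemma integral_grad_S3:
  assumes f: "smooth_S3 f" and g: "smooth_S3 g"
  shows "(\<integral>x. grad_S3 f x \<bullet> grad_S3 g x \<partial>mu) = - (\<integral>x. f x * lap (radial_ext g) x \<partial>mu)"
proof -
  have "(\<integral>x. grad_S3 f x \<bullet> grad_S3 g x \<partial>mu)
     = (\<integral>x. (\<Sum>a\<in>UNIV. lie a (radial_ext f) x * lie a (radial_ext g) x) \<partial>mu)"
    by (rule integral_mu_cong) (rule grad_S3_inner[OF f g])
  also have "\<dots> = - (\<integral>x. radial_ext f x * lap (radial_ext g) x \<partial>mu)"
    using f g by (intro integral_grad_grad) (auto simp: smooth_S3_iff)
  also have "(\<integral>x. radial_ext f x * lap (radial_ext g) x \<partial>mu) = (\<integral>x. f x * lap (radial_ext g) x \<partial>mu)"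
    by (rule integral_mu_cong) (simp add: radial_ext_on_S3)
  finally show ?thesis .
qed

lemma integral_lap_lap:
  assumes f: "smooth_S3 f" and g: "smooth_S3 g"
  shows "(\<integral>x. lap (radial_ext f) x * lap (radial_ext g) x \<partial>mu) = (\<integral>x. f x * lap (lap (radial_ext g)) x \<partial>mu)"
proof -
  have "(\<integral>x. lap (radial_ext f) x * lap (radial_ext g) x \<partial>mu) = (\<integral>x. radial_ext f x * lap (lap (radial_ext g)) x \<partial>mu)"
    using f g by (intro integral_lap_symmetric Cinf_lap) (auto simp: smooth_S3_iff)
  also have "\<dots> = (\<integral>x. f x * lap (lap (radial_ext g)) x \<partial>mu)"
    by (rule integral_mu_cong) (simp add: radial_ext_on_S3)
  finally show ?thesis .
qed

text \<open>Integration by parts moves all derivatives of the difference of two approximating sequences to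
  a fixed member, whence the differences of the limits vanish.\<close>

lemma weak_derivs_unique:
  assumes "has_weak_derivs \<phi> V T" "has_weak_derivs \<phi> V' T'"
  shows "AE x in mu. V x = V' x" "AE x in mu. trace (T x) = trace (T' x)"
proof -
  obtain f where f: "\<And>n. smooth_S3 (f n)" "L2_tendsto f \<phi>" "L2_tendsto (\<lambda>n. grad_S3 (f n)) V"
    "L2_tendsto (\<lambda>n. hess_S3 (f n)) T"
    using weak_derivs_approx[OF assms(1)] by metis
  obtain g where g: "\<And>n. smooth_S3 (g n)" "L2_tendsto g \<phi>" "L2_tendsto (\<lambda>n. grad_S3 (g n)) V'"
    "L2_tendsto (\<lambda>n. hess_S3 (g n)) T'"
    using weak_derivs_approx[OF assms(2)] by metis
  define d where "d n x = f n x + (-1) * g n x" for n x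
  have dn: "d n = (\<lambda>x. f n x + (-1) * g n x)" for n by (rule ext) (simp only: d_def)
  have d: "smooth_S3 (d n)" for n unfolding dn by (rule smooth_S3_add_cmult[OF f(1) g(1)])
  note dL2 = L2_continuous[OF continuous_smooth[OF d]] L2_continuous[OF continuous_grad_S3[OF d]]
    L2_continuous[OF continuous_lap[OF d]] L2_continuous[OF continuous_hess_S3[OF d]]
  have d0: "L2_tendsto d (\<lambda>x. 0)"
    using L2_tendsto_diff[OF L2_continuous[OF continuous_smooth[OF f(1)]] L2_continuous[OF continuous_smooth[OF g(1)]] f(2) g(2)]
    by (simp add: d_def[abs_def])
  have "L2_tendsto (\<lambda>n x. grad_S3 (f n) x - grad_S3 (g n) x) (\<lambda>x. V x - V' x)"
    by (rule L2_tendsto_diff[OF L2_continuous[OF continuous_grad_S3[OF f(1)]] L2_continuous[OF continuous_grad_S3[OF g(1)]] f(3) g(3)])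
  then have dV: "L2_tendsto (\<lambda>n. grad_S3 (d n)) (\<lambda>x. V x - V' x)"
  proof (rule L2_tendsto_cong[rotated])
    show "grad_S3 (f n) x - grad_S3 (g n) x = grad_S3 (d n) x" if "x \<in> S3" for n x
      unfolding dn grad_S3_add_cmult[OF f(1) g(1) that] by simp
  qed
  have "L2_tendsto (\<lambda>n x. hess_S3 (f n) x - hess_S3 (g n) x) (\<lambda>x. T x - T' x)"
    by (rule L2_tendsto_diff[OF L2_continuous[OF continuous_hess_S3[OF f(1)]] L2_continuous[OF continuous_hess_S3[OF g(1)]] f(4) g(4)])
  then have dT: "L2_tendsto (\<lambda>n. hess_S3 (d n)) (\<lambda>x. T x - T' x)"
  proof (rule L2_tendsto_cong[rotated])
    show "hess_S3 (f n) x - hess_S3 (g n) x = hess_S3 (d n) x" if "x \<in> S3" for n x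
      unfolding dn hess_S3_add_cmult[OF f(1) g(1) that] by simp
  qed
  have dl: "L2_tendsto (\<lambda>n. lap (radial_ext (d n))) (\<lambda>x. trace (T x - T' x))"
    by (rule L2_tendsto_cong[OF _ L2_tendsto_trace[OF dL2(4) dT]]) (rule trace_hess_S3[OF d])
  have "AE x in mu. V x - V' x = 0"
  proof (rule L2_limit_zero[OF dL2(2) dV])
    fix n
    have "(\<lambda>m. \<integral>x. d m x \<bullet> lap (radial_ext (d n)) x \<partial>mu) \<longlonglongrightarrow> (\<integral>x. 0 \<bullet> lap (radial_ext (d n)) x \<partial>mu)"
      by (rule L2_tendsto_inner[OF dL2(1) d0 dL2(3)])
    from tendsto_minus[OF this] show "(\<lambda>m. \<integral>x. grad_S3 (d m) x \<bullet> grad_S3 (d n) x \<partial>mu) \<longlonglongrightarrow> 0"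
      by (simp add: integral_grad_S3[OF d d])
  qed
  then show "AE x in mu. V x = V' x" by simp
  have "AE x in mu. trace (T x - T' x) = 0"
  proof (rule L2_limit_zero[OF dL2(3) dl])
    fix n
    have "continuous_on S3 (lap (lap (radial_ext (d n))))"
      using d by (intro Cinf_continuous Cinf_lap) (simp add: smooth_S3_iff)
    then have "(\<lambda>m. \<integral>x. d m x \<bullet> lap (lap (radial_ext (d n))) x \<partial>mu) \<longlonglongrightarrow> (\<integral>x. 0 \<bullet> lap (lap (radial_ext (d n))) x \<partial>mu)"
      by (intro L2_tendsto_inner[OF dL2(1) d0] L2_continuous)
    then show "(\<lambda>m. \<integral>x. lap (radial_ext (d m)) x \<bullet> lap (radial_ext (d n)) x \<partial>mu) \<longlonglongrightarrow> 0"
      by (simp add: integral_lap_lap[OF d d])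
  qed
  then show "AE x in mu. trace (T x) = trace (T' x)" by (simp add: trace_sub)
qed

section \<open>The energy\<close>

text \<open>By uniqueness, the weak derivatives picked by the choice operator may be replaced by any others.\<close>

lemma E_weak_derivs:
  assumes w: "has_weak_derivs \<phi> V T" and c: "continuous_on S3 \<phi>"
  shows "E \<epsilon> \<phi> = (\<integral>x. (trace (T x))\<^sup>2 \<partial>mu) - 1/2 * (\<integral>x. (norm (V x))\<^sup>2 \<partial>mu) - (15/16 - \<epsilon>) * (\<integral>x. (\<phi> x)\<^sup>2 \<partial>mu)"
proof -
  have "\<exists>T. has_weak_derivs \<phi> (weak_grad \<phi>) T"
    unfolding weak_grad_def by (rule someI_ex[of "\<lambda>V. \<exists>T. has_weak_derivs \<phi> V T"]) (use w in blast)
  then obtain T1 where wg: "has_weak_derivs \<phi> (weak_grad \<phi>) T1" by blast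
  have "\<exists>V. has_weak_derivs \<phi> V (weak_hess \<phi>)"
    unfolding weak_hess_def by (rule someI_ex[of "\<lambda>T. \<exists>V. has_weak_derivs \<phi> V T"]) (use w in blast)
  then obtain V1 where wh: "has_weak_derivs \<phi> V1 (weak_hess \<phi>)" by blast
  note L = weak_derivs_L2[OF w] weak_derivs_L2(2)[OF wg] weak_derivs_L2(4)[OF wh]
  have m [measurable]: "\<phi> \<in> borel_measurable mu" "V \<in> borel_measurable mu" "weak_grad \<phi> \<in> borel_measurable mu"
    "(\<lambda>x. trace (T x)) \<in> borel_measurable mu" "laplacian \<phi> \<in> borel_measurable mu"
    using L by (auto simp: L2_def laplacian_def[abs_def])
  have i: "integrable mu (\<lambda>x. (trace (T x))\<^sup>2)" "integrable mu (\<lambda>x. (norm (V x))\<^sup>2)" "integrable mu (\<lambda>x. (\<phi> x)\<^sup>2)"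
    using L by (auto simp: L2_def)
  have "(\<integral>x. (laplacian \<phi> x)\<^sup>2 - 1/2 * (norm (weak_grad \<phi> x))\<^sup>2 - 15/16 * (\<phi> x)\<^sup>2 \<partial>mu)
     = (\<integral>x. (trace (T x))\<^sup>2 - 1/2 * (norm (V x))\<^sup>2 - 15/16 * (\<phi> x)\<^sup>2 \<partial>mu)"
  proof (rule integral_cong_AE)
    show "AE x in mu. (laplacian \<phi> x)\<^sup>2 - 1/2 * (norm (weak_grad \<phi> x))\<^sup>2 - 15/16 * (\<phi> x)\<^sup>2
        = (trace (T x))\<^sup>2 - 1/2 * (norm (V x))\<^sup>2 - 15/16 * (\<phi> x)\<^sup>2"
      using weak_derivs_unique(1)[OF w wg] weak_derivs_unique(2)[OF w wh]
      by eventually_elim (simp add: laplacian_def)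
  qed measurable
  also have "\<dots> = (\<integral>x. (trace (T x))\<^sup>2 \<partial>mu) - 1/2 * (\<integral>x. (norm (V x))\<^sup>2 \<partial>mu) - 15/16 * (\<integral>x. (\<phi> x)\<^sup>2 \<partial>mu)"
    using i by simp
  finally show ?thesis unfolding E_def by (simp add: algebra_simps)
qed

lemma L2_tendsto_const: "continuous_on S3 g \<Longrightarrow> L2_tendsto (\<lambda>_. g) g"
  for g :: "real^4 \<Rightarrow> 'a::euclidean_space"
  using measurable_mu_continuous[of g] by (simp add: L2_tendsto_def)

lemma L2_tendsto_add_scaled:
  fixes b :: "real^4 \<Rightarrow> 'a::euclidean_space"
  assumes "L2_tendsto h g" "continuous_on S3 b"
  shows "L2_tendsto (\<lambda>n x. h n x + t *\<^sub>R b x) (\<lambda>x. g x + t *\<^sub>R b x)"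
  using assms measurable_mu_continuous[OF assms(2)] by (auto simp: L2_tendsto_def)

lemma integral_norm_add_square:
  fixes g h :: "real^4 \<Rightarrow> 'a::euclidean_space"
  assumes "L2 g" "L2 h"
  shows "(\<integral>x. (norm (g x + t *\<^sub>R h x))\<^sup>2 \<partial>mu) =
    (\<integral>x. (norm (g x))\<^sup>2 \<partial>mu) + 2 * t * (\<integral>x. g x \<bullet> h x \<partial>mu) + t\<^sup>2 * (\<integral>x. (norm (h x))\<^sup>2 \<partial>mu)"
proof -
  have "(\<integral>x. (norm (g x + t *\<^sub>R h x))\<^sup>2 \<partial>mu) = (\<integral>x. (norm (g x))\<^sup>2 + 2 * t * (g x \<bullet> h x) + t\<^sup>2 * (norm (h x))\<^sup>2 \<partial>mu)"
  proof (rule integral_mu_cong)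
    fix x
    show "(norm (g x + t *\<^sub>R h x))\<^sup>2 = (norm (g x))\<^sup>2 + 2 * t * (g x \<bullet> h x) + t\<^sup>2 * (norm (h x))\<^sup>2"
    proof -
      have "(g x + t *\<^sub>R h x) \<bullet> (g x + t *\<^sub>R h x) = g x \<bullet> g x + 2 * t * (g x \<bullet> h x) + t\<^sup>2 * (h x \<bullet> h x)"
        by (simp add: inner_add_left inner_add_right inner_commute[of "h x" "g x"] power2_eq_square algebra_simps)
      then show ?thesis by (simp only: power2_norm_eq_inner)
    qed
  qed
  then show ?thesis
    using assms integrable_L2_inner[OF assms] by (simp add: L2_def)
qed

lemma smooth_has_weak_derivs:
  assumes "smooth_S3 \<psi>" shows "has_weak_derivs \<psi> (grad_S3 \<psi>) (hess_S3 \<psi>)"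
  unfolding has_weak_derivs_def using assms
  by (intro exI[of _ "\<lambda>_. \<psi>"])
    (auto intro!: L2_tendsto_const continuous_smooth continuous_grad_S3 continuous_hess_S3)

lemma weak_derivs_add_smooth:
  assumes w: "has_weak_derivs \<phi> V T" and s: "smooth_S3 \<psi>"
  shows "has_weak_derivs (\<lambda>x. \<phi> x + t * \<psi> x) (\<lambda>x. V x + t *\<^sub>R grad_S3 \<psi> x) (\<lambda>x. T x + t *\<^sub>R hess_S3 \<psi> x)"
proof -
  obtain f where f: "\<And>n. smooth_S3 (f n)" "L2_tendsto f \<phi>" "L2_tendsto (\<lambda>n. grad_S3 (f n)) V"
    "L2_tendsto (\<lambda>n. hess_S3 (f n)) T"
    using weak_derivs_approx[OF w] by metis
  have "L2_tendsto (\<lambda>n x. f n x + t * \<psi> x) (\<lambda>x. \<phi> x + t * \<psi> x)"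
    using L2_tendsto_add_scaled[OF f(2) continuous_smooth[OF s], of t] by simp
  moreover have "L2_tendsto (\<lambda>n. grad_S3 (\<lambda>x. f n x + t * \<psi> x)) (\<lambda>x. V x + t *\<^sub>R grad_S3 \<psi> x)"
    by (rule L2_tendsto_cong[OF _ L2_tendsto_add_scaled[OF f(3) continuous_grad_S3[OF s]]])
      (rule grad_S3_add_cmult[OF f(1) s, symmetric])
  moreover have "L2_tendsto (\<lambda>n. hess_S3 (\<lambda>x. f n x + t * \<psi> x)) (\<lambda>x. T x + t *\<^sub>R hess_S3 \<psi> x)"
    by (rule L2_tendsto_cong[OF _ L2_tendsto_add_scaled[OF f(4) continuous_hess_S3[OF s]]])
      (rule hess_S3_add_cmult[OF f(1) s, symmetric])
  ultimately show ?thesis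
    unfolding has_weak_derivs_def
    by (intro exI[of _ "\<lambda>n x. f n x + t * \<psi> x"]) (auto intro: smooth_S3_add_cmult f s)
qed

lemma E_smooth:
  assumes s: "smooth_S3 \<psi>"
  shows "E \<epsilon> \<psi> = (\<integral>x. \<psi> x * paneitz \<epsilon> (radial_ext \<psi>) x \<partial>mu)"
proof -
  let ?F = "radial_ext \<psi>"
  have F: "Cinf ?F" using s by (simp add: smooth_S3_iff)
  note c = continuous_smooth[OF s] Cinf_continuous[OF Cinf_lap[OF F]] Cinf_continuous[OF Cinf_lap[OF Cinf_lap[OF F]]]
  have 1: "(\<integral>x. (trace (hess_S3 \<psi> x))\<^sup>2 \<partial>mu) = (\<integral>x. \<psi> x * lap (lap ?F) x \<partial>mu)"
  proof -
    have "(\<integral>x. (trace (hess_S3 \<psi> x))\<^sup>2 \<partial>mu) = (\<integral>x. lap ?F x * lap ?F x \<partial>mu)"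
      by (rule integral_mu_cong) (simp add: trace_hess_S3[OF s] power2_eq_square)
    then show ?thesis by (simp add: integral_lap_lap[OF s s])
  qed
  have 2: "(\<integral>x. (norm (grad_S3 \<psi> x))\<^sup>2 \<partial>mu) = - (\<integral>x. \<psi> x * lap ?F x \<partial>mu)"
    using integral_grad_S3[OF s s] by (simp add: power2_norm_eq_inner)
  have 3: "(\<integral>x. \<psi> x * paneitz \<epsilon> ?F x \<partial>mu) = (\<integral>x. \<psi> x * lap (lap ?F) x + 1/2 * (\<psi> x * lap ?F x) - (15/16 - \<epsilon>) * (\<psi> x)\<^sup>2 \<partial>mu)"
    by (rule integral_mu_cong) (simp add: paneitz_def radial_ext_on_S3 algebra_simps power2_eq_square)
  have "integrable mu (\<lambda>x. \<psi> x * lap (lap ?F) x)" "integrable mu (\<lambda>x. \<psi> x * lap ?F x)" "integrable mu (\<lambda>x. (\<psi> x)\<^sup>2)"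
    by (intro integrable_mu_continuous continuous_intros c)+
  then have "(\<integral>x. \<psi> x * paneitz \<epsilon> ?F x \<partial>mu) = (\<integral>x. \<psi> x * lap (lap ?F) x \<partial>mu) + 1/2 * (\<integral>x. \<psi> x * lap ?F x \<partial>mu) - (15/16 - \<epsilon>) * (\<integral>x. (\<psi> x)\<^sup>2 \<partial>mu)"
    unfolding 3 by simp
  then show ?thesis
    unfolding E_weak_derivs[OF smooth_has_weak_derivs[OF s] c(1)] 1 2 by simp
qed

text \<open>Only the mixed term needs an argument: for the smooth approximations of \<open>\<phi>\<close> all derivatives can be
  moved to \<open>\<psi>\<close>, and the result is continuous in \<open>L\<^sup>2\<close>.\<close>

lemma E_add_smooth:
  assumes w: "has_weak_derivs \<phi> V T" and c: "continuous_on S3 \<phi>" and s: "smooth_S3 \<psi>"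
  shows "E \<epsilon> (\<lambda>x. \<phi> x + t * \<psi> x) = E \<epsilon> \<phi> + 2 * t * (\<integral>x. \<phi> x * paneitz \<epsilon> (radial_ext \<psi>) x \<partial>mu) + t\<^sup>2 * E \<epsilon> \<psi>"
proof -
  let ?F = "radial_ext \<psi>"
  have F: "Cinf ?F" using s by (simp add: smooth_S3_iff)
  have cl: "continuous_on S3 (lap (lap ?F))" by (intro Cinf_continuous Cinf_lap F)
  note L = weak_derivs_L2[OF w]
  note M = L2_continuous[OF continuous_smooth[OF s]] L2_continuous[OF continuous_grad_S3[OF s]]
     L2_continuous[OF continuous_lap[OF s]]
  have trh: "L2 (\<lambda>x. trace (hess_S3 \<psi> x))" by (intro L2_trace L2_continuous continuous_hess_S3 s)
  obtain f where f: "\<And>n. smooth_S3 (f n)" "L2_tendsto f \<phi>" "L2_tendsto (\<lambda>n. grad_S3 (f n)) V"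
    "L2_tendsto (\<lambda>n. lap (radial_ext (f n))) (\<lambda>x. trace (T x))"
    using weak_derivs_approx[OF w] by metis
  have lap_cross: "(\<integral>x. trace (T x) * trace (hess_S3 \<psi> x) \<partial>mu) = (\<integral>x. \<phi> x * lap (lap ?F) x \<partial>mu)"
  proof -
    have "(\<lambda>n. \<integral>x. lap (radial_ext (f n)) x \<bullet> lap ?F x \<partial>mu) \<longlonglongrightarrow> (\<integral>x. trace (T x) \<bullet> lap ?F x \<partial>mu)"
      by (rule L2_tendsto_inner[OF L2_continuous[OF continuous_lap[OF f(1)]] f(4) M(3)])
    moreover have "(\<lambda>n. \<integral>x. f n x \<bullet> lap (lap ?F) x \<partial>mu) \<longlonglongrightarrow> (\<integral>x. \<phi> x \<bullet> lap (lap ?F) x \<partial>mu)"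
      by (rule L2_tendsto_inner[OF L2_continuous[OF continuous_smooth[OF f(1)]] f(2) L2_continuous[OF cl]])
    ultimately have "(\<integral>x. trace (T x) * lap ?F x \<partial>mu) = (\<integral>x. \<phi> x * lap (lap ?F) x \<partial>mu)"
      by (simp add: integral_lap_lap[OF f(1) s] LIMSEQ_unique)
    moreover have "(\<integral>x. trace (T x) * trace (hess_S3 \<psi> x) \<partial>mu) = (\<integral>x. trace (T x) * lap ?F x \<partial>mu)"
      by (rule integral_mu_cong) (simp add: trace_hess_S3[OF s])
    ultimately show ?thesis by simp
  qed
  have grad_cross: "(\<integral>x. V x \<bullet> grad_S3 \<psi> x \<partial>mu) = - (\<integral>x. \<phi> x * lap ?F x \<partial>mu)"
  proof -
    have "(\<lambda>n. \<integral>x. grad_S3 (f n) x \<bullet> grad_S3 \<psi> x \<partial>mu) \<longlonglongrightarrow> (\<integral>x. V x \<bullet> grad_S3 \<psi> x \<partial>mu)"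
      by (rule L2_tendsto_inner[OF L2_continuous[OF continuous_grad_S3[OF f(1)]] f(3) M(2)])
    moreover have "(\<lambda>n. \<integral>x. f n x \<bullet> lap ?F x \<partial>mu) \<longlonglongrightarrow> (\<integral>x. \<phi> x \<bullet> lap ?F x \<partial>mu)"
      by (rule L2_tendsto_inner[OF L2_continuous[OF continuous_smooth[OF f(1)]] f(2) M(3)])
    from tendsto_minus[OF this] have "(\<lambda>n. \<integral>x. grad_S3 (f n) x \<bullet> grad_S3 \<psi> x \<partial>mu) \<longlonglongrightarrow> - (\<integral>x. \<phi> x * lap ?F x \<partial>mu)"
      by (simp add: integral_grad_S3[OF f(1) s])
    ultimately show ?thesis by (rule LIMSEQ_unique)
  qed
  have cross: "(\<integral>x. \<phi> x * paneitz \<epsilon> ?F x \<partial>mu) = (\<integral>x. \<phi> x * lap (lap ?F) x \<partial>mu) + 1/2 * (\<integral>x. \<phi> x * lap ?F x \<partial>mu) - (15/16 - \<epsilon>) * (\<integral>x. \<phi> x * \<psi> x \<partial>mu)"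
  proof -
    have "(\<integral>x. \<phi> x * paneitz \<epsilon> ?F x \<partial>mu) = (\<integral>x. \<phi> x * lap (lap ?F) x + 1/2 * (\<phi> x * lap ?F x) - (15/16 - \<epsilon>) * (\<phi> x * \<psi> x) \<partial>mu)"
      by (rule integral_mu_cong) (simp add: paneitz_def radial_ext_on_S3 algebra_simps)
    moreover have "integrable mu (\<lambda>x. \<phi> x * lap (lap ?F) x)" "integrable mu (\<lambda>x. \<phi> x * lap ?F x)" "integrable mu (\<lambda>x. \<phi> x * \<psi> x)"
      by (intro integrable_mu_continuous continuous_intros c cl continuous_lap[OF s] continuous_smooth[OF s])+
    ultimately show ?thesis by simp
  qed
  have ct: "continuous_on S3 (\<lambda>x. \<phi> x + t * \<psi> x)" by (intro continuous_intros c continuous_smooth[OF s])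
  have 1: "(\<integral>x. (trace (T x + t *\<^sub>R hess_S3 \<psi> x))\<^sup>2 \<partial>mu) = (\<integral>x. (trace (T x))\<^sup>2 \<partial>mu) + 2 * t * (\<integral>x. \<phi> x * lap (lap ?F) x \<partial>mu) + t\<^sup>2 * (\<integral>x. (trace (hess_S3 \<psi> x))\<^sup>2 \<partial>mu)"
  proof -
    have tr: "trace (A + t *\<^sub>R B) = trace A + t * trace B" for A B :: "real^4^4"
      by (simp add: trace_def sum.distrib sum_distrib_left)
    show ?thesis using integral_norm_add_square[OF L(4) trh] by (simp add: tr lap_cross)
  qed
  have 2: "(\<integral>x. (norm (V x + t *\<^sub>R grad_S3 \<psi> x))\<^sup>2 \<partial>mu) = (\<integral>x. (norm (V x))\<^sup>2 \<partial>mu) - 2 * t * (\<integral>x. \<phi> x * lap ?F x \<partial>mu) + t\<^sup>2 * (\<integral>x. (norm (grad_S3 \<psi> x))\<^sup>2 \<partial>mu)"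
    using integral_norm_add_square[OF L(2) M(2)] by (simp add: grad_cross)
  have 3: "(\<integral>x. (\<phi> x + t * \<psi> x)\<^sup>2 \<partial>mu) = (\<integral>x. (\<phi> x)\<^sup>2 \<partial>mu) + 2 * t * (\<integral>x. \<phi> x * \<psi> x \<partial>mu) + t\<^sup>2 * (\<integral>x. (\<psi> x)\<^sup>2 \<partial>mu)"
    using integral_norm_add_square[OF L(1) M(1)] by simp
  show ?thesis
    unfolding E_weak_derivs[OF weak_derivs_add_smooth[OF w s] ct] E_weak_derivs[OF w c]
      E_weak_derivs[OF smooth_has_weak_derivs[OF s] continuous_smooth[OF s]] 1 2 3 cross
    by (simp add: algebra_simps)
qed

section \<open>Polarization\<close>

definition mirror :: "real^4 \<Rightarrow> real^4 \<Rightarrow> real^4" where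
  "mirror e x = x - (2 * (x \<bullet> e)) *\<^sub>R e"

lemma mirror_inner:
  assumes "e \<in> S3"
  shows "mirror e x \<bullet> y = x \<bullet> mirror e y" "mirror e x \<bullet> mirror e y = x \<bullet> y" "mirror e x \<bullet> e = - (x \<bullet> e)"
    "x \<bullet> mirror e y = x \<bullet> y - 2 * (x \<bullet> e) * (y \<bullet> e)"
proof -
  have e: "e \<bullet> e = 1" using assms by (simp add: norm_eq_1)
  show "mirror e x \<bullet> y = x \<bullet> mirror e y" "mirror e x \<bullet> mirror e y = x \<bullet> y" "mirror e x \<bullet> e = - (x \<bullet> e)"
    "x \<bullet> mirror e y = x \<bullet> y - 2 * (x \<bullet> e) * (y \<bullet> e)"
    using e by (simp_all add: mirror_def inner_diff_left inner_diff_right inner_commute algebra_simps)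
qed

lemma mirror_mirror: "e \<in> S3 \<Longrightarrow> mirror e (mirror e x) = x"
  by (simp add: mirror_inner(3) mirror_def[of e "mirror e x"]) (simp add: mirror_def)

lemma mirror_orthogonal:
  assumes "e \<in> S3" shows "orthogonal_transformation (mirror e)"
proof -
  have "linear (mirror e)"
    by (rule linearI) (simp_all add: mirror_def inner_add_left algebra_simps)
  then show ?thesis by (simp add: orthogonal_transformation_def mirror_inner(2)[OF assms])
qed

lemma mirror_S3: "e \<in> S3 \<Longrightarrow> x \<in> S3 \<Longrightarrow> mirror e x \<in> S3"
  by (simp add: orthogonal_norm[OF mirror_orthogonal])

lemma continuous_on_mirror: "continuous_on X f \<Longrightarrow> continuous_on X (\<lambda>x. mirror e (f x))"
  unfolding mirror_def by (intro continuous_intros)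

lemma continuous_mirror_compose:
  assumes "e \<in> S3" "continuous_on S3 f" shows "continuous_on S3 (\<lambda>x. f (mirror e x))"
  by (rule continuous_on_compose2[OF assms(2) continuous_on_mirror[OF continuous_on_id]]) (auto simp: orthogonal_norm[OF mirror_orthogonal[OF assms(1)]])

definition double_int :: "(real^4 \<Rightarrow> real^4 \<Rightarrow> real) \<Rightarrow> real" where
  "double_int F = (\<integral>x. (\<integral>y. F x y \<partial>mu) \<partial>mu)"

abbreviation cont2 :: "(real^4 \<Rightarrow> real^4 \<Rightarrow> real) \<Rightarrow> bool" where
  "cont2 F \<equiv> continuous_on (S3 \<times> S3) (\<lambda>(x, y). F x y)"

lemma cont2_slice:
  assumes "cont2 F" "x \<in> S3" shows "continuous_on S3 (F x)"
proof -
  have "continuous_on S3 (\<lambda>y. (\<lambda>(x, y). F x y) (x, y))"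
    by (rule continuous_on_compose2[OF assms(1), of S3 "Pair x"])
      (use assms(2) in \<open>auto intro!: continuous_on_Pair continuous_on_const continuous_on_id\<close>)
  then show ?thesis by simp
qed

lemma cont2_integral:
  assumes "cont2 F" shows "continuous_on S3 (\<lambda>x. \<integral>y. F x y \<partial>mu)"
proof -
  obtain B where B: "\<And>z. z \<in> S3 \<times> S3 \<Longrightarrow> \<bar>(\<lambda>(x, y). F x y) z\<bar> \<le> B"
    using continuous_compact_bound[OF compact_Times[OF compact_sphere compact_sphere] assms] by metis
  show ?thesis
    by (rule continuous_on_integral_mu[OF assms, of B]) (use B in force)
qed

lemma double_int_add:
  assumes "cont2 F" "cont2 G" shows "double_int (\<lambda>x y. F x y + G x y) = double_int F + double_int G"
proof -
  have "double_int (\<lambda>x y. F x y + G x y) = (\<integral>x. (\<integral>y. F x y \<partial>mu) + (\<integral>y. G x y \<partial>mu) \<partial>mu)"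
    unfolding double_int_def
    by (rule integral_mu_cong) (simp add: integrable_mu_continuous cont2_slice assms)
  also have "\<dots> = double_int F + double_int G"
    unfolding double_int_def
    by (intro Bochner_Integration.integral_add integrable_mu_continuous cont2_integral assms)
  finally show ?thesis .
qed

lemma double_int_pos:
  assumes c: "cont2 F" and nn: "\<And>x y. x \<in> S3 \<Longrightarrow> y \<in> S3 \<Longrightarrow> F x y \<ge> 0"
    and p: "x0 \<in> S3" "y0 \<in> S3" "F x0 y0 > 0"
  shows "double_int F > 0"
  unfolding double_int_def
proof (rule integral_mu_pos[OF cont2_integral[OF c] _ p(1)])
  show "0 \<le> (\<integral>y. F x y \<partial>mu)" if "x \<in> S3" for x
    using nn[OF that] by (intro integral_nonneg_AE AE_mu_I)
  show "0 < (\<integral>y. F x0 y \<partial>mu)"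
    by (rule integral_mu_pos[OF cont2_slice[OF c p(1)] nn[OF p(1)] p(2,3)])
qed

lemma double_int_mirror1:
  assumes e: "e \<in> S3" and c: "cont2 F"
  shows "double_int (\<lambda>x y. F (mirror e x) y) = double_int F"
  unfolding double_int_def by (rule integral_mu_orthogonal[OF mirror_orthogonal[OF e] cont2_integral[OF c]])

lemma double_int_mirror2:
  assumes e: "e \<in> S3" and c: "cont2 F"
  shows "double_int (\<lambda>x y. F x (mirror e y)) = double_int F"
  unfolding double_int_def
  by (rule integral_mu_cong) (rule integral_mu_orthogonal[OF mirror_orthogonal[OF e] cont2_slice[OF c]])

lemma cont2_mirror:
  assumes e: "e \<in> S3" and c: "cont2 F"
  shows "cont2 (\<lambda>x y. F (mirror e x) y)" "cont2 (\<lambda>x y. F x (mirror e y))"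
proof -
  have n: "norm (mirror e x) = norm x" for x by (rule orthogonal_norm[OF mirror_orthogonal[OF e]])
  have "continuous_on (S3 \<times> S3) (\<lambda>p. (\<lambda>(x, y). F x y) (mirror e (fst p), snd p))"
    by (rule continuous_on_compose2[OF c])
      (auto intro!: continuous_on_Pair continuous_on_mirror continuous_on_fst continuous_on_snd continuous_on_id simp: n)
  then show "cont2 (\<lambda>x y. F (mirror e x) y)" by (simp add: case_prod_beta)
  have "continuous_on (S3 \<times> S3) (\<lambda>p. (\<lambda>(x, y). F x y) (fst p, mirror e (snd p)))"
    by (rule continuous_on_compose2[OF c])
      (auto intro!: continuous_on_Pair continuous_on_mirror continuous_on_fst continuous_on_snd continuous_on_id simp: n)
  then show "cont2 (\<lambda>x y. F x (mirror e y))" by (simp add: case_prod_beta)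
qed

lemma cont2_product:
  assumes "continuous_on S3 f" "continuous_on S3 g"
  shows "cont2 (\<lambda>x y. f x * g y)"
  unfolding case_prod_beta
  by (intro continuous_on_mult continuous_on_compose2[OF assms(1) continuous_on_fst]
      continuous_on_compose2[OF assms(2) continuous_on_snd] continuous_on_id) auto

lemma green_energy_dint:
  assumes "0 < \<epsilon>" "\<epsilon> < 15/16" 
  shows "mass * (\<integral>x. f x * green \<epsilon> f x \<partial>mu) = double_int (\<lambda>x y. (f x * f y) * kern \<epsilon> (x \<bullet> y))"
proof -
  have "double_int (\<lambda>x y. (f x * f y) * kern \<epsilon> (x \<bullet> y)) = (\<integral>x. mass * (f x * green \<epsilon> f x) \<partial>mu)"
    unfolding double_int_def
  proof (rule integral_mu_cong)
    fix x
    have "(\<integral>y. (f x * f y) * kern \<epsilon> (x \<bullet> y) \<partial>mu) = (\<integral>y. f x * (kern \<epsilon> (x \<bullet> y) * f y) \<partial>mu)"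
      by (simp add: mult_ac)
    then show "(\<integral>y. (f x * f y) * kern \<epsilon> (x \<bullet> y) \<partial>mu) = mass * (f x * green \<epsilon> f x)"
      using mass_pos by (simp add: green_def)
  qed
  then show ?thesis by simp
qed

text \<open>Averaging over the group generated by the reflections of either variable turns the difference of
  the two energies into the integral of a product of a definite sign.\<close>

lemma polarization_strict:
  assumes eps: "0 < \<epsilon>" "\<epsilon> < 15/16" and e: "e \<in> S3"
    and f: "continuous_on S3 f" and g: "continuous_on S3 g"
    and swap: "\<And>x. x \<in> S3 \<Longrightarrow> (g x = f x \<and> g (mirror e x) = f (mirror e x)) \<or> (g x = f (mirror e x) \<and> g (mirror e x) = f x)"
    and order: "\<And>x. x \<in> S3 \<Longrightarrow> x \<bullet> e \<ge> 0 \<Longrightarrow> g x \<ge> g (mirror e x)"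
    and x0: "x0 \<in> S3" "x0 \<bullet> e \<ge> 0" "f x0 < f (mirror e x0)"
    and y0: "y0 \<in> S3" "y0 \<bullet> e \<ge> 0" "f y0 > f (mirror e y0)"
  shows "(\<integral>x. g x * green \<epsilon> g x \<partial>mu) < (\<integral>x. f x * green \<epsilon> f x \<partial>mu)"
proof -
  let ?s = "mirror e" and ?k = "\<lambda>x y. kern \<epsilon> (x \<bullet> y)"
  define A where "A x y = (f x * f y - g x * g y) * ?k x y" for x y
  have kc: "cont2 ?k" by (rule continuous_on_kern_inner[OF eps])
  have prodc: "cont2 (\<lambda>x y. (h x * h y) * ?k x y)" if "continuous_on S3 h" for h
    using continuous_on_mult[OF cont2_product[OF that that] kc] by (simp add: case_prod_beta)
  have Ac: "cont2 A"
    using continuous_on_diff[OF prodc[OF f] prodc[OF g]]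
    unfolding A_def left_diff_distrib by (simp add: case_prod_beta)
  have dA: "double_int (\<lambda>x y. (f x * f y) * ?k x y) = double_int A + double_int (\<lambda>x y. (g x * g y) * ?k x y)"
    using double_int_add[OF Ac prodc[OF g]] by (simp add: A_def[abs_def] left_diff_distrib)
  define A1 A2 A3 where "A1 x y = A (?s x) y" "A2 x y = A x (?s y)" "A3 x y = A (?s x) (?s y)" for x y
  have A1c: "cont2 A1" and A2c: "cont2 A2" unfolding A1_A2_A3_def by (rule cont2_mirror[OF e Ac])+
  have A3c: "cont2 A3" unfolding A1_A2_A3_def by (rule cont2_mirror(1)[OF e A2c[unfolded A1_A2_A3_def]])
  have d1: "double_int A1 = double_int A" unfolding A1_A2_A3_def by (rule double_int_mirror1[OF e Ac])
  have d2: "double_int A2 = double_int A" unfolding A1_A2_A3_def by (rule double_int_mirror2[OF e Ac])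
  have d3: "double_int A3 = double_int A"
    using double_int_mirror1[OF e A2c] d2 by (simp add: A1_A2_A3_def[abs_def])
  \<comment> \<open>Both pairs of values are permuted by \<open>g\<close>; this factor vanishes unless exactly one of them is swapped.\<close>
  define \<beta> where "\<beta> x y = f x * f y + f (?s x) * f (?s y) - g x * g y - g (?s x) * g (?s y)" for x y
  \<comment> \<open>The sum over the four images of the integrand under the reflections of the two variables.\<close>
  define B where "B x y = ((A x y + A1 x y) + A2 x y) + A3 x y" for x y
  have c1: "cont2 (\<lambda>x y. A x y + A1 x y)" using continuous_on_add[OF Ac A1c] by (simp add: case_prod_beta)
  have c2: "cont2 (\<lambda>x y. (A x y + A1 x y) + A2 x y)" using continuous_on_add[OF c1 A2c] by (simp add: case_prod_beta)
  have Bc: "cont2 B" using continuous_on_add[OF c2 A3c] by (simp add: B_def[abs_def] case_prod_beta)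
  have dB: "double_int B = 4 * double_int A"
    unfolding B_def[abs_def] double_int_add[OF c2 A3c] double_int_add[OF c1 A2c] double_int_add[OF Ac A1c] d1 d2 d3 by simp
  have B_eq: "B x y = \<beta> x y * (?k x y - ?k x (?s y))" if x: "x \<in> S3" and y: "y \<in> S3" for x y
  proof -
    have k: "?k (?s x) y = ?k x (?s y)" "?k (?s x) (?s y) = ?k x y"
      by (simp_all add: mirror_inner(1,2)[OF e] mirror_mirror[OF e])
    have gs: "g x + g (?s x) = f x + f (?s x)" "g y + g (?s y) = f y + f (?s y)"
      using swap[OF x] swap[OF y] by auto
    have "(g x + g (?s x)) * (g y + g (?s y)) = (f x + f (?s x)) * (f y + f (?s y))"
      unfolding gs ..
    then have "f (?s x) * f y + f x * f (?s y) - g (?s x) * g y - g x * g (?s y) = - \<beta> x y"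
      by (simp add: \<beta>_def algebra_simps)
    moreover have "B x y = \<beta> x y * ?k x y + (f (?s x) * f y + f x * f (?s y) - g (?s x) * g y - g x * g (?s y)) * ?k x (?s y)"
      by (simp add: B_def A1_A2_A3_def A_def k \<beta>_def algebra_simps)
    ultimately have "B x y = \<beta> x y * ?k x y + (- \<beta> x y) * ?k x (?s y)" by (simp only:)
    then show ?thesis by (simp add: right_diff_distrib)
  qed
  have \<beta>_eq: "\<beta> x y = 0 \<or> \<beta> x y = - ((g x - g (?s x)) * (g y - g (?s y)))" if "x \<in> S3" "y \<in> S3" for x y
    using swap[OF that(1)] swap[OF that(2)] by (auto simp: \<beta>_def algebra_simps)
  have gsign: "(x \<bullet> e \<ge> 0 \<longrightarrow> g x \<ge> g (?s x)) \<and> (x \<bullet> e \<le> 0 \<longrightarrow> g x \<le> g (?s x))" if "x \<in> S3" for x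
    using order[OF that] order[OF mirror_S3[OF e that]] by (simp add: mirror_inner(3)[OF e] mirror_mirror[OF e])
  have rng: "-1 \<le> x \<bullet> y" "x \<bullet> y \<le> 1" if "x \<in> S3" "y \<in> S3" for x y :: "real^4"
    using inner_S3_le[OF that] by (simp_all add: abs_le_iff)
  have kdiff: "((x \<bullet> e) * (y \<bullet> e) > 0 \<longrightarrow> ?k x y < ?k x (?s y)) \<and> ((x \<bullet> e) * (y \<bullet> e) < 0 \<longrightarrow> ?k x y > ?k x (?s y))
      \<and> ((x \<bullet> e) * (y \<bullet> e) = 0 \<longrightarrow> ?k x y = ?k x (?s y))" if x: "x \<in> S3" and y: "y \<in> S3" for x y
  proof (intro conjI impI)
    have s: "x \<bullet> ?s y = x \<bullet> y - 2 * ((x \<bullet> e) * (y \<bullet> e))" by (simp add: mirror_inner(4)[OF e])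
    show "?k x y < ?k x (?s y)" if "(x \<bullet> e) * (y \<bullet> e) > 0"
      using rng[OF x y] rng[OF x mirror_S3[OF e y]] that s by (intro kern_strict_antimono[OF eps]) linarith+
    show "?k x y > ?k x (?s y)" if "(x \<bullet> e) * (y \<bullet> e) < 0"
      using rng[OF x y] rng[OF x mirror_S3[OF e y]] that s by (intro kern_strict_antimono[OF eps]) linarith+
    show "?k x y = ?k x (?s y)" if "(x \<bullet> e) * (y \<bullet> e) = 0" unfolding s that by simp
  qed
  have "double_int B > 0"
  proof (rule double_int_pos[OF Bc _ x0(1) y0(1)])
    fix x y :: "real^4" assume x: "x \<in> S3" and y: "y \<in> S3"
    consider "(x \<bullet> e) * (y \<bullet> e) > 0" | "(x \<bullet> e) * (y \<bullet> e) < 0" | "(x \<bullet> e) * (y \<bullet> e) = 0" by linarith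
    then have "\<beta> x y * (?k x y - ?k x (?s y)) \<ge> 0"
    proof cases
      case 1
      then have "(g x - g (?s x)) * (g y - g (?s y)) \<ge> 0"
        using gsign[OF x] gsign[OF y] by (auto simp: zero_less_mult_iff zero_le_mult_iff)
      then have "\<beta> x y \<le> 0" using \<beta>_eq[OF x y] by auto
      then show ?thesis using kdiff[OF x y] 1 by (simp add: zero_le_mult_iff)
    next
      case 2
      then have "(g x - g (?s x)) * (g y - g (?s y)) \<le> 0"
        using gsign[OF x] gsign[OF y] by (auto simp: mult_less_0_iff mult_le_0_iff)
      then have "\<beta> x y \<ge> 0" using \<beta>_eq[OF x y] by auto
      then show ?thesis using kdiff[OF x y] 2 by (simp add: zero_le_mult_iff)
    next
      case 3
      then show ?thesis using kdiff[OF x y] by simp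
    qed
    then show "B x y \<ge> 0" unfolding B_eq[OF x y] .
  next
    have fixed: "?s x = x" if "x \<bullet> e = 0" for x using that by (simp add: mirror_def)
    have pos: "x0 \<bullet> e > 0" "y0 \<bullet> e > 0"
      using x0 y0 fixed[of x0] fixed[of y0] by (auto simp: less_le)
    have gx: "g x0 = f (?s x0)" "g (?s x0) = f x0"
      using swap[OF x0(1)] order[OF x0(1,2)] x0(3) by auto
    have gy: "g y0 = f y0" "g (?s y0) = f (?s y0)"
      using swap[OF y0(1)] order[OF y0(1,2)] y0(3) by auto
    have "\<beta> x0 y0 = - ((f (?s x0) - f x0) * (f y0 - f (?s y0)))"
      by (simp add: \<beta>_def gx gy algebra_simps)
    then have "\<beta> x0 y0 < 0" using x0(3) y0(3) by simp
    moreover have "?k x0 y0 < ?k x0 (?s y0)" using kdiff[OF x0(1) y0(1)] pos by simp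
    ultimately show "B x0 y0 > 0"
      unfolding B_eq[OF x0(1) y0(1)] by (simp add: mult_neg_neg)
  qed
  then have "double_int A > 0" using dB by simp
  then have "mass * (\<integral>x. g x * green \<epsilon> g x \<partial>mu) < mass * (\<integral>x. f x * green \<epsilon> f x \<partial>mu)"
    unfolding green_energy_dint[OF eps] dA by simp
  then show ?thesis using mass_pos by simp
qed

text \<open>The larger value is put on the side opposite to \<open>e\<close>, as suits a function whose power \<open>-7\<close> is to
  concentrate near \<open>e\<close>.\<close>

definition polarize :: "real^4 \<Rightarrow> (real^4 \<Rightarrow> real) \<Rightarrow> real^4 \<Rightarrow> real" where
  "polarize e u x = (if x \<bullet> e \<le> 0 then max (u x) (u (mirror e x)) else min (u x) (u (mirror e x)))"

lemma continuous_polarize: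
  assumes e: "e \<in> S3" and u: "continuous_on S3 u"
  shows "continuous_on S3 (polarize e u)"
  unfolding polarize_def[abs_def]
proof (rule continuous_on_cases_le)
  show "continuous_on {t \<in> S3. t \<bullet> e \<le> 0} (\<lambda>x. max (u x) (u (mirror e x)))"
    by (rule continuous_on_subset[of S3]) (auto intro!: continuous_on_max u continuous_mirror_compose e)
  show "continuous_on {t \<in> S3. 0 \<le> t \<bullet> e} (\<lambda>x. min (u x) (u (mirror e x)))"
    by (rule continuous_on_subset[of S3]) (auto intro!: continuous_on_min u continuous_mirror_compose e)
  show "continuous_on S3 (\<lambda>x. x \<bullet> e)" by (intro continuous_intros)
qed (simp add: mirror_def)

lemma polarize_swap:
  assumes e: "e \<in> S3"
  shows "(polarize e u x = u x \<and> polarize e u (mirror e x) = u (mirror e x)) \<or>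
         (polarize e u x = u (mirror e x) \<and> polarize e u (mirror e x) = u x)"
proof (cases "x \<bullet> e = 0")
  case True
  then show ?thesis by (simp add: mirror_def polarize_def)
next
  case False
  then show ?thesis
    by (auto simp: polarize_def mirror_inner(3)[OF e] mirror_mirror[OF e] min_def max_def)
qed

lemma polarize_order:
  assumes e: "e \<in> S3" and x: "x \<bullet> e \<ge> 0"
  shows "polarize e u x \<le> polarize e u (mirror e x)"
proof (cases "x \<bullet> e = 0")
  case True
  then show ?thesis by (simp add: mirror_def)
next
  case False
  then show ?thesis using x
    by (auto simp: polarize_def mirror_inner(3)[OF e] mirror_mirror[OF e] min_def max_def)
qed

definition int_inv6 :: "(real^4 \<Rightarrow> real) \<Rightarrow> real" where
  "int_inv6 \<phi> = (\<integral>x. inverse (\<phi> x) ^ 6 \<partial>mu)"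

lemma int_inv6_polarize:
  assumes e: "e \<in> S3" and u: "continuous_on S3 u" and pos: "\<And>x. x \<in> S3 \<Longrightarrow> u x > 0"
  shows "int_inv6 (polarize e u) = int_inv6 u"
proof -
  have pp: "polarize e u x > 0" if "x \<in> S3" for x
    using polarize_swap[OF e, of u x] pos[OF that] pos[OF mirror_S3[OF e that]] by auto
  have two: "2 * int_inv6 v = (\<integral>x. inverse (v x) ^ 6 + inverse (v (mirror e x)) ^ 6 \<partial>mu)"
    if c: "continuous_on S3 v" and p: "\<And>x. x \<in> S3 \<Longrightarrow> v x > 0" for v
  proof -
    have vc: "continuous_on S3 (\<lambda>x. inverse (v x) ^ 6)"
      using p by (intro continuous_intros c) (metis less_irrefl)
    have "(\<integral>x. inverse (v x) ^ 6 + inverse (v (mirror e x)) ^ 6 \<partial>mu)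
       = (\<integral>x. inverse (v x) ^ 6 \<partial>mu) + (\<integral>x. inverse (v (mirror e x)) ^ 6 \<partial>mu)"
      by (intro Bochner_Integration.integral_add integrable_mu_continuous vc continuous_mirror_compose[OF e vc])
    then show ?thesis
      using integral_mu_orthogonal[OF mirror_orthogonal[OF e] vc] by (simp add: int_inv6_def)
  qed
  have "2 * int_inv6 (polarize e u) = (\<integral>x. inverse (polarize e u x) ^ 6 + inverse (polarize e u (mirror e x)) ^ 6 \<partial>mu)"
    by (rule two[OF continuous_polarize[OF e u] pp])
  also have "\<dots> = (\<integral>x. inverse (u x) ^ 6 + inverse (u (mirror e x)) ^ 6 \<partial>mu)"
  proof (rule integral_mu_cong)
    show "inverse (polarize e u x) ^ 6 + inverse (polarize e u (mirror e x)) ^ 6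
        = inverse (u x) ^ 6 + inverse (u (mirror e x)) ^ 6" for x
      using polarize_swap[OF e, of u x] by auto
  qed
  also have "\<dots> = 2 * int_inv6 u" by (rule two[OF u pos, symmetric])
  finally show ?thesis by simp
qed

section \<open>The Euler-Lagrange equation\<close>

lemma int_inv6_pos:
  assumes c: "continuous_on S3 \<phi>" and pos: "\<And>x. x \<in> S3 \<Longrightarrow> \<phi> x > 0"
  shows "int_inv6 \<phi> > 0"
  unfolding int_inv6_def
proof (rule integral_mu_pos[of _ "axis 1 1"])
  show "continuous_on S3 (\<lambda>x. inverse (\<phi> x) ^ 6)"
    using pos by (intro continuous_intros c) (metis less_irrefl)
  show "inverse (\<phi> (axis 1 1)) ^ 6 > 0" using pos[of "axis 1 1"] by simp
qed (auto simp: norm_axis_1)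

text \<open>The cube of the functional has no fractional powers, and cubing preserves the order of reals.\<close>

lemma J_cube:
  assumes c: "continuous_on S3 \<phi>" and pos: "\<And>x. x \<in> S3 \<Longrightarrow> \<phi> x > 0"
  shows "(J \<epsilon> \<phi>) ^ 3 = int_inv6 \<phi> * (E \<epsilon> \<phi>) ^ 3"
proof -
  have N: "int_inv6 \<phi> > 0" by (rule int_inv6_pos[OF c pos])
  have "(\<integral>x. \<bar>inverse (\<phi> x)\<bar> powr 6 \<partial>mu) = int_inv6 \<phi>"
    unfolding int_inv6_def
  proof (rule integral_mu_cong)
    fix x assume "x \<in> S3"
    then have "inverse (\<phi> x) > 0" using pos by simp
    then show "\<bar>inverse (\<phi> x)\<bar> powr 6 = inverse (\<phi> x) ^ 6" by (simp add: powr_numeral)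
  qed
  then have "(Lp_norm 6 (\<lambda>x. inverse (\<phi> x)))\<^sup>2 = int_inv6 \<phi> powr (1/3)"
    using N by (simp add: Lp_norm_def power2_eq_square powr_add[symmetric])
  moreover have "(int_inv6 \<phi> powr (1/3)) ^ 3 = int_inv6 \<phi>"
    using N by (simp add: powr_power)
  ultimately show ?thesis by (simp add: J_def power_mult_distrib)
qed

text \<open>The graph of \<open>v \<mapsto> v\<^sup>-\<^sup>6\<close> lies above its tangents.\<close>

lemma inverse_power_tangent:
  fixes a v :: real
  assumes a: "a > 0" and v: "v > 0"
  shows "7 * inverse a ^ 6 - 6 * inverse a ^ 7 * v \<le> inverse v ^ 6"
proof -
  define y where "y = a / v"
  have y: "y > 0" using a v by (simp add: y_def)
  have "1 + real 7 * (y - 1) \<le> (1 + (y - 1)) ^ 7" by (rule Bernoulli_inequality) (use y in simp)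
  then have "7 * y - 6 \<le> y ^ 7" by simp
  then have "(7 * y - 6) * (v * inverse a ^ 7) \<le> y ^ 7 * (v * inverse a ^ 7)"
    using a v by (intro mult_right_mono) auto
  moreover have "(7 * y - 6) * (v * inverse a ^ 7) = 7 * inverse a ^ 6 - 6 * inverse a ^ 7 * v"
    using a v by (simp add: y_def field_simps power_numeral_reduce)
  moreover have "y ^ 7 * (v * inverse a ^ 7) = inverse v ^ 6"
    using a v by (simp add: y_def field_simps power_numeral_reduce)
  ultimately show ?thesis by simp
qed

lemma smooth_const: "smooth_S3 (\<lambda>_. c)"
  unfolding smooth_S3_iff radial_ext_def[abs_def] by (rule Cinf_const)

lemma smooth_in_H2: "smooth_S3 \<psi> \<Longrightarrow> \<psi> \<in> H2"
  using smooth_has_weak_derivs continuous_smooth by (auto simp: H2_def)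

lemma E_one: "E \<epsilon> (\<lambda>_. 1) = - (15/16 - \<epsilon>) * mass"
proof -
  have l: "lie a (\<lambda>_. c) = (\<lambda>_. 0)" for a c
    by (rule ext) (rule lie_eq[OF has_derivative_const])
  have "radial_ext (\<lambda>_. 1) = (\<lambda>_. 1)" by (rule ext) (simp add: radial_ext_def)
  then have "paneitz \<epsilon> (radial_ext (\<lambda>_. 1)) x = - (15/16 - \<epsilon>)" for x
    by (simp add: paneitz_def lap_def[abs_def] l)
  then show ?thesis
    unfolding E_smooth[OF smooth_const] by (simp add: mass_def)
qed

lemma positive_S3_lower_bound:
  fixes f :: "real^4 \<Rightarrow> real"
  assumes c: "continuous_on S3 f" and pos: "\<And>x. x \<in> S3 \<Longrightarrow> f x > 0"
  obtains l where "l > 0" "\<And>x. x \<in> S3 \<Longrightarrow> l \<le> f x"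
proof -
  have "axis 1 1 \<in> S3" by (simp add: norm_axis_1)
  then have "S3 \<noteq> {}" by blast
  then obtain z where z: "z \<in> S3" "\<And>x. x \<in> S3 \<Longrightarrow> f z \<le> f x"
    using continuous_attains_inf[OF compact_sphere _ c] by blast
  show ?thesis by (rule that[of "f z"]) (use z pos in auto)
qed

lemma integral_uniform_limit:
  fixes f :: "nat \<Rightarrow> real^4 \<Rightarrow> real"
  assumes f: "\<And>n. continuous_on S3 (f n)" "continuous_on S3 g"
    and close: "\<And>n x. x \<in> S3 \<Longrightarrow> \<bar>f n x - g x\<bar> \<le> C * inverse (real (Suc n))"
  shows "(\<lambda>n. \<integral>x. f n x \<partial>mu) \<longlonglongrightarrow> (\<integral>x. g x \<partial>mu)"
proof -
  have lim: "(\<lambda>n. (C * inverse (real (Suc n))) * mass) \<longlonglongrightarrow> (C * 0) * mass"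
    by (intro tendsto_intros LIMSEQ_inverse_real_of_nat)
  have "(\<lambda>n. (\<integral>x. f n x \<partial>mu) - (\<integral>x. g x \<partial>mu)) \<longlonglongrightarrow> 0"
  proof (rule Lim_null_comparison[OF always_eventually])
    show "\<forall>n. norm ((\<integral>x. f n x \<partial>mu) - (\<integral>x. g x \<partial>mu)) \<le> (C * inverse (real (Suc n))) * mass"
    proof
      fix n
      show "norm ((\<integral>x. f n x \<partial>mu) - (\<integral>x. g x \<partial>mu)) \<le> (C * inverse (real (Suc n))) * mass"
        unfolding real_norm_def by (rule integral_abs_diff_le[OF f(1) f(2) close])
    qed
    show "(\<lambda>n. (C * inverse (real (Suc n))) * mass) \<longlonglongrightarrow> 0" using lim by simp
  qed
  then show ?thesis by (rule LIM_zero_cancel)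
qed

context
  fixes \<epsilon> :: real and u :: "real^4 \<Rightarrow> real"
  assumes eps: "0 < \<epsilon>" "\<epsilon> < 15/16"
    and u: "u \<in> positive_H2" and minimal: "\<And>\<phi>. \<phi> \<in> positive_H2 \<Longrightarrow> J \<epsilon> u \<le> J \<epsilon> \<phi>"
begin

lemma u_cont: "continuous_on S3 u" and u_pos: "x \<in> S3 \<Longrightarrow> u x > 0"
  using u by (auto simp: positive_H2_def H2_def)

lemma u_inverse_cont: "continuous_on S3 (\<lambda>x. inverse (u x) ^ k)"
  using u_pos by (intro continuous_intros u_cont) (metis less_irrefl)

lemma minimal_cube:
  assumes "\<phi> \<in> H2" "\<And>x. x \<in> S3 \<Longrightarrow> \<phi> x > 0"
  shows "int_inv6 \<phi> * (- E \<epsilon> \<phi>) ^ 3 \<le> int_inv6 u * (- E \<epsilon> u) ^ 3"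
proof -
  have "continuous_on S3 \<phi>" using assms by (simp add: H2_def)
  moreover have "(J \<epsilon> u) ^ 3 \<le> (J \<epsilon> \<phi>) ^ 3"
    using minimal[of \<phi>] assms by (intro power_mono_odd) (auto simp: positive_H2_def)
  ultimately show ?thesis
    using J_cube[OF u_cont u_pos, of \<epsilon>] J_cube[of \<phi> \<epsilon>] assms by (simp add: power_minus_odd)
qed

lemma E_u_neg: "E \<epsilon> u < 0"
proof -
  have "int_inv6 (\<lambda>_. 1) * (- E \<epsilon> (\<lambda>_. 1)) ^ 3 \<le> int_inv6 u * (- E \<epsilon> u) ^ 3"
    by (rule minimal_cube) (auto intro: smooth_in_H2 smooth_const)
  moreover have "int_inv6 (\<lambda>_. 1) * (- E \<epsilon> (\<lambda>_. 1)) ^ 3 > 0"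
  proof -
    have "(15/16 - \<epsilon>) * mass > 0" using eps mass_pos by (intro mult_pos_pos) auto
    then have "- (- (15/16 - \<epsilon>) * mass) > 0" by (simp only: minus_mult_left[symmetric] minus_minus)
    then show ?thesis unfolding E_one by (intro mult_pos_pos zero_less_power int_inv6_pos) auto
  qed
  ultimately have "int_inv6 u * (- E \<epsilon> u) ^ 3 > 0" by linarith
  then have "(- E \<epsilon> u) ^ 3 > 0"
    using int_inv6_pos[OF u_cont u_pos] zero_less_mult_pos by blast
  moreover have "(- E \<epsilon> u) ^ 3 \<le> 0 ^ 3" if "- E \<epsilon> u \<le> 0"
    using that by (rule power_mono_odd[rotated]) simp
  ultimately show ?thesis by fastforce
qed

text \<open>By the tangent estimate, minus the cube of the functional at \<open>u + t \<psi>\<close> is at least a polynomial in \<open>t\<close>,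
  with equality at \<open>t = 0\<close>. By minimality this polynomial has a local maximum there, so its derivative
  vanishes, and no integral has to be differentiated.\<close>

lemma euler_lagrange:
  assumes s: "smooth_S3 \<psi>"
  shows "(\<integral>x. inverse (u x) ^ 7 * \<psi> x \<partial>mu) * (- E \<epsilon> u) = - int_inv6 u * (\<integral>x. u x * paneitz \<epsilon> (radial_ext \<psi>) x \<partial>mu)"
proof -
  define b N I e where "b = - E \<epsilon> u" "N = int_inv6 u" "I = (\<integral>x. inverse (u x) ^ 7 * \<psi> x \<partial>mu)"
    "e = (\<integral>x. u x * paneitz \<epsilon> (radial_ext \<psi>) x \<partial>mu)"
  define G where "G t = (N - 6 * t * I) * (b - 2 * t * e - t\<^sup>2 * E \<epsilon> \<psi>) ^ 3" for t
  have b: "b > 0" using E_u_neg by (simp add: b_N_I_e_def)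
  have pc: "continuous_on S3 \<psi>" by (rule continuous_smooth[OF s])
  obtain C where C: "C > 0" "\<And>x. x \<in> S3 \<Longrightarrow> \<bar>\<psi> x\<bar> \<le> C" using continuous_compact_bound[OF compact_sphere pc] by metis
  obtain l where l: "l > 0" "\<And>x. x \<in> S3 \<Longrightarrow> l \<le> u x" using positive_S3_lower_bound[OF u_cont u_pos] by blast
  obtain V T where w: "has_weak_derivs u V T" using u by (auto simp: positive_H2_def H2_def)
  have "((\<lambda>t. b - 2 * t * e - t\<^sup>2 * E \<epsilon> \<psi>) \<longlongrightarrow> b - 2 * 0 * e - 0\<^sup>2 * E \<epsilon> \<psi>) (nhds 0)"
    by (intro tendsto_intros filterlim_ident)
  then have "eventually (\<lambda>t. 0 < b - 2 * t * e - t\<^sup>2 * E \<epsilon> \<psi>) (nhds 0)"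
    by (rule order_tendstoD) (use b in simp)
  then obtain d where d: "d > 0" "\<And>t. \<bar>t\<bar> < d \<Longrightarrow> 0 < b - 2 * t * e - t\<^sup>2 * E \<epsilon> \<psi>"
    by (auto simp: eventually_nhds_metric dist_real_def)
  have le: "G t \<le> G 0" if t: "\<bar>t\<bar> < min d (l / C)" for t
  proof -
    define \<phi> where "\<phi> x = u x + t * \<psi> x" for x
    have pos: "\<phi> x > 0" if x: "x \<in> S3" for x
    proof -
      have "\<bar>t * \<psi> x\<bar> \<le> \<bar>t\<bar> * C" unfolding abs_mult using C(2)[OF x] by (intro mult_left_mono) auto
      also have "\<dots> < l" using t C(1) by (simp add: less_divide_eq)
      finally show ?thesis using l(2)[OF x] by (auto simp: \<phi>_def abs_less_iff)
    qed
    have "has_weak_derivs \<phi> (\<lambda>x. V x + t *\<^sub>R grad_S3 \<psi> x) (\<lambda>x. T x + t *\<^sub>R hess_S3 \<psi> x)"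
      unfolding \<phi>_def[abs_def] by (rule weak_derivs_add_smooth[OF w s])
    moreover have c\<phi>: "continuous_on S3 \<phi>" unfolding \<phi>_def by (intro continuous_intros u_cont pc)
    ultimately have H: "\<phi> \<in> H2" by (auto simp: H2_def)
    have E\<phi>: "- E \<epsilon> \<phi> = b - 2 * t * e - t\<^sup>2 * E \<epsilon> \<psi>"
      unfolding \<phi>_def[abs_def] E_add_smooth[OF w u_cont s] by (simp add: b_N_I_e_def)
    have "N - 6 * t * I \<le> int_inv6 \<phi>"
    proof -
      have "N - 6 * t * I = (\<integral>x. inverse (u x) ^ 6 - 6 * t * (inverse (u x) ^ 7 * \<psi> x) \<partial>mu)"
        unfolding b_N_I_e_def int_inv6_def
        by (subst Bochner_Integration.integral_diff)
          (auto intro!: integrable_mu_continuous continuous_on_mult continuous_on_const u_inverse_cont pc)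
      also have "\<dots> \<le> int_inv6 \<phi>"
        unfolding int_inv6_def
      proof (intro integral_mono_AE AE_mu_I)
        show "integrable mu (\<lambda>x. inverse (u x) ^ 6 - 6 * t * (inverse (u x) ^ 7 * \<psi> x))"
          by (intro integrable_mu_continuous continuous_on_diff continuous_on_mult continuous_on_const u_inverse_cont pc)
        show "integrable mu (\<lambda>x. inverse (\<phi> x) ^ 6)"
          using pos by (intro integrable_mu_continuous continuous_on_power continuous_on_inverse c\<phi>) (metis less_irrefl)
        fix x assume x: "x \<in> S3"
        have "inverse (u x) ^ 7 * u x = inverse (u x) ^ 6"
          using u_pos[OF x] by (simp add: field_simps power_numeral_reduce)
        then have "6 * inverse (u x) ^ 7 * \<phi> x = 6 * inverse (u x) ^ 6 + 6 * t * (inverse (u x) ^ 7 * \<psi> x)"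
          by (simp add: \<phi>_def distrib_left mult.assoc)
        then show "inverse (u x) ^ 6 - 6 * t * (inverse (u x) ^ 7 * \<psi> x) \<le> inverse (\<phi> x) ^ 6"
          using inverse_power_tangent[OF u_pos[OF x] pos[OF x]] by linarith
      qed
      finally show ?thesis .
    qed
    moreover have "(b - 2 * t * e - t\<^sup>2 * E \<epsilon> \<psi>) ^ 3 \<ge> 0" using d(2)[of t] t by simp
    ultimately have "G t \<le> int_inv6 \<phi> * (- E \<epsilon> \<phi>) ^ 3"
      unfolding G_def E\<phi> by (rule mult_right_mono)
    also have "\<dots> \<le> int_inv6 u * (- E \<epsilon> u) ^ 3" by (rule minimal_cube[OF H pos])
    finally show ?thesis by (simp add: G_def b_N_I_e_def)
  qed
  have D: "(G has_real_derivative (- 6 * I * b ^ 3 + N * (3 * b\<^sup>2 * (- 2 * e)))) (at 0)"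
    unfolding G_def[abs_def] by (auto intro!: derivative_eq_intros simp: power2_eq_square)
  have "- 6 * I * b ^ 3 + N * (3 * b\<^sup>2 * (- 2 * e)) = 0"
    by (rule DERIV_local_max[OF D, of "min d (l / C)"]) (use d l C le in auto)
  then have "(- 6 * b\<^sup>2) * (I * b + N * e) = 0"
    by (simp add: algebra_simps power2_eq_square power3_eq_cube)
  then have "I * b = - N * e" using b by simp
  then show ?thesis unfolding b_N_I_e_def .
qed

lemma green_sequence:
  assumes f: "continuous_on S3 f"
  obtains p where "\<And>n x. x \<in> S3 \<Longrightarrow> \<bar>zint (p n) f x - green \<epsilon> f x\<bar> \<le> inverse (real (Suc n))"
    "\<And>n x. x \<in> S3 \<Longrightarrow> \<bar>- zint (zonal_P \<epsilon> (p n)) f x - f x\<bar> \<le> inverse (real (Suc n))"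
proof -
  have "\<forall>n. \<exists>p. \<forall>x\<in>S3. \<bar>zint p f x - green \<epsilon> f x\<bar> \<le> inverse (real (Suc n))
      \<and> \<bar>- zint (zonal_P \<epsilon> p) f x - f x\<bar> \<le> inverse (real (Suc n))"
    using green_approximation[OF eps f] by simp
  then show ?thesis using that by metis
qed

lemma continuous_green:
  assumes f: "continuous_on S3 f" shows "continuous_on S3 (green \<epsilon> f)"
proof -
  have "continuous_on (S3 \<times> S3) (\<lambda>p. kern \<epsilon> (fst p \<bullet> snd p) * f (snd p))"
    using continuous_on_kern_inner[OF eps]
    by (intro continuous_on_mult continuous_on_compose2[OF f continuous_on_snd]) (auto simp: case_prod_beta continuous_on_id)
  then have c: "continuous_on (S3 \<times> S3) (\<lambda>(x, y). kern \<epsilon> (x \<bullet> y) * f y)" by (simp add: case_prod_beta)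
  have "continuous_on S3 (\<lambda>x. \<integral>y. kern \<epsilon> (x \<bullet> y) * f y \<partial>mu)"
    by (rule cont2_integral[OF c])
  then show ?thesis
    unfolding green_def[abs_def] using mass_pos by (intro continuous_intros) auto
qed

lemma green_pos:
  assumes f: "continuous_on S3 f" and pos: "\<And>x. x \<in> S3 \<Longrightarrow> f x > 0" and x: "x \<in> S3"
  shows "green \<epsilon> f x > 0"
proof -
  have k: "kern \<epsilon> (x \<bullet> y) > 0" if "y \<in> S3" for y
    by (rule kern_pos[OF eps inner_S3_le[OF x that]])
  have "(\<integral>y. kern \<epsilon> (x \<bullet> y) * f y \<partial>mu) > 0"
  proof (rule integral_mu_pos[OF _ _ x])
    show "continuous_on S3 (\<lambda>y. kern \<epsilon> (x \<bullet> y) * f y)"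
      by (intro continuous_on_mult continuous_on_kern_inner1 eps x f)
    show "kern \<epsilon> (x \<bullet> y) * f y \<ge> 0" if "y \<in> S3" for y using k[OF that] pos[OF that] by simp
    show "kern \<epsilon> (x \<bullet> x) * f x > 0" using k[OF x] pos[OF x] by simp
  qed
  then show ?thesis using mass_pos by (simp add: green_def)
qed

text \<open>Testing the Euler-Lagrange equation with the Green potential of its own right-hand side.\<close>

lemma green_energy_minimizer:
  "(\<integral>x. inverse (u x) ^ 7 * green \<epsilon> (\<lambda>x. inverse (u x) ^ 7) x \<partial>mu) * (- E \<epsilon> u) = (int_inv6 u)\<^sup>2"
proof -
  define f where "f x = inverse (u x) ^ 7" for x
  have f: "continuous_on S3 f" unfolding f_def by (rule u_inverse_cont)
  obtain p where p: "\<And>n x. x \<in> S3 \<Longrightarrow> \<bar>zint (p n) f x - green \<epsilon> f x\<bar> \<le> inverse (real (Suc n))"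
    "\<And>n x. x \<in> S3 \<Longrightarrow> \<bar>- zint (zonal_P \<epsilon> (p n)) f x - f x\<bar> \<le> inverse (real (Suc n))"
    using green_sequence[OF f] by blast
  obtain A where A: "A > 0" "\<And>x. x \<in> S3 \<Longrightarrow> \<bar>f x\<bar> \<le> A" using continuous_compact_bound[OF compact_sphere f] by metis
  obtain B where B: "B > 0" "\<And>x. x \<in> S3 \<Longrightarrow> \<bar>u x\<bar> \<le> B" using continuous_compact_bound[OF compact_sphere u_cont] by metis
  have EL: "(\<integral>x. f x * zint (p n) f x \<partial>mu) * (- E \<epsilon> u) = int_inv6 u * (\<integral>x. u x * (- zint (zonal_P \<epsilon> (p n)) f x) \<partial>mu)" for n
  proof -
    have "smooth_S3 (zint (p n) f)" by (simp add: smooth_S3_iff smooth_zint f)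
    from euler_lagrange[OF this] have "(\<integral>x. f x * zint (p n) f x \<partial>mu) * (- E \<epsilon> u)
        = - int_inv6 u * (\<integral>x. u x * paneitz \<epsilon> (radial_ext (zint (p n) f)) x \<partial>mu)" by (simp add: f_def[abs_def])
    also have "(\<integral>x. u x * paneitz \<epsilon> (radial_ext (zint (p n) f)) x \<partial>mu) = (\<integral>x. u x * zint (zonal_P \<epsilon> (p n)) f x \<partial>mu)"
      by (rule integral_mu_cong) (simp add: paneitz_zint[OF f])
    finally show ?thesis by simp
  qed
  have 1: "(\<lambda>n. \<integral>x. f x * zint (p n) f x \<partial>mu) \<longlonglongrightarrow> (\<integral>x. f x * green \<epsilon> f x \<partial>mu)"
  proof (rule integral_uniform_limit[where C=A])
    show "continuous_on S3 (\<lambda>x. f x * zint (p n) f x)" for n by (intro continuous_on_mult f continuous_on_zint)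
    show "continuous_on S3 (\<lambda>x. f x * green \<epsilon> f x)" by (intro continuous_on_mult f continuous_green)
    show "\<bar>f x * zint (p n) f x - f x * green \<epsilon> f x\<bar> \<le> A * inverse (real (Suc n))" if "x \<in> S3" for n x
      unfolding right_diff_distrib[symmetric] abs_mult using A p(1)[OF that] that by (intro mult_mono) auto
  qed
  have 2: "(\<lambda>n. \<integral>x. u x * (- zint (zonal_P \<epsilon> (p n)) f x) \<partial>mu) \<longlonglongrightarrow> (\<integral>x. u x * f x \<partial>mu)"
  proof (rule integral_uniform_limit[where C=B])
    show "continuous_on S3 (\<lambda>x. u x * (- zint (zonal_P \<epsilon> (p n)) f x))" for n
      by (intro continuous_on_mult continuous_on_minus u_cont continuous_on_zint f)
    show "continuous_on S3 (\<lambda>x. u x * f x)" by (intro continuous_on_mult f u_cont)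
    show "\<bar>u x * (- zint (zonal_P \<epsilon> (p n)) f x) - u x * f x\<bar> \<le> B * inverse (real (Suc n))" if "x \<in> S3" for n x
      unfolding right_diff_distrib[symmetric] abs_mult using B p(2)[OF that] that by (intro mult_mono) auto
  qed
  have "(\<lambda>n. int_inv6 u * (\<integral>x. u x * (- zint (zonal_P \<epsilon> (p n)) f x) \<partial>mu)) \<longlonglongrightarrow> (\<integral>x. f x * green \<epsilon> f x \<partial>mu) * (- E \<epsilon> u)"
    using tendsto_mult_right[OF 1, of "- E \<epsilon> u"] unfolding EL .
  then have "(\<integral>x. f x * green \<epsilon> f x \<partial>mu) * (- E \<epsilon> u) = int_inv6 u * (\<integral>x. u x * f x \<partial>mu)"
    using tendsto_mult_left[OF 2, of "int_inv6 u"] by (rule LIMSEQ_unique)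
  also have "(\<integral>x. u x * f x \<partial>mu) = int_inv6 u"
    unfolding int_inv6_def
  proof (rule integral_mu_cong)
    show "u x * f x = inverse (u x) ^ 6" if "x \<in> S3" for x
      using u_pos[OF that] by (simp add: f_def field_simps power_numeral_reduce)
  qed
  finally show ?thesis by (simp add: f_def[abs_def] power2_eq_square)
qed

text \<open>The minimality of \<open>u\<close> is tested with approximations of the Green potential of \<open>v\<^sup>-\<^sup>7\<close>. The tangent
  estimate for a suitable multiple of the competitor plays the role of the reverse Hoelder inequality.\<close>

lemma green_energy_lower_bound:
  assumes vc: "continuous_on S3 v" and vpos: "\<And>x. x \<in> S3 \<Longrightarrow> v x > 0" and Nv: "int_inv6 v = int_inv6 u"
  shows "(int_inv6 u)\<^sup>2 \<le> (\<integral>x. inverse (v x) ^ 7 * green \<epsilon> (\<lambda>x. inverse (v x) ^ 7) x \<partial>mu) * (- E \<epsilon> u)"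
proof -
  define g where "g x = inverse (v x) ^ 7" for x
  have vi: "continuous_on S3 (\<lambda>x. inverse (v x) ^ k)" for k
    using vpos by (intro continuous_intros vc) (metis less_irrefl)
  have g: "continuous_on S3 g" unfolding g_def by (rule vi)
  have gpos: "g x > 0" if "x \<in> S3" for x using vpos[OF that] by (simp add: g_def)
  define S where "S = (\<integral>x. g x * green \<epsilon> g x \<partial>mu)"
  define N b where "N = int_inv6 u" "b = - E \<epsilon> u"
  have Nv': "N = (\<integral>x. inverse (v x) ^ 6 \<partial>mu)" using Nv by (simp add: N_b_def int_inv6_def)
  have N: "N > 0" unfolding N_b_def by (rule int_inv6_pos[OF u_cont u_pos])
  have b: "b > 0" using E_u_neg by (simp add: N_b_def)
  have Kc: "continuous_on S3 (green \<epsilon> g)" by (rule continuous_green[OF g])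
  have Kpos: "green \<epsilon> g x > 0" if "x \<in> S3" for x by (rule green_pos[OF g gpos that])
  have S: "S > 0" unfolding S_def
    by (rule integral_mu_pos[of _ "axis 1 1"])
      (use gpos Kpos in \<open>auto intro!: continuous_on_mult g Kc less_imp_le[OF mult_pos_pos] simp: norm_axis_1\<close>)
  obtain p where p: "\<And>n x. x \<in> S3 \<Longrightarrow> \<bar>zint (p n) g x - green \<epsilon> g x\<bar> \<le> inverse (real (Suc n))"
    "\<And>n x. x \<in> S3 \<Longrightarrow> \<bar>- zint (zonal_P \<epsilon> (p n)) g x - g x\<bar> \<le> inverse (real (Suc n))"
    using green_sequence[OF g] by blast
  obtain A where A: "A > 0" "\<And>x. x \<in> S3 \<Longrightarrow> \<bar>g x\<bar> \<le> A" using continuous_compact_bound[OF compact_sphere g] by metis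
  obtain B where B: "B > 0" "\<And>x. x \<in> S3 \<Longrightarrow> \<bar>green \<epsilon> g x\<bar> \<le> B" using continuous_compact_bound[OF compact_sphere Kc] by metis
  obtain l where l: "l > 0" "\<And>x. x \<in> S3 \<Longrightarrow> l \<le> green \<epsilon> g x" using positive_S3_lower_bound[OF Kc Kpos] by blast
  define w where "w n = zint (p n) g" for n
  define q where "q n x = - zint (zonal_P \<epsilon> (p n)) g x" for n x
  have wc: "continuous_on S3 (w n)" for n unfolding w_def by (rule continuous_on_zint[OF g])
  have qc: "continuous_on S3 (q n)" for n unfolding q_def by (intro continuous_on_minus continuous_on_zint g)
  have sw: "smooth_S3 (w n)" for n by (simp add: w_def smooth_S3_iff smooth_zint g)
  define Sn bn where "Sn n = (\<integral>x. g x * w n x \<partial>mu)" "bn n = - E \<epsilon> (w n)" for n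
  have bn: "bn n = (\<integral>x. w n x * q n x \<partial>mu)" for n
  proof -
    have "E \<epsilon> (w n) = (\<integral>x. w n x * paneitz \<epsilon> (radial_ext (w n)) x \<partial>mu)" by (rule E_smooth[OF sw])
    also have "\<dots> = (\<integral>x. - (w n x * q n x) \<partial>mu)"
      by (rule integral_mu_cong) (simp add: w_def q_def paneitz_zint[OF g])
    finally show ?thesis by (simp add: Sn_bn_def)
  qed
  have limS: "Sn \<longlonglongrightarrow> S"
    unfolding Sn_bn_def[abs_def] S_def
  proof (rule integral_uniform_limit[where C=A])
    show "continuous_on S3 (\<lambda>x. g x * w n x)" for n by (intro continuous_on_mult g wc)
    show "continuous_on S3 (\<lambda>x. g x * green \<epsilon> g x)" by (intro continuous_on_mult g Kc)
    show "\<bar>g x * w n x - g x * green \<epsilon> g x\<bar> \<le> A * inverse (real (Suc n))" if "x \<in> S3" for n x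
      unfolding right_diff_distrib[symmetric] abs_mult w_def using A p(1)[OF that] that by (intro mult_mono) auto
  qed
  have limb: "bn \<longlonglongrightarrow> S"
  proof -
    have "(\<lambda>n. \<integral>x. w n x * q n x \<partial>mu) \<longlonglongrightarrow> (\<integral>x. green \<epsilon> g x * g x \<partial>mu)"
    proof (rule integral_uniform_limit[where C="(A + 1) + B"])
      show "continuous_on S3 (\<lambda>x. w n x * q n x)" for n by (intro continuous_on_mult qc wc)
      show "continuous_on S3 (\<lambda>x. green \<epsilon> g x * g x)" by (intro continuous_on_mult g Kc)
      fix n x assume x: "x \<in> S3"
      have i1: "inverse (real (Suc n)) \<le> 1" by (simp add: field_simps)
      have q1: "\<bar>q n x - g x\<bar> \<le> inverse (real (Suc n))" using p(2)[OF x] by (simp add: q_def)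
      have w1: "\<bar>w n x - green \<epsilon> g x\<bar> \<le> inverse (real (Suc n))" using p(1)[OF x] by (simp add: w_def)
      have qA: "\<bar>q n x\<bar> \<le> A + 1" using q1 i1 A(2)[OF x] by linarith
      have "w n x * q n x - green \<epsilon> g x * g x = q n x * (w n x - green \<epsilon> g x) + green \<epsilon> g x * (q n x - g x)"
        by (simp add: algebra_simps)
      then have "\<bar>w n x * q n x - green \<epsilon> g x * g x\<bar> \<le> \<bar>q n x\<bar> * \<bar>w n x - green \<epsilon> g x\<bar> + \<bar>green \<epsilon> g x\<bar> * \<bar>q n x - g x\<bar>"
        by (metis abs_mult abs_triangle_ineq)
      also have "\<dots> \<le> (A + 1) * inverse (real (Suc n)) + B * inverse (real (Suc n))"
        using qA q1 w1 B(2)[OF x] A(1) B(1) by (intro add_mono mult_mono) auto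
      finally show "\<bar>w n x * q n x - green \<epsilon> g x * g x\<bar> \<le> ((A + 1) + B) * inverse (real (Suc n))"
        by (simp only: distrib_right)
    qed
    then show ?thesis unfolding bn[abs_def] S_def by (simp add: mult.commute bn)
  qed
  have "eventually (\<lambda>n. inverse (real (Suc n)) < l) sequentially"
    by (rule order_tendstoD(2)[OF LIMSEQ_inverse_real_of_nat l(1)])
  moreover have "eventually (\<lambda>n. bn n > 0) sequentially" by (rule order_tendstoD(1)[OF limb S])
  moreover have "eventually (\<lambda>n. Sn n > 0) sequentially" by (rule order_tendstoD(1)[OF limS S])
  ultimately have ev: "eventually (\<lambda>n. N ^ 7 * bn n ^ 3 \<le> (N * b ^ 3) * Sn n ^ 6) sequentially"
  proof eventually_elim
    case (elim n)
    have wpos: "w n x > 0" if "x \<in> S3" for x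
      using p(1)[OF that, of n] l(2)[OF that] elim by (simp add: w_def)
    have wi: "continuous_on S3 (\<lambda>x. inverse (w n x) ^ 6)"
      using wpos by (intro continuous_intros wc) (metis less_irrefl)
    \<comment> \<open>This factor maximizes the lower bound for the integral of the power \<open>-6\<close> of the competitor.\<close>
    define L where "L = N / Sn n"
    have lam: "L > 0" using N elim by (simp add: L_def)
    have "7 * N - 6 * L * Sn n \<le> inverse L ^ 6 * int_inv6 (w n)"
    proof -
      have "7 * N - 6 * L * Sn n = (\<integral>x. 7 * inverse (v x) ^ 6 - 6 * L * (g x * w n x) \<partial>mu)"
        unfolding Nv' Sn_bn_def
        by (subst Bochner_Integration.integral_diff)
          (auto intro!: integrable_mu_continuous continuous_on_mult continuous_on_const vi g wc)
      also have "\<dots> \<le> (\<integral>x. inverse L ^ 6 * inverse (w n x) ^ 6 \<partial>mu)"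
      proof (intro integral_mono_AE AE_mu_I)
        show "integrable mu (\<lambda>x. 7 * inverse (v x) ^ 6 - 6 * L * (g x * w n x))"
          by (intro integrable_mu_continuous continuous_on_diff continuous_on_mult continuous_on_const vi g wc)
        show "integrable mu (\<lambda>x. inverse L ^ 6 * inverse (w n x) ^ 6)"
          by (intro integrable_mu_continuous continuous_on_mult continuous_on_const wi)
        fix x assume x: "x \<in> S3"
        show "7 * inverse (v x) ^ 6 - 6 * L * (g x * w n x) \<le> inverse L ^ 6 * inverse (w n x) ^ 6"
          using inverse_power_tangent[OF vpos[OF x] mult_pos_pos[OF lam wpos[OF x]]]
          by (simp add: g_def power_mult_distrib mult_ac)
      qed
      finally show ?thesis by (simp add: int_inv6_def)
    qed
    then have "N \<le> inverse L ^ 6 * int_inv6 (w n)" using elim by (simp add: L_def)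
    then have "N ^ 7 \<le> int_inv6 (w n) * Sn n ^ 6"
      using N elim by (simp add: L_def field_simps power_numeral_reduce)
    then have "N ^ 7 * bn n ^ 3 \<le> (int_inv6 (w n) * Sn n ^ 6) * bn n ^ 3"
      using elim by (intro mult_right_mono) auto
    also have "\<dots> = (int_inv6 (w n) * bn n ^ 3) * Sn n ^ 6" by simp
    also have "\<dots> \<le> (N * b ^ 3) * Sn n ^ 6"
      unfolding Sn_bn_def(2) N_b_def
      by (intro mult_right_mono minimal_cube smooth_in_H2 sw wpos) (use elim in auto)
    finally show ?case .
  qed
  have "N ^ 7 * S ^ 3 \<le> (N * b ^ 3) * S ^ 6"
    by (rule tendsto_le[OF sequentially_bot _ _ ev]) (intro tendsto_intros limS limb)+
  then have "(N * S ^ 3) * (N\<^sup>2) ^ 3 \<le> (N * S ^ 3) * (S * b) ^ 3"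
    by (simp add: power_mult_distrib power_mult[symmetric] power_numeral_reduce mult_ac)
  then have "(N\<^sup>2) ^ 3 \<le> (S * b) ^ 3"
    using N S by (simp add: mult_le_cancel_left)
  then have "N\<^sup>2 \<le> S * b"
    by (subst (asm) power_mono_iff) (use S b in auto)
  then show ?thesis unfolding N_b_def S_def g_def[abs_def] .
qed

end

section \<open>Radial symmetry\<close>

text \<open>Otherwise polarization would strictly lower the energy of \<open>u\<^sup>-\<^sup>7\<close> below the bound that holds for
  every positive function with the same integral of the power \<open>-6\<close>.\<close>

lemma minimizer_polarized:
  assumes eps: "0 < \<epsilon>" "\<epsilon> < 15/16" and u: "u \<in> positive_H2"
    and minimal: "\<And>\<phi>. \<phi> \<in> positive_H2 \<Longrightarrow> J \<epsilon> u \<le> J \<epsilon> \<phi>" and e: "e \<in> S3"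
  shows "(\<forall>x\<in>S3. x \<bullet> e \<ge> 0 \<longrightarrow> u x \<le> u (mirror e x)) \<or> (\<forall>x\<in>S3. x \<bullet> e \<ge> 0 \<longrightarrow> u (mirror e x) \<le> u x)"
proof (rule ccontr)
  assume "\<not> ?thesis"
  then obtain x0 y0 where xy: "x0 \<in> S3" "x0 \<bullet> e \<ge> 0" "u x0 > u (mirror e x0)"
    "y0 \<in> S3" "y0 \<bullet> e \<ge> 0" "u (mirror e y0) > u y0" by (auto simp: not_le)
  have uc: "continuous_on S3 u" and up: "u x > 0" if "x \<in> S3" for x
    using u that by (auto simp: positive_H2_def H2_def)
  have uc: "continuous_on S3 u" using u by (auto simp: positive_H2_def H2_def)
  define v where "v = polarize e u"
  have vc: "continuous_on S3 v" unfolding v_def by (rule continuous_polarize[OF e uc])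
  have vp: "v x > 0" if "x \<in> S3" for x
    using polarize_swap[OF e, of u x] up[OF that] up[OF mirror_S3[OF e that]] by (auto simp: v_def)
  have inv: "inverse a ^ 7 \<le> inverse b ^ 7" if "b \<le> a" "0 < b" for a b :: real
    using that by (intro power_mono) (auto simp: le_imp_inverse_le)
  have inv': "inverse a ^ 7 < inverse b ^ 7" if "b < a" "0 < b" for a b :: real
    using that by (intro power_strict_mono) (auto simp: less_imp_inverse_less)
  have "(\<integral>x. inverse (v x) ^ 7 * green \<epsilon> (\<lambda>x. inverse (v x) ^ 7) x \<partial>mu)
      < (\<integral>x. inverse (u x) ^ 7 * green \<epsilon> (\<lambda>x. inverse (u x) ^ 7) x \<partial>mu)"
  proof (rule polarization_strict[OF eps e _ _ _ _ xy(1,2) _ xy(4,5)])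
    show "continuous_on S3 (\<lambda>x. inverse (u x) ^ 7)" "continuous_on S3 (\<lambda>x. inverse (v x) ^ 7)"
      using up vp by (intro continuous_intros uc vc; metis less_irrefl)+
    show "inverse (v (mirror e x)) ^ 7 \<le> inverse (v x) ^ 7" if "x \<in> S3" "x \<bullet> e \<ge> 0" for x
      by (intro inv vp that(1)) (simp add: v_def polarize_order[OF e that(2)])
    show "inverse (u x0) ^ 7 < inverse (u (mirror e x0)) ^ 7"
      by (intro inv' up mirror_S3[OF e] xy)
    show "inverse (u (mirror e y0)) ^ 7 < inverse (u y0) ^ 7"
      by (intro inv' up xy)
    fix x
    show "(inverse (v x) ^ 7 = inverse (u x) ^ 7 \<and> inverse (v (mirror e x)) ^ 7 = inverse (u (mirror e x)) ^ 7) \<or>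
          (inverse (v x) ^ 7 = inverse (u (mirror e x)) ^ 7 \<and> inverse (v (mirror e x)) ^ 7 = inverse (u x) ^ 7)"
      using polarize_swap[OF e, of u x] by (auto simp: v_def)
  qed
  moreover have "(int_inv6 u)\<^sup>2 \<le> (\<integral>x. inverse (v x) ^ 7 * green \<epsilon> (\<lambda>x. inverse (v x) ^ 7) x \<partial>mu) * (- E \<epsilon> u)"
    by (rule green_energy_lower_bound[OF eps u minimal vc vp]) (use int_inv6_polarize[OF e uc up] in \<open>simp_all add: v_def\<close>)
  moreover have "(\<integral>x. inverse (u x) ^ 7 * green \<epsilon> (\<lambda>x. inverse (u x) ^ 7) x \<partial>mu) * (- E \<epsilon> u) = (int_inv6 u)\<^sup>2"
    by (rule green_energy_minimizer[OF eps u minimal])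
  moreover have "- E \<epsilon> u > 0" using E_u_neg[OF eps u minimal] by simp
  ultimately show False by (smt (verit) mult_strict_right_mono)
qed

text \<open>Choose the hyperplane that interchanges \<open>x\<close> and \<open>y\<close>. If the values on the side of \<open>x\<close> were the smaller
  ones, the center of mass would lie on the side of \<open>y\<close>, unless \<open>f\<close> is invariant under the reflection.\<close>

lemma polarized_monotone:
  fixes f :: "real^4 \<Rightarrow> real"
  assumes f: "continuous_on S3 f"
    and pol: "\<And>e. e \<in> S3 \<Longrightarrow> (\<forall>x\<in>S3. x \<bullet> e \<ge> 0 \<longrightarrow> f (mirror e x) \<le> f x) \<or> (\<forall>x\<in>S3. x \<bullet> e \<ge> 0 \<longrightarrow> f x \<le> f (mirror e x))"
    and x: "x \<in> S3" and y: "y \<in> S3"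
    and c: "(\<integral>z. f z *\<^sub>R z \<partial>mu) \<bullet> y \<le> (\<integral>z. f z *\<^sub>R z \<partial>mu) \<bullet> x"
  shows "f y \<le> f x"
proof (cases "x = y")
  case False
  define e where "e = (x - y) /\<^sub>R norm (x - y)"
  have n: "norm (x - y) > 0" using False by simp
  have e: "e \<in> S3" using False by (simp add: e_def)
  have xx: "x \<bullet> x = 1" "y \<bullet> y = 1" using x y by (simp_all add: norm_eq_1)
  have sq: "norm (x - y) * norm (x - y) = 2 - 2 * (x \<bullet> y)"
    using xx power2_norm_eq_inner[of "x - y"] by (simp add: power2_eq_square inner_diff_left inner_diff_right inner_commute)
  have "x \<bullet> e = (1 - x \<bullet> y) / norm (x - y)"
    using xx by (simp add: e_def inner_diff_right divide_inverse mult.commute)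
  also have "\<dots> = norm (x - y) / 2" using sq n by (simp add: field_simps)
  finally have xe: "x \<bullet> e = norm (x - y) / 2" .
  have ry: "mirror e x = y" unfolding mirror_def xe using n by (simp add: e_def)
  have "f (mirror e x) \<le> f x"
    using pol[OF e]
  proof
    assume a: "\<forall>x\<in>S3. x \<bullet> e \<ge> 0 \<longrightarrow> f x \<le> f (mirror e x)"
    define h where "h z = (z \<bullet> e) * (f (mirror e z) - f z)" for z
    have fr: "continuous_on S3 (\<lambda>z. f (mirror e z))" by (rule continuous_mirror_compose[OF e f])
    have hc: "continuous_on S3 h" unfolding h_def by (intro continuous_intros f fr)
    have h0: "h z \<ge> 0" if z: "z \<in> S3" for z
    proof (cases "z \<bullet> e \<ge> 0")
      case True
      then show ?thesis using a z by (simp add: h_def)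
    next
      case False
      then have "f (mirror e z) \<le> f z"
        using a[rule_format, OF mirror_S3[OF e z]] by (simp add: mirror_inner(3)[OF e] mirror_mirror[OF e])
      then show ?thesis using False by (simp add: h_def mult_nonpos_nonpos)
    qed
    have fc: "continuous_on S3 (\<lambda>z. (z \<bullet> e) * f z)" by (intro continuous_intros f)
    have frc: "continuous_on S3 (\<lambda>z. (z \<bullet> e) * f (mirror e z))" by (intro continuous_intros fr)
    have iz: "integrable mu (\<lambda>z. f z *\<^sub>R z)" by (intro integrable_mu_continuous continuous_intros f)
    have ce: "(\<integral>z. (z \<bullet> e) * f z \<partial>mu) = (\<integral>z. f z *\<^sub>R z \<partial>mu) \<bullet> e"
      using integral_inner_left[OF iz, of e] by (simp add: mult.commute)
    have "(\<integral>z. f z *\<^sub>R z \<partial>mu) \<bullet> e \<ge> 0"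
      using c n by (simp add: e_def inner_diff_right)
    moreover have "(\<integral>z. (z \<bullet> e) * f (mirror e z) \<partial>mu) = - (\<integral>z. (z \<bullet> e) * f z \<partial>mu)"
    proof -
      have "(\<integral>z. (z \<bullet> e) * f z \<partial>mu) = (\<integral>z. (mirror e z \<bullet> e) * f (mirror e z) \<partial>mu)"
        by (rule integral_mu_orthogonal[OF mirror_orthogonal[OF e] fc, symmetric])
      then show ?thesis by (simp add: mirror_inner(3)[OF e])
    qed
    then have "(\<integral>z. h z \<partial>mu) = - 2 * (\<integral>z. (z \<bullet> e) * f z \<partial>mu)"
      using integrable_mu_continuous[OF fc] integrable_mu_continuous[OF frc]
      by (simp add: h_def right_diff_distrib)
    moreover have "(\<integral>z. h z \<partial>mu) \<ge> 0" using h0 by (intro integral_nonneg_AE AE_mu_I)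
    ultimately have "(\<integral>z. h z \<partial>mu) = 0" using ce by linarith
    from integral_mu_nonneg_eq_0[OF hc h0 this x] show ?thesis
      using xe n by (simp add: h_def)
  next
    assume a: "\<forall>x\<in>S3. x \<bullet> e \<ge> 0 \<longrightarrow> f (mirror e x) \<le> f x"
    have "x \<bullet> e \<ge> 0" unfolding xe by simp
    then show ?thesis using a x by blast
  qed
  then show ?thesis by (simp add: ry)
qed simp

theorem mainTheorem2:
  "\<exists>\<epsilon>\<^sub>0>0. \<forall>\<epsilon>. 0 < \<epsilon> \<and> \<epsilon> < \<epsilon>\<^sub>0 \<longrightarrow>
     (\<forall>u\<in>positive_H2. (\<forall>\<phi>\<in>positive_H2. J \<epsilon> u \<le> J \<epsilon> \<phi>) \<longrightarrow>
        (\<exists>e\<in>S3. \<exists>g :: real \<Rightarrow> real. mono_on {-1..1} g \<and> (\<forall>x\<in>S3. u x = g (x \<bullet> e))))"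
proof (intro exI[of _ "15/16"] conjI allI impI ballI)
  fix \<epsilon> :: real and u
  assume eps: "0 < \<epsilon> \<and> \<epsilon> < 15/16" and u: "u \<in> positive_H2"
    and minimal: "\<forall>\<phi>\<in>positive_H2. J \<epsilon> u \<le> J \<epsilon> \<phi>"
  have uc: "continuous_on S3 u" using u by (auto simp: positive_H2_def H2_def)
  have up: "u x > 0" if "x \<in> S3" for x using u that by (auto simp: positive_H2_def)
  define f where "f x = inverse (u x) ^ 7" for x
  have f: "continuous_on S3 f"
    unfolding f_def using up by (intro continuous_intros uc) (metis less_irrefl)
  have f_le: "f x \<le> f y \<longleftrightarrow> u y \<le> u x" if "x \<in> S3" "y \<in> S3" for x y
    using up[OF that(1)] up[OF that(2)] by (simp add: f_def power_mono_iff)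
  define c where "c = (\<integral>z. f z *\<^sub>R z \<partial>mu)"
  have mono: "u x \<le> u y" if x: "x \<in> S3" and y: "y \<in> S3" and "c \<bullet> y \<le> c \<bullet> x" for x y
  proof -
    have "f y \<le> f x"
    proof (rule polarized_monotone[OF f _ x y])
      fix e :: "real^4" assume e: "e \<in> S3"
      show "(\<forall>x\<in>S3. x \<bullet> e \<ge> 0 \<longrightarrow> f (mirror e x) \<le> f x) \<or> (\<forall>x\<in>S3. x \<bullet> e \<ge> 0 \<longrightarrow> f x \<le> f (mirror e x))"
      proof -
        have f_mirror: "f (mirror e x) \<le> f x \<longleftrightarrow> u x \<le> u (mirror e x)" "f x \<le> f (mirror e x) \<longleftrightarrow> u (mirror e x) \<le> u x"
          if "x \<in> S3" for x
          by (rule f_le[OF mirror_S3[OF e that] that], rule f_le[OF that mirror_S3[OF e that]])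
        have "(\<forall>x\<in>S3. x \<bullet> e \<ge> 0 \<longrightarrow> u x \<le> u (mirror e x)) \<or> (\<forall>x\<in>S3. x \<bullet> e \<ge> 0 \<longrightarrow> u (mirror e x) \<le> u x)"
          by (rule minimizer_polarized[OF _ _ u _ e]) (use eps minimal in auto)
        then show ?thesis using f_mirror by blast
      qed
    next
      show "(\<integral>z. f z *\<^sub>R z \<partial>mu) \<bullet> y \<le> (\<integral>z. f z *\<^sub>R z \<partial>mu) \<bullet> x" using that by (simp add: c_def)
    qed
    then show ?thesis using f_le[OF y x] by simp
  qed
  define e :: "real^4" where "e = (if c = 0 then axis 1 1 else - (c /\<^sub>R norm c))"
  have e: "e \<in> S3" by (simp add: e_def norm_axis_1)
  have ce: "c = - (norm c *\<^sub>R e)" by (simp add: e_def)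
  have mono_e: "u x \<le> u y" if "x \<in> S3" "y \<in> S3" "x \<bullet> e \<le> y \<bullet> e" for x y
  proof (rule mono[OF that(1,2)])
    have "norm c * (x \<bullet> e) \<le> norm c * (y \<bullet> e)" using that(3) by (rule mult_left_mono) simp
    then show "c \<bullet> y \<le> c \<bullet> x"
      by (subst (1 2) ce) (simp add: inner_commute)
  qed
  \<comment> \<open>A meridian through \<open>e\<close>, parametrized by its height.\<close>
  define pt where "pt s = s *\<^sub>R e + sqrt (1 - s\<^sup>2) *\<^sub>R quat 1 e" for s
  have pt: "pt s \<in> S3" "pt s \<bullet> e = s" if "s \<in> {-1..1}" for s
  proof -
    have ee: "e \<bullet> e = 1" "quat 1 e \<bullet> quat 1 e = 1" "quat 1 e \<bullet> e = 0" "e \<bullet> quat 1 e = 0"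
    proof -
      have n: "norm e = 1" "norm (quat 1 e) = 1" using e quat_norm[of 1 e] by auto
      show "e \<bullet> e = 1" "quat 1 e \<bullet> quat 1 e = 1" using n by (simp_all only: norm_eq_1)
      show "quat 1 e \<bullet> e = 0" "e \<bullet> quat 1 e = 0" using quat_inner_self[of 1 e] by (simp_all add: inner_commute)
    qed
    show "pt s \<bullet> e = s" by (simp add: pt_def inner_add_left ee)
    have "s\<^sup>2 \<le> 1" using that by (simp add: abs_square_le_1 abs_le_iff)
    then have "pt s \<bullet> pt s = 1"
      by (simp add: pt_def inner_add_left inner_add_right ee power2_eq_square[symmetric])
    then show "pt s \<in> S3" by (simp add: norm_eq_1)
  qed
  define g where "g s = u (pt s)" for s
  have "mono_on {-1..1} g"
  proof (rule mono_onI)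
    fix r s :: real assume rs: "r \<in> {-1..1}" "s \<in> {-1..1}" "r \<le> s"
    show "g r \<le> g s"
      unfolding g_def
      by (rule mono_e[OF pt(1)[OF rs(1)] pt(1)[OF rs(2)]]) (simp only: pt(2)[OF rs(1)] pt(2)[OF rs(2)] rs(3))
  qed
  moreover have "\<forall>x\<in>S3. u x = g (x \<bullet> e)"
  proof
    fix x assume x: "x \<in> S3"
    have "x \<bullet> e \<in> {-1..1}" using inner_S3_le[OF x e] by (simp add: abs_le_iff)
    then show "u x = g (x \<bullet> e)"
      unfolding g_def using mono_e[OF x pt(1)] mono_e[OF pt(1) x] pt(2) by (simp add: order_antisym)
  qed
  ultimately show "\<exists>e\<in>S3. \<exists>g :: real \<Rightarrow> real. mono_on {-1..1} g \<and> (\<forall>x\<in>S3. u x = g (x \<bullet> e))"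
    using e by blast
qed simp

end
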